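(* Let $T=(T_1,\dots,T_k)\in\mathbf B_\Lambda(\mathcal H)$ and $T'=(T_1',\dots,T_k')\in\mathbf B_\Lambda(\mathcal H')$ be two completely non-coisometric $k$-tuples which admit characteristic functions. Then $T$ and $T'$ are unitarily equivalent if and only if their characteristic functions $\Theta_T$ and $\Theta_{T'}$ coincide.
   Context: Let $k,n_1,\dots,n_k$ be positive integers. For $i,j\in\{1,\dots,k\}$, $i\ne j$, let $\Lambda_{ij}=[\lambda_{i,j}(s,t)]$ be an $n_i\times n_j$ matrix with entries in $\mathbb T=\{z\in\mathbb C:|z|=1\}$, with $\Lambda_{ji}=\Lambda_{ij}^*$, i.e. $\lambda_{j,i}(t,s)=\overline{\lambda_{i,j}(s,t)}$. Words: $\mathbb F_{n_i}^+$ is the unital free semigroup with generators $g^i_1,\dots,g^i_{n_i}$ and neutral element $g^i_0$. If $X_{i,1},\dots,X_{i,n_i}$ are operators and $\alpha=g^i_{p_1}\cdots g^i_{p_m}$, put $X_{i,\alpha}=X_{i,p_1}\cdots X_{i,p_m}$, and $X_{i,g^i_0}=I$. Set $\mathbf F=\mathbb F_{n_1}^+\times\cdots\times\mathbb F_{n_k}^+$. Universal model: on $\ell^2(\mathbf F)$ with orthonormal basis $\{\chi_{(\alpha_1,\dots,\alpha_k)}\}$, $$S_{i,s}\chi_{(\alpha_1,\dots,\alpha_k)}=\boldsymbol\lambda_{i,1}(s,\alpha_1)\cdots\boldsymbol\lambda_{i,i-1}(s,\alpha_{i-1})\,\chi_{(\alpha_1,\dots,\alpha_{i-1},g^i_s\alpha_i,\alpha_{i+1},\dots,\alpha_k)}$$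 (no scalar factor if $i=1$), where $\boldsymbol\lambda_{i,j}(s,\beta)=\prod_{b=1}^q\lambda_{i,j}(s,j_b)$ for $\beta=g^j_{j_1}\cdots g^j_{j_q}$ and $\boldsymbol\lambda_{i,j}(s,g^j_0)=1$. Regular $\Lambda$-polyball: $\mathbf B_\Lambda(\mathcal H)$ is the set of $k$-tuples $T=(T_1,\dots,T_k)$ of row contractions $T_i=[T_{i,1}\cdots T_{i,n_i}]$, $T_{i,s}\in B(\mathcal H)$, $\sum_sT_{i,s}T_{i,s}^*\le I$, such that $T_{i,s}T_{j,t}=\lambda_{i,j}(s,t)T_{j,t}T_{i,s}$ for all $i\ne j$ and all $s,t$, and $\Delta_{rT}(I)\ge0$ for all $r\in[0,1)$, where $\Phi_{T_i}(X)=\sum_sT_{i,s}XT_{i,s}^*$, $\Delta_T(I)=(\mathrm{id}-\Phi_{T_k})\circ\cdots\circ(\mathrm{id}-\Phi_{T_1})(I)$ and $rT$ has entries $rT_{i,s}$; then also $\Delta_T(I)\ge0$. $T$ is completely non-coisometric if there is no $h\in\mathcal H$, $h\ne0$, with $\langle(\mathrm{id}-\Phi_{T_k}^{p_k})\circ\cdots\circ(\mathrm{id}-\Phi_{T_1}^{p_1})(I)h,h\rangle=0$ for all $(p_1,\dots,p_k)\in\mathbb N^k$. Tuples $T$ on $\mathcal H$ and $T'$ on $\mathcal H'$ are unitarily equivalent if there is a unitary $W:\mathcal H\to\mathcal H'$ with $T_{i,s}=W^*T'_{i,s}W$ for all $i,s$. Berezin kernel: $K_T:\mathcal H\to\ell^2(\mathbf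 F)\otimes\overline{\Delta_T(I)\mathcal H}$, $K_Th=\sum_{(\beta_1,\dots,\beta_k)\in\mathbf F}\chi_{(\beta_1,\dots,\beta_k)}\otimes\Delta_T(I)^{1/2}T_{k,\beta_k}^*\cdots T_{1,\beta_1}^*h$; it is a contraction. A bounded operator $A:\ell^2(\mathbf F)\otimes\mathcal E\to\ell^2(\mathbf F)\otimes\mathcal K$ is multi-analytic if $A(S_{i,s}\otimes I_{\mathcal E})=(S_{i,s}\otimes I_{\mathcal K})A$ for all $i,s$. Two multi-analytic operators $A:\ell^2(\mathbf F)\otimes\mathcal K_1\to\ell^2(\mathbf F)\otimes\mathcal K_2$ and $A':\ell^2(\mathbf F)\otimes\mathcal K_1'\to\ell^2(\mathbf F)\otimes\mathcal K_2'$ coincide if there are unitary operators $u_j:\mathcal K_j\to\mathcal K_j'$, $j=1,2$, with $A'(I\otimes u_1)=(I\otimes u_2)A$. $T\in\mathbf B_\Lambda(\mathcal H)$ admits a characteristic function if there are a Hilbert space $\mathcal E$ and a multi-analytic $\Psi:\ell^2(\mathbf F)\otimes\mathcal E\to\ell^2(\mathbf F)\otimes\overline{\Delta_T(I)\mathcal H}$ with $K_TK_T^*+\Psi\Psi^*=I$. In that case the characteristic function $\Theta_T$ is the following multi-analytic operator. Let $Y=I-K_TK_T^*$ and $\mathcal M_T=\overline{\mathrm{range}\,Y}$. Define $A_{i,s}\in B(\mathcal M_T)$ uniquely by $A_{i,s}(Y^{1/2}f)=Y^{1/2}(S_{i,s}^*\otimes I)f$ for $f\in\ell^2(\mathbf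 F)\otimes\overline{\Delta_T(I)\mathcal H}$, and put $M_{i,s}=A_{i,s}^*$, $M_i=(M_{i,1},\dots,M_{i,n_i})$, $M_T=(M_1,\dots,M_k)$. Then $M_T$ is a pure element of $\mathbf B_\Lambda(\mathcal M_T)$ (i.e. $\Phi_{M_i}^p(I)\to0$ for each $i$), with Berezin kernel $K_{M_T}:\mathcal M_T\to\ell^2(\mathbf F)\otimes\overline{\Delta_{M_T}(I)\mathcal M_T}$, and $$\Theta_T:=(I-K_TK_T^* )^{1/2}K_{M_T}^*:\ \ell^2(\mathbf F)\otimes\overline{\Delta_{M_T}(I)\mathcal M_T}\to\ell^2(\mathbf F)\otimes\overline{\Delta_T(I)\mathcal H};$$ it satisfies $K_TK_T^*+\Theta_T\Theta_T^*=I$. *)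

theory Defs
  imports "HOL-Analysis.Analysis"
begin

section \<open>Complex Hilbert spaces\<close>

text \<open>
  The distribution has real inner product spaces only.  A complex Hilbert space is a complete
  real inner product space with a complex scalar multiplication and a sesquilinear form, linear in
  the first argument, whose real part is the given real inner product; norm and topology are those
  of the library.
\<close>

class complex_hilbert = real_inner + complete_space +
  fixes scaleC :: "complex \<Rightarrow> 'a \<Rightarrow> 'a"  (infixr "*\<^sub>C" 75)
    and cinner :: "'a \<Rightarrow> 'a \<Rightarrow> complex"
  assumes scaleC_add_right: "a *\<^sub>C (x + y) = a *\<^sub>C x + a *\<^sub>C y"
    and scaleC_add_left: "(a + b) *\<^sub>C x = a *\<^sub>C x + b *\<^sub>C x"
    and scaleC_scaleC: "a *\<^sub>C b *\<^sub>C x = (a * b) *\<^sub>C x"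
    and scaleR_scaleC: "r *\<^sub>R x = complex_of_real r *\<^sub>C x"
    and cinner_add_left: "cinner (x + y) z = cinner x z + cinner y z"
    and cinner_scaleC_left: "cinner (a *\<^sub>C x) y = a * cinner x y"
    and cinner_commute: "cinner y x = cnj (cinner x y)"
    and inner_eq_Re_cinner: "inner x y = Re (cinner x y)"

instantiation complex :: complex_hilbert
begin

definition "scaleC_complex (a::complex) x = a * x"
definition "cinner_complex (x::complex) y = x * cnj y"

instance
  by standard
    (auto simp: scaleC_complex_def cinner_complex_def algebra_simps scaleR_conv_of_real
      inner_complex_def)

end

lemma cinner_self: "cinner x x = complex_of_real ((norm x)\<^sup>2)"
  for x :: "'a::complex_hilbert"
proof (rule complex_eqI)
  show "Re (cinner x x) = Re (complex_of_real ((norm x)\<^sup>2))"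
    using inner_eq_Re_cinner[of x x] by (simp add: power2_norm_eq_inner)
  have "Im (cinner x x) = - Im (cinner x x)"
    by (metis cinner_commute complex_cnj cnj.sel(2))
  then show "Im (cinner x x) = Im (complex_of_real ((norm x)\<^sup>2))" by simp
qed

lemma norm_scaleC: "norm (a *\<^sub>C x) = cmod a * norm x"
  for x :: "'a::complex_hilbert"
proof -
  have "cinner (a *\<^sub>C x) (a *\<^sub>C x) = a * cnj a * cinner x x"
    by (metis cinner_commute cinner_scaleC_left complex_cnj_mult mult.assoc mult.commute)
  then have "complex_of_real ((norm (a *\<^sub>C x))\<^sup>2) = complex_of_real ((cmod a * norm x)\<^sup>2)"
    by (simp add: cinner_self complex_norm_square[symmetric] power_mult_distrib)
  then have "(norm (a *\<^sub>C x))\<^sup>2 = (cmod a * norm x)\<^sup>2"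
    using of_real_eq_iff by blast
  then show ?thesis by simp
qed

lemma cmod_cinner_le: "cmod (cinner x y) \<le> 2 * (norm x * norm y)"
  for x y :: "'a::complex_hilbert"
proof -
  have 1: "\<bar>Re (cinner x y)\<bar> \<le> norm x * norm y"
    by (metis Cauchy_Schwarz_ineq2 inner_eq_Re_cinner)
  have "Im (cinner x y) = - inner (\<i> *\<^sub>C x) y"
    by (simp add: inner_eq_Re_cinner cinner_scaleC_left)
  then have "\<bar>Im (cinner x y)\<bar> \<le> norm (\<i> *\<^sub>C x) * norm y"
    by (metis Cauchy_Schwarz_ineq2 abs_minus_cancel)
  then have 2: "\<bar>Im (cinner x y)\<bar> \<le> norm x * norm y"
    by (simp add: norm_scaleC)
  show ?thesis using cmod_le[of "cinner x y"] 1 2 by linarith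
qed


section \<open>Square-summable families\<close>

text \<open>
  The Hilbert space of square-summable families \<open>'i \<Rightarrow> 'a\<close>, i.e. the Hilbert tensor product of
  scalar square-summable families over \<open>'i\<close> with \<open>'a\<close>.
\<close>

typedef (overloaded) ('i, 'a) ell2 =
  "{f :: 'i \<Rightarrow> 'a::complex_hilbert. (\<lambda>i. (norm (f i))\<^sup>2) summable_on UNIV}"
  morphisms coord Abs_ell2
  by (rule exI[of _ "\<lambda>_. 0"]) simp

lemma coord_summable: "(\<lambda>i. (norm (coord f i))\<^sup>2) summable_on UNIV"
  using coord[of f] by simp

lemma coord_Abs_ell2: "(\<lambda>i. (norm (f i))\<^sup>2) summable_on UNIV \<Longrightarrow> coord (Abs_ell2 f) = f"
  by (simp add: Abs_ell2_inverse)

lemma ell2_eqI: "(\<And>i. coord f i = coord g i) \<Longrightarrow> f = g"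
  by (simp add: coord_inject[symmetric] ext)

lemma ell2_add_summable:
  fixes f g :: "'i \<Rightarrow> 'a::complex_hilbert"
  assumes "(\<lambda>i. (norm (f i))\<^sup>2) summable_on UNIV" "(\<lambda>i. (norm (g i))\<^sup>2) summable_on UNIV"
  shows "(\<lambda>i. (norm (f i + g i))\<^sup>2) summable_on UNIV"
proof (rule summable_on_comparison_test)
  show "(\<lambda>i. 2 * (norm (f i))\<^sup>2 + 2 * (norm (g i))\<^sup>2) summable_on UNIV"
    using assms by (intro summable_on_add summable_on_cmult_right)
  fix i
  have "(norm (f i + g i))\<^sup>2 \<le> (norm (f i) + norm (g i))\<^sup>2"
    by (simp add: norm_triangle_ineq power_mono)
  also have "\<dots> \<le> 2 * (norm (f i))\<^sup>2 + 2 * (norm (g i))\<^sup>2"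
    using zero_le_power2[of "norm (f i) - norm (g i)"] by (simp add: power2_eq_square algebra_simps)
  finally show "(norm (f i + g i))\<^sup>2 \<le> 2 * (norm (f i))\<^sup>2 + 2 * (norm (g i))\<^sup>2" .
qed simp

lemma ell2_scaleC_summable:
  fixes f :: "'i \<Rightarrow> 'a::complex_hilbert"
  assumes "(\<lambda>i. (norm (f i))\<^sup>2) summable_on UNIV"
  shows "(\<lambda>i. (norm (a *\<^sub>C f i))\<^sup>2) summable_on UNIV"
  using summable_on_cmult_right[OF assms, of "(cmod a)\<^sup>2"]
  by (simp add: norm_scaleC power_mult_distrib)

lemma ell2_cinner_summable:
  "(\<lambda>i. cinner (coord f i) (coord g i)) summable_on UNIV"
proof (rule abs_summable_summable, rule summable_on_comparison_test)
  show "(\<lambda>i. (norm (coord f i))\<^sup>2 + (norm (coord g i))\<^sup>2) summable_on UNIV"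
    by (intro summable_on_add coord_summable)
  fix i
  have "cmod (cinner (coord f i) (coord g i)) \<le> 2 * (norm (coord f i) * norm (coord g i))"
    by (rule cmod_cinner_le)
  also have "\<dots> \<le> (norm (coord f i))\<^sup>2 + (norm (coord g i))\<^sup>2"
    using zero_le_power2[of "norm (coord f i) - norm (coord g i)"]
    by (simp add: power2_eq_square algebra_simps)
  finally show "cmod (cinner (coord f i) (coord g i)) \<le> (norm (coord f i))\<^sup>2 + (norm (coord g i))\<^sup>2" .
qed simp

instantiation ell2 :: (type, complex_hilbert) real_inner
begin

definition "zero_ell2 = Abs_ell2 (\<lambda>_. 0)"
definition "plus_ell2 f g = Abs_ell2 (\<lambda>i. coord f i + coord g i)"
definition "uminus_ell2 f = Abs_ell2 (\<lambda>i. - coord f i)"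
definition "minus_ell2 f g = Abs_ell2 (\<lambda>i. coord f i - coord g i)"
definition "scaleR_ell2 r f = Abs_ell2 (\<lambda>i. r *\<^sub>R coord f i)"
definition "inner_ell2 f g = (\<Sum>\<^sub>\<infinity>i. inner (coord f i) (coord g i))"
definition "norm_ell2 (f::('a,'b) ell2) = sqrt (inner f f)"
definition "sgn_ell2 (f::('a,'b) ell2) = inverse (norm f) *\<^sub>R f"
definition "dist_ell2 (f::('a,'b) ell2) g = norm (f - g)"
definition "(uniformity :: (('a,'b) ell2 \<times> ('a,'b) ell2) filter)
  = (INF e\<in>{0<..}. principal {(f, g). dist f g < e})"
definition "open (U :: ('a,'b) ell2 set)
  \<longleftrightarrow> (\<forall>f\<in>U. eventually (\<lambda>(f', g). f' = f \<longrightarrow> g \<in> U) uniformity)"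

lemma coord_zero [simp]: "coord 0 i = 0"
  by (simp add: zero_ell2_def coord_Abs_ell2)

lemma coord_add [simp]: "coord (f + g) i = coord f i + coord g i"
  by (simp add: plus_ell2_def coord_Abs_ell2 ell2_add_summable coord_summable)

lemma coord_uminus [simp]: "coord (- f) i = - coord f i"
  by (simp add: uminus_ell2_def coord_Abs_ell2 coord_summable)

lemma coord_diff [simp]: "coord (f - g) i = coord f i - coord g i"
  using ell2_add_summable[OF coord_summable[of f], of "\<lambda>i. - coord g i"] coord_summable[of g]
  by (simp add: minus_ell2_def coord_Abs_ell2)

lemma coord_scaleR [simp]: "coord (r *\<^sub>R f) i = r *\<^sub>R coord f i"
  by (simp add: scaleR_ell2_def coord_Abs_ell2 scaleR_scaleC ell2_scaleC_summable coord_summable)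

lemma ell2_inner_summable: "(\<lambda>i. inner (coord f i) (coord g i)) summable_on UNIV"
  using summable_on_Re[OF ell2_cinner_summable[of f g]] by (simp add: inner_eq_Re_cinner)

instance
proof
  fix f g h :: "('a,'b) ell2" and a b :: real
  show "dist f g = norm (f - g)" by (rule dist_ell2_def)
  show "sgn f = inverse (norm f) *\<^sub>R f" by (rule sgn_ell2_def)
  show "uniformity = (INF e\<in>{0<..}. principal {(f, g :: ('a,'b) ell2). dist f g < e})"
    by (rule uniformity_ell2_def)
  show "open U \<longleftrightarrow> (\<forall>f\<in>U. eventually (\<lambda>(f', g). f' = f \<longrightarrow> g \<in> U) uniformity)"
    for U :: "('a,'b) ell2 set" by (rule open_ell2_def)
  show "norm f = sqrt (inner f f)" by (rule norm_ell2_def)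
  show "inner f g = inner g f" by (simp add: inner_ell2_def inner_commute)
  show "inner (f + g) h = inner f h + inner g h"
    by (simp add: inner_ell2_def inner_add_left infsum_add ell2_inner_summable)
  show "inner (a *\<^sub>R f) g = a * inner f g"
    by (simp add: inner_ell2_def infsum_cmult_right')
  show "0 \<le> inner f f" by (simp add: inner_ell2_def infsum_nonneg)
  show "inner f f = 0 \<longleftrightarrow> f = 0"
  proof
    assume 0: "inner f f = 0"
    show "f = 0"
    proof (rule ell2_eqI)
      fix i
      have "inner (coord f i) (coord f i) = 0"
        by (rule nonneg_infsum_le_0D[where A = UNIV]) 
          (use 0 ell2_inner_summable[of f f] in \<open>auto simp: inner_ell2_def\<close>)
      then show "coord f i = coord 0 i" by simp
    qed
  qed (simp add: inner_ell2_def)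
qed (auto intro!: ell2_eqI simp: algebra_simps)

end

lemma norm_ell2_sq: "(norm f)\<^sup>2 = (\<Sum>\<^sub>\<infinity>i. (norm (coord f i))\<^sup>2)"
  by (simp add: power2_norm_eq_inner inner_ell2_def)

lemma sum_coord_le: "finite F \<Longrightarrow> (\<Sum>i\<in>F. (norm (coord f i))\<^sup>2) \<le> (norm f)\<^sup>2"
  unfolding norm_ell2_sq by (rule finite_sum_le_infsum) (auto simp: coord_summable)

lemma norm_coord_le: "norm (coord f i) \<le> norm f"
  using sum_coord_le[of "{i}" f] by simp

instance ell2 :: (type, complex_hilbert) complete_space
proof
  fix X :: "nat \<Rightarrow> ('a,'b) ell2"
  assume X: "Cauchy X"
  have "Cauchy (\<lambda>n. coord (X n) i)" for i
    unfolding Cauchy_def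
  proof (intro allI impI)
    fix e :: real assume "e > 0"
    then obtain N where "\<forall>m\<ge>N. \<forall>n\<ge>N. dist (X m) (X n) < e" using X unfolding Cauchy_def by blast
    then show "\<exists>N. \<forall>m\<ge>N. \<forall>n\<ge>N. dist (coord (X m) i) (coord (X n) i) < e"
      by (metis coord_diff dist_norm le_less_trans norm_coord_le)
  qed
  then have "\<forall>i. \<exists>l. (\<lambda>n. coord (X n) i) \<longlonglongrightarrow> l"
    using Cauchy_convergent convergent_def by blast
  then obtain L where L: "\<And>i. (\<lambda>n. coord (X n) i) \<longlonglongrightarrow> L i" by metis
  have tail: "\<exists>N. \<forall>n\<ge>N. \<forall>F. finite F \<longrightarrow> (\<Sum>i\<in>F. (norm (coord (X n) i - L i))\<^sup>2) \<le> e\<^sup>2"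
    if epos: "e > 0" for e :: real
  proof -
    obtain N where N: "\<forall>m\<ge>N. \<forall>n\<ge>N. dist (X m) (X n) < e"
      using X epos unfolding Cauchy_def by blast
    have "(\<Sum>i\<in>F. (norm (coord (X n) i - L i))\<^sup>2) \<le> e\<^sup>2" if "n \<ge> N" "finite F" for n F
    proof (rule LIMSEQ_le_const2)
      show "(\<lambda>m. \<Sum>i\<in>F. (norm (coord (X n) i - coord (X m) i))\<^sup>2)
          \<longlonglongrightarrow> (\<Sum>i\<in>F. (norm (coord (X n) i - L i))\<^sup>2)"
        by (intro tendsto_intros L)
      have "(\<Sum>i\<in>F. (norm (coord (X n) i - coord (X m) i))\<^sup>2) \<le> e\<^sup>2" if "m \<ge> N" for m
      proof -
        have "(\<Sum>i\<in>F. (norm (coord (X n) i - coord (X m) i))\<^sup>2) \<le> (norm (X n - X m))\<^sup>2"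
          using sum_coord_le[OF \<open>finite F\<close>, of "X n - X m"] by simp
        also have "\<dots> \<le> e\<^sup>2"
          using N \<open>n \<ge> N\<close> that by (intro power_mono) (auto simp: dist_norm less_imp_le)
        finally show ?thesis .
      qed
      then show "\<exists>N. \<forall>m\<ge>N. (\<Sum>i\<in>F. (norm (coord (X n) i - coord (X m) i))\<^sup>2) \<le> e\<^sup>2" by blast
    qed
    then show ?thesis by blast
  qed
  have summ: "(\<lambda>i. (norm (h i))\<^sup>2) summable_on UNIV"
    if "\<And>F. finite F \<Longrightarrow> (\<Sum>i\<in>F. (norm (h i))\<^sup>2) \<le> c" for h :: "'a \<Rightarrow> 'b" and c
    by (rule nonneg_bdd_above_summable_on) (use that in \<open>auto simp: bdd_above_def\<close>)
  obtain N1 where N1: "\<forall>n\<ge>N1. \<forall>F. finite F \<longrightarrow> (\<Sum>i\<in>F. (norm (coord (X n) i - L i))\<^sup>2) \<le> 1\<^sup>2"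
    using tail[of 1] by auto
  have "(\<lambda>i. (norm (L i - coord (X N1) i))\<^sup>2) summable_on UNIV"
    by (rule summ[where c = 1]) (use N1 in \<open>auto simp: norm_minus_commute\<close>)
  from ell2_add_summable[OF this coord_summable[of "X N1"]]
  have cL: "coord (Abs_ell2 L) = L" by (simp add: coord_Abs_ell2)
  have "X \<longlonglongrightarrow> Abs_ell2 L"
    unfolding LIMSEQ_def
  proof (intro allI impI)
    fix e :: real assume "e > 0"
    then obtain N where N: "\<And>n F. n \<ge> N \<Longrightarrow> finite F \<Longrightarrow> (\<Sum>i\<in>F. (norm (coord (X n) i - L i))\<^sup>2) \<le> (e/2)\<^sup>2"
      using tail[of "e/2"] by auto
    have "dist (X n) (Abs_ell2 L) < e" if "n \<ge> N" for n
    proof -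
      have "(norm (X n - Abs_ell2 L))\<^sup>2 \<le> (e/2)\<^sup>2"
        unfolding norm_ell2_sq
        by (rule infsum_le_finite_sums) (use N[OF that] coord_summable[of "X n - Abs_ell2 L"] in \<open>auto simp: cL\<close>)
      then have "norm (X n - Abs_ell2 L) \<le> e/2"
        using \<open>e > 0\<close> by (simp add: power2_le_iff_abs_le)
      then show ?thesis using \<open>e > 0\<close> by (simp add: dist_norm)
    qed
    then show "\<exists>N. \<forall>n\<ge>N. dist (X n) (Abs_ell2 L) < e" by blast
  qed
  then show "convergent X" unfolding convergent_def by blast
qed

instantiation ell2 :: (type, complex_hilbert) complex_hilbert
begin

definition "scaleC_ell2 a f = Abs_ell2 (\<lambda>i. a *\<^sub>C coord f i)"
definition "cinner_ell2 f g = (\<Sum>\<^sub>\<infinity>i. cinner (coord f i) (coord g i))"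

lemma coord_scaleC [simp]: "coord (a *\<^sub>C f) i = a *\<^sub>C coord f i"
  by (simp add: scaleC_ell2_def coord_Abs_ell2 ell2_scaleC_summable coord_summable)

instance
proof
  fix f g h :: "('a,'b) ell2" and a b :: complex and r :: real
  show "cinner (f + g) h = cinner f h + cinner g h"
    by (simp add: cinner_ell2_def cinner_add_left infsum_add ell2_cinner_summable)
  show "cinner (a *\<^sub>C f) g = a * cinner f g"
    by (simp add: cinner_ell2_def cinner_scaleC_left infsum_cmult_right')
  have "cinner g f = (\<Sum>\<^sub>\<infinity>i. cnj (cinner (coord f i) (coord g i)))"
    unfolding cinner_ell2_def by (intro infsum_cong cinner_commute)
  also have "\<dots> = cnj (cinner f g)" unfolding cinner_ell2_def by simp
  finally show "cinner g f = cnj (cinner f g)" .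
  show "inner f g = Re (cinner f g)"
    by (simp add: inner_ell2_def cinner_ell2_def inner_eq_Re_cinner infsum_Re ell2_cinner_summable)
qed (auto intro!: ell2_eqI simp: scaleC_add_right scaleC_add_left scaleC_scaleC scaleR_scaleC)

end

definition elem_tensor :: "'i \<Rightarrow> 'a::complex_hilbert \<Rightarrow> ('i, 'a) ell2"
  where "elem_tensor i x = Abs_ell2 (\<lambda>j. if j = i then x else 0)"

lemma coord_elem_tensor: "coord (elem_tensor i x) j = (if j = i then x else 0)"
proof -
  have "(\<lambda>j. (norm (if j = i then x else 0))\<^sup>2) summable_on UNIV
      \<longleftrightarrow> (\<lambda>j. (norm (if j = i then x else 0))\<^sup>2) summable_on {i}"
    by (rule summable_on_cong_neutral) auto
  then show ?thesis unfolding elem_tensor_def by (subst coord_Abs_ell2) auto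
qed


section \<open>Subspaces and operators\<close>

text \<open>
  A Hilbert space is represented by a closed subspace \<open>H\<close> of a type of class
  \<open>complex_hilbert\<close> (possibly \<open>UNIV\<close>).  An operator from \<open>H\<close> to \<open>K\<close> is represented by its extension
  to the whole type by zero on the orthogonal complement of \<open>H\<close>; then the identity of \<open>H\<close> is the
  orthogonal projection onto \<open>H\<close>, and composition, adjoint, positivity and positive square root of
  operators between subspaces agree with those of the extensions.
\<close>

definition closed_csubspace :: "'a::complex_hilbert set \<Rightarrow> bool"
  where "closed_csubspace H \<longleftrightarrow> closed H \<and> 0 \<in> H \<and> (\<forall>x\<in>H. \<forall>y\<in>H. x + y \<in> H) \<and>
    (\<forall>a. \<forall>x\<in>H. a *\<^sub>C x \<in> H)"

definition ocomplement :: "'a::complex_hilbert set \<Rightarrow> 'a set"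
  where "ocomplement H = {x. \<forall>y\<in>H. cinner x y = 0}"

definition proj :: "'a::complex_hilbert set \<Rightarrow> 'a \<Rightarrow> 'a"
  where "proj H x = (THE y. y \<in> H \<and> x - y \<in> ocomplement H)"

definition bounded_clinear :: "('a::complex_hilbert \<Rightarrow> 'b::complex_hilbert) \<Rightarrow> bool"
  where "bounded_clinear A \<longleftrightarrow> bounded_linear A \<and> (\<forall>a x. A (a *\<^sub>C x) = a *\<^sub>C A x)"

definition bops :: "'a::complex_hilbert set \<Rightarrow> 'b::complex_hilbert set \<Rightarrow> ('a \<Rightarrow> 'b) set"
  where "bops H K = {A. bounded_clinear A \<and> (\<forall>x. A x \<in> K) \<and> (\<forall>x\<in>ocomplement H. A x = 0)}"

definition cadjoint :: "('a::complex_hilbert \<Rightarrow> 'b::complex_hilbert) \<Rightarrow> 'b \<Rightarrow> 'a"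
  where "cadjoint A = (THE B. \<forall>x y. cinner (A x) y = cinner x (B y))"

definition pos_op :: "('a::complex_hilbert \<Rightarrow> 'a) \<Rightarrow> bool"
  where "pos_op A \<longleftrightarrow> bounded_clinear A \<and> (\<forall>x. cinner (A x) x \<in> \<real>\<^sub>\<ge>\<^sub>0)"

definition op_sqrt :: "('a::complex_hilbert \<Rightarrow> 'a) \<Rightarrow> 'a \<Rightarrow> 'a"
  where "op_sqrt A = (THE B. pos_op B \<and> B \<circ> B = A)"

definition unitary_between ::
    "'a::complex_hilbert set \<Rightarrow> 'b::complex_hilbert set \<Rightarrow> ('a \<Rightarrow> 'b) \<Rightarrow> bool"
  where "unitary_between H K W \<longleftrightarrow>
    W \<in> bops H K \<and> cadjoint W \<circ> W = proj H \<and> W \<circ> cadjoint W = proj K"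


section \<open>Multi-words and the universal model\<close>

text \<open>
  A word in the free semigroup on \<open>n i\<close> generators is a list over \<open>{1..n i}\<close>.  A \<open>k\<close>-tuple of words
  is a function \<open>nat \<Rightarrow> nat list\<close> that is empty off \<open>{1..k}\<close>.
\<close>

type_synonym mword = "nat \<Rightarrow> nat list"

definition mwords :: "nat \<Rightarrow> (nat \<Rightarrow> nat) \<Rightarrow> mword set"
  where "mwords k n =
    {\<alpha>. (\<forall>i\<in>{1..k}. set (\<alpha> i) \<subseteq> {1..n i}) \<and> (\<forall>i. i \<notin> {1..k} \<longrightarrow> \<alpha> i = [])}"

text \<open>
  \<open>fock k n E\<close> is the tensor product of the square-summable scalar families over \<open>mwords k n\<close> with
  \<open>E\<close>, i.e. the space of square-summable \<open>E\<close>-valued families; \<open>elem_tensor \<alpha> x\<close> is the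
  elementary tensor of the basis vector at \<open>\<alpha>\<close> with \<open>x\<close>.
\<close>

definition fock :: "nat \<Rightarrow> (nat \<Rightarrow> nat) \<Rightarrow> 'a::complex_hilbert set \<Rightarrow> (mword, 'a) ell2 set"
  where "fock k n E =
    {f. (\<forall>\<alpha>\<in>mwords k n. coord f \<alpha> \<in> E) \<and> (\<forall>\<alpha>. \<alpha> \<notin> mwords k n \<longrightarrow> coord f \<alpha> = 0)}"

definition phase :: "(nat \<Rightarrow> nat \<Rightarrow> nat \<Rightarrow> nat \<Rightarrow> complex) \<Rightarrow> nat \<Rightarrow> nat \<Rightarrow> mword \<Rightarrow> complex"
  where "phase \<Lambda> i s \<alpha> = (\<Prod>j\<in>{1..<i}. prod_list (map (\<Lambda> i j s) (\<alpha> j)))"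

text \<open>
  \<open>model_shift k n \<Lambda> i s\<close> is the \<open>(i,s)\<close>-th universal model operator tensored with the identity, and
  \<open>ampliation k n u\<close> is the identity of the scalar Fock space tensored with \<open>u\<close>; both are
  given by their action on elementary tensors.
\<close>

definition model_shift ::
    "nat \<Rightarrow> (nat \<Rightarrow> nat) \<Rightarrow> (nat \<Rightarrow> nat \<Rightarrow> nat \<Rightarrow> nat \<Rightarrow> complex) \<Rightarrow> nat \<Rightarrow> nat \<Rightarrow>
     (mword, 'a::complex_hilbert) ell2 \<Rightarrow> (mword, 'a) ell2"
  where "model_shift k n \<Lambda> i s f =
    (\<Sum>\<^sub>\<infinity>\<alpha>\<in>mwords k n. phase \<Lambda> i s \<alpha> *\<^sub>C elem_tensor (\<alpha>(i := s # \<alpha> i)) (coord f \<alpha>))"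

definition ampliation ::
    "nat \<Rightarrow> (nat \<Rightarrow> nat) \<Rightarrow> ('a::complex_hilbert \<Rightarrow> 'b::complex_hilbert) \<Rightarrow>
     (mword, 'a) ell2 \<Rightarrow> (mword, 'b) ell2"
  where "ampliation k n u f = (\<Sum>\<^sub>\<infinity>\<alpha>\<in>mwords k n. elem_tensor \<alpha> (u (coord f \<alpha>)))"

lemma model_shift_basis:
  assumes "\<alpha> \<in> mwords k n"
  shows "model_shift k n \<Lambda> i s (elem_tensor \<alpha> x) = phase \<Lambda> i s \<alpha> *\<^sub>C elem_tensor (\<alpha>(i := s # \<alpha> i)) x"
proof -
  have "model_shift k n \<Lambda> i s (elem_tensor \<alpha> x)
      = (\<Sum>\<^sub>\<infinity>\<beta>\<in>{\<alpha>}. phase \<Lambda> i s \<beta> *\<^sub>C elem_tensor (\<beta>(i := s # \<beta> i)) (coord (elem_tensor \<alpha> x) \<beta>))"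
    unfolding model_shift_def
    by (rule infsum_cong_neutral)
      (use assms in \<open>auto intro!: ell2_eqI simp: coord_elem_tensor\<close>,
       metis add_cancel_right_right scaleC_add_right)
  then show ?thesis by (simp add: coord_elem_tensor)
qed

definition multi_analytic ::
    "nat \<Rightarrow> (nat \<Rightarrow> nat) \<Rightarrow> (nat \<Rightarrow> nat \<Rightarrow> nat \<Rightarrow> nat \<Rightarrow> complex) \<Rightarrow>
     'a::complex_hilbert set \<Rightarrow> 'b::complex_hilbert set \<Rightarrow>
     ((mword, 'a) ell2 \<Rightarrow> (mword, 'b) ell2) \<Rightarrow> bool"
  where "multi_analytic k n \<Lambda> E K A \<longleftrightarrow> A \<in> bops (fock k n E) (fock k n K) \<and>
    (\<forall>i\<in>{1..k}. \<forall>s\<in>{1..n i}. \<forall>f\<in>fock k n E.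
      A (model_shift k n \<Lambda> i s f) = model_shift k n \<Lambda> i s (A f))"

definition coincide ::
    "nat \<Rightarrow> (nat \<Rightarrow> nat) \<Rightarrow> 'a::complex_hilbert set \<Rightarrow> 'b::complex_hilbert set \<Rightarrow>
     ((mword, 'a) ell2 \<Rightarrow> (mword, 'b) ell2) \<Rightarrow>
     'c::complex_hilbert set \<Rightarrow> 'd::complex_hilbert set \<Rightarrow>
     ((mword, 'c) ell2 \<Rightarrow> (mword, 'd) ell2) \<Rightarrow> bool"
  where "coincide k n K1 K2 A K1' K2' A' \<longleftrightarrow>
    (\<exists>u1 u2. unitary_between K1 K1' u1 \<and> unitary_between K2 K2' u2 \<and>
      (\<forall>f\<in>fock k n K1. A' (ampliation k n u1 f) = ampliation k n u2 (A f)))"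


section \<open>Regular polyballs\<close>

type_synonym 'a optuple = "nat \<Rightarrow> nat \<Rightarrow> 'a \<Rightarrow> 'a"

definition Phi ::
    "(nat \<Rightarrow> nat) \<Rightarrow> 'a::complex_hilbert optuple \<Rightarrow> nat \<Rightarrow> ('a \<Rightarrow> 'a) \<Rightarrow> 'a \<Rightarrow> 'a"
  where "Phi n T i X = (\<lambda>h. \<Sum>s\<in>{1..n i}. T i s (X (cadjoint (T i s) h)))"

text \<open>\<open>(id - \<Phi>\<^sub>k\<^sup>p\<^sup>k) \<circ> \<dots> \<circ> (id - \<Phi>\<^sub>1\<^sup>p\<^sup>1)\<close> applied to the identity of \<open>H\<close>; the fold applies the
  factor with index 1 first.\<close>

definition defect_pow ::
    "nat \<Rightarrow> (nat \<Rightarrow> nat) \<Rightarrow> 'a::complex_hilbert set \<Rightarrow> 'a optuple \<Rightarrow> (nat \<Rightarrow> nat) \<Rightarrow> 'a \<Rightarrow> 'a"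
  where "defect_pow k n H T p =
    fold (\<lambda>i X h. X h - (Phi n T i ^^ p i) X h) [1..<Suc k] (proj H)"

definition defect ::
    "nat \<Rightarrow> (nat \<Rightarrow> nat) \<Rightarrow> 'a::complex_hilbert set \<Rightarrow> 'a optuple \<Rightarrow> 'a \<Rightarrow> 'a"
  where "defect k n H T = defect_pow k n H T (\<lambda>_. 1)"

definition polyball ::
    "nat \<Rightarrow> (nat \<Rightarrow> nat) \<Rightarrow> (nat \<Rightarrow> nat \<Rightarrow> nat \<Rightarrow> nat \<Rightarrow> complex) \<Rightarrow>
     'a::complex_hilbert set \<Rightarrow> 'a optuple set"
  where "polyball k n \<Lambda> H = {T.
    (\<forall>i\<in>{1..k}. \<forall>s\<in>{1..n i}. T i s \<in> bops H H) \<and>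
    (\<forall>i\<in>{1..k}. pos_op (\<lambda>h. proj H h - (\<Sum>s\<in>{1..n i}. T i s (cadjoint (T i s) h)))) \<and>
    (\<forall>i\<in>{1..k}. \<forall>j\<in>{1..k}. i \<noteq> j \<longrightarrow> (\<forall>s\<in>{1..n i}. \<forall>t\<in>{1..n j}. \<forall>h.
      T i s (T j t h) = \<Lambda> i j s t *\<^sub>C T j t (T i s h))) \<and>
    (\<forall>r::real. 0 \<le> r \<and> r < 1 \<longrightarrow> pos_op (defect k n H (\<lambda>i s h. r *\<^sub>R T i s h)))}"

definition completely_non_coisometric ::
    "nat \<Rightarrow> (nat \<Rightarrow> nat) \<Rightarrow> 'a::complex_hilbert set \<Rightarrow> 'a optuple \<Rightarrow> bool"
  where "completely_non_coisometric k n H T \<longleftrightarrow>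
    \<not> (\<exists>h\<in>H. h \<noteq> 0 \<and> (\<forall>p. cinner (defect_pow k n H T p h) h = 0))"

definition unitarily_equivalent ::
    "nat \<Rightarrow> (nat \<Rightarrow> nat) \<Rightarrow> 'a::complex_hilbert set \<Rightarrow> 'a optuple \<Rightarrow>
     'b::complex_hilbert set \<Rightarrow> 'b optuple \<Rightarrow> bool"
  where "unitarily_equivalent k n H T H' T' \<longleftrightarrow>
    (\<exists>W. unitary_between H H' W \<and>
      (\<forall>i\<in>{1..k}. \<forall>s\<in>{1..n i}. T i s = cadjoint W \<circ> T' i s \<circ> W))"


section \<open>Berezin kernel and characteristic function\<close>

definition defect_space ::
    "nat \<Rightarrow> (nat \<Rightarrow> nat) \<Rightarrow> 'a::complex_hilbert set \<Rightarrow> 'a optuple \<Rightarrow> 'a set"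
  where "defect_space k n H T = closure (defect k n H T ` H)"

definition word_op :: "(nat \<Rightarrow> 'a \<Rightarrow> 'a) \<Rightarrow> nat list \<Rightarrow> 'a \<Rightarrow> 'a"
  where "word_op X w = foldr (\<lambda>s A. X s \<circ> A) w id"

text \<open>The fold below is the product of the adjoints of the word operators, the one for \<open>\<beta> 1\<close>
  acting on \<open>h\<close> first.\<close>

definition berezin ::
    "nat \<Rightarrow> (nat \<Rightarrow> nat) \<Rightarrow> 'a::complex_hilbert set \<Rightarrow> 'a optuple \<Rightarrow> 'a \<Rightarrow> (mword, 'a) ell2"
  where "berezin k n H T h = (\<Sum>\<^sub>\<infinity>\<beta>\<in>mwords k n.
    elem_tensor \<beta> (op_sqrt (defect k n H T)
      (fold (\<lambda>i. cadjoint (word_op (T i) (\<beta> i))) [1..<Suc k] h)))"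

text \<open>
  The auxiliary space \<open>E\<close> ranges over all closed subspaces of the type \<open>'e\<close>.  In a theorem that has
  \<open>admits_char_fun\<close> as a hypothesis and \<open>'e\<close> as a free type variable occurring nowhere else, the
  implicit universal quantification over \<open>'e\<close> makes \<open>E\<close> an arbitrary Hilbert space.
\<close>

definition admits_char_fun ::
    "'e::complex_hilbert itself \<Rightarrow> nat \<Rightarrow> (nat \<Rightarrow> nat) \<Rightarrow>
     (nat \<Rightarrow> nat \<Rightarrow> nat \<Rightarrow> nat \<Rightarrow> complex) \<Rightarrow> 'a::complex_hilbert set \<Rightarrow> 'a optuple \<Rightarrow> bool"
  where "admits_char_fun (_ :: 'e itself) k n \<Lambda> H T \<longleftrightarrow>
    (\<exists>(E :: 'e set) \<Psi>. closed_csubspace E \<and>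
      multi_analytic k n \<Lambda> E (defect_space k n H T) \<Psi> \<and>
      (\<forall>f. berezin k n H T (cadjoint (berezin k n H T) f) + \<Psi> (cadjoint \<Psi> f)
        = proj (fock k n (defect_space k n H T)) f))"

text \<open>
  With \<open>Y = I - K K\<^sup>*\<close> for the Berezin kernel \<open>K\<close> of \<open>T\<close> (\<open>berezin_codefect\<close>), the model tuple consists of
  the adjoints of the operators \<open>A\<close> with \<open>A Y\<^sup>1\<^sup>/\<^sup>2 = Y\<^sup>1\<^sup>/\<^sup>2 S\<^sup>*\<close> on the closure of the range of \<open>Y\<close>.  Its Berezin
  kernel takes values in families over \<open>mwords k n\<close> of elements of that space, hence the iterated
  \<open>ell2\<close> type in the domain of \<open>char_fun\<close>.  \<open>char_dom\<close> is the coefficient space of that domain; the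
  coefficient space of the codomain is \<open>defect_space k n H T\<close>.
\<close>

definition berezin_codefect ::
    "nat \<Rightarrow> (nat \<Rightarrow> nat) \<Rightarrow> 'a::complex_hilbert set \<Rightarrow> 'a optuple \<Rightarrow>
     (mword, 'a) ell2 \<Rightarrow> (mword, 'a) ell2"
  where "berezin_codefect k n H T f =
    proj (fock k n (defect_space k n H T)) f - berezin k n H T (cadjoint (berezin k n H T) f)"

definition model_space ::
    "nat \<Rightarrow> (nat \<Rightarrow> nat) \<Rightarrow> 'a::complex_hilbert set \<Rightarrow> 'a optuple \<Rightarrow> (mword, 'a) ell2 set"
  where "model_space k n H T =
    closure (berezin_codefect k n H T ` fock k n (defect_space k n H T))"

definition model_tuple ::
    "nat \<Rightarrow> (nat \<Rightarrow> nat) \<Rightarrow> (nat \<Rightarrow> nat \<Rightarrow> nat \<Rightarrow> nat \<Rightarrow> complex) \<Rightarrow>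
     'a::complex_hilbert set \<Rightarrow> 'a optuple \<Rightarrow> (mword, 'a) ell2 optuple"
  where "model_tuple k n \<Lambda> H T i s = cadjoint (THE A.
    A \<in> bops (model_space k n H T) (model_space k n H T) \<and>
    (\<forall>f\<in>fock k n (defect_space k n H T).
      A (op_sqrt (berezin_codefect k n H T) f)
        = op_sqrt (berezin_codefect k n H T) (cadjoint (model_shift k n \<Lambda> i s) f)))"

definition char_fun ::
    "nat \<Rightarrow> (nat \<Rightarrow> nat) \<Rightarrow> (nat \<Rightarrow> nat \<Rightarrow> nat \<Rightarrow> nat \<Rightarrow> complex) \<Rightarrow>
     'a::complex_hilbert set \<Rightarrow> 'a optuple \<Rightarrow>
     (mword, (mword, 'a) ell2) ell2 \<Rightarrow> (mword, 'a) ell2"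
  where "char_fun k n \<Lambda> H T = op_sqrt (berezin_codefect k n H T) \<circ>
    cadjoint (berezin k n (model_space k n H T) (model_tuple k n \<Lambda> H T))"

definition char_dom ::
    "nat \<Rightarrow> (nat \<Rightarrow> nat) \<Rightarrow> (nat \<Rightarrow> nat \<Rightarrow> nat \<Rightarrow> nat \<Rightarrow> complex) \<Rightarrow>
     'a::complex_hilbert set \<Rightarrow> 'a optuple \<Rightarrow> (mword, 'a) ell2 set"
  where "char_dom k n \<Lambda> H T =
    defect_space k n (model_space k n H T) (model_tuple k n \<Lambda> H T)"

end

theory Submission
  imports Defs
begin

text \<open>
  Write \<open>K\<close> for the Berezin kernel of \<open>T\<close> and \<open>Y = I - K K\<^sup>*\<close>.  Two facts carry the proof.  First, \<open>K\<close>
  intertwines the adjoints of \<open>T\<close> and of the universal model, and it is injective if \<open>T\<close> is completely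
  non-coisometric, because the sum of the squared coordinates of \<open>K h\<close> over the words of length less
  than \<open>p\<^sub>i\<close> is \<open>\<langle>(id - \<Phi>\<^sub>k\<^sup>p\<^sup>k) \<circ> \<dots> \<circ> (id - \<Phi>\<^sub>1\<^sup>p\<^sup>1)(I) h, h\<rangle>\<close>.  Second, \<open>\<Theta> \<Theta>\<^sup>* = Y\<close>, that is, the Berezin kernel of
  the model tuple is isometric: since \<open>Y = \<Psi> \<Psi>\<^sup>*\<close> with \<open>\<Psi>\<close> multi-analytic, the coordinate at \<open>\<beta>\<close> of the
  image of \<open>Y\<^sup>1\<^sup>/\<^sup>2 f\<close> has the norm of the coordinate at \<open>\<beta>\<close> of \<open>\<Psi>\<^sup>* f\<close>.

  If the characteristic functions coincide through \<open>u\<^sub>1\<close> and \<open>u\<^sub>2\<close>, then \<open>U = I \<otimes> u\<^sub>2\<close> conjugates \<open>Y\<close> to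
  \<open>Y'\<close>, hence \<open>K K\<^sup>*\<close> to \<open>K' K'\<^sup>*\<close>, and \<open>K\<^sup>* f \<mapsto> K'\<^sup>* U f\<close> extends to a unitary that intertwines \<open>T\<close>
  and \<open>T'\<close>.  Conversely, a unitary equivalence passes through every step of the construction of \<open>\<Theta>\<close>,
  because adjoints, projections, positive square roots and the model tuple are unique.
\<close>

section \<open>Bounded operators on complex Hilbert spaces\<close>

text \<open>Positivity is handled on quadratic forms, and polarization turns equal forms back into
  equal operators. The ingredients of \<Theta> are given by \<open>THE\<close> or
  \<open>infsum\<close>, so existence, uniqueness and convergence must be established before any of
  them can be computed. Two obstacles shape the rest. Regularity speaks of the full defect of rT for
  r < 1, whereas contractivity of K uses positivity of every partial defect of T; this is recovered
  by descending through the factors at fixed r < 1, where powers of r^2 force decay, and then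
  letting r tend to 1. Moreover the model tuple needs a Berezin kernel of its own. Its positivity
  and summability are read off the adjoint of \<Psi> on the dense range of Y^(1/2) and extended by
  continuity; the locale \<open>berezin_tuple\<close> isolates what both kinds of tuple have to
  supply. In the passage back from \<Theta> to T, complete non-coisometry makes the range of the
  adjoint of K dense in H, so that an isometry given on that range determines the unitary on all of
  H.\<close>

lemma cinner_scaleC_right: "cinner x (a *\<^sub>C y) = cnj a * cinner x y"
  for x y :: "'a::complex_hilbert"
  by (metis cinner_commute cinner_scaleC_left complex_cnj_mult)

text \<open>The real form determines the complex one, so most later arguments can be carried out
  with \<open>inner\<close> alone.\<close>

lemma cinner_eq_Complex: "cinner x y = Complex (inner x y) (inner x (\<i> *\<^sub>C y))"
  for x y :: "'a::complex_hilbert"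
  by (rule complex_eqI) (simp_all add: inner_eq_Re_cinner cinner_scaleC_right)

lemma inner_scaleC_left: "inner (a *\<^sub>C x) y = inner x (cnj a *\<^sub>C y)"
  for x y :: "'a::complex_hilbert"
  by (simp add: inner_eq_Re_cinner cinner_scaleC_left cinner_scaleC_right)

lemma inner_scaleC_scaleC:
  "cmod a = 1 \<Longrightarrow> inner (a *\<^sub>C x) (a *\<^sub>C y) = inner x y"
  for x y :: "'a::complex_hilbert"
  by (simp add: inner_scaleC_left scaleC_scaleC mult.commute[of "cnj a"] complex_norm_square[symmetric])
    (metis of_real_1 scaleR_one scaleR_scaleC)

lemma scaleC_one [simp]: "1 *\<^sub>C x = x" for x :: "'a::complex_hilbert"
  by (metis of_real_1 scaleR_one scaleR_scaleC)

lemma scaleC_zero_right [simp]: "a *\<^sub>C (0::'a::complex_hilbert) = 0"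
  by (metis add_cancel_right_right scaleC_add_right)

lemma scaleC_minus_left: "(- a) *\<^sub>C x = - (a *\<^sub>C x)" for x :: "'a::complex_hilbert"
  by (metis mult_minus1 of_real_1 of_real_minus scaleC_scaleC scaleR_minus1_left scaleR_scaleC)

lemma scaleC_sum_right: "a *\<^sub>C sum f A = (\<Sum>i\<in>A. a *\<^sub>C (f i :: 'a::complex_hilbert))"
  by (induction A rule: infinite_finite_induct) (auto simp: scaleC_add_right)

lemma bounded_clinearI:
  fixes A :: "'a::complex_hilbert \<Rightarrow> 'b::complex_hilbert"
  assumes "\<And>x y. A (x + y) = A x + A y" "\<And>a x. A (a *\<^sub>C x) = a *\<^sub>C A x"
    and "\<And>x. norm (A x) \<le> norm x * c"
  shows "bounded_clinear A"
  unfolding bounded_clinear_def using assms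
  by (auto intro!: bounded_linear_intro[of A c] simp: scaleR_scaleC)

lemma bounded_clinear_imp_linear: "bounded_clinear A \<Longrightarrow> bounded_linear A"
  by (simp add: bounded_clinear_def)

lemma bounded_clinear_scaleC: "bounded_clinear A \<Longrightarrow> A (a *\<^sub>C x) = a *\<^sub>C A x"
  by (simp add: bounded_clinear_def)

lemma bounded_clinear_simps:
  assumes "bounded_clinear A"
  shows "A (x + y) = A x + A y" "A (x - y) = A x - A y" "A 0 = 0" "A (- x) = - A x"
    "A (r *\<^sub>R x) = r *\<^sub>R A x" "A (sum f I) = (\<Sum>i\<in>I. A (f i))" "A (a *\<^sub>C x) = a *\<^sub>C A x"
proof -
  interpret bounded_linear A using assms by (rule bounded_clinear_imp_linear)
  show "A (x + y) = A x + A y" "A (x - y) = A x - A y" "A 0 = 0" "A (- x) = - A x"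
    "A (r *\<^sub>R x) = r *\<^sub>R A x" "A (sum f I) = (\<Sum>i\<in>I. A (f i))"
    by (fact add diff zero neg scaleR sum)+
  show "A (a *\<^sub>C x) = a *\<^sub>C A x" using assms by (rule bounded_clinear_scaleC)
qed

lemma bounded_clinear_id: "bounded_clinear (\<lambda>x. x)"
  by (simp add: bounded_clinear_def bounded_linear_ident)

lemma bounded_clinear_zero: "bounded_clinear (\<lambda>x. 0)"
  by (simp add: bounded_clinear_def bounded_linear_zero)

lemma bounded_clinear_scaleC_right: "bounded_clinear (\<lambda>x. a *\<^sub>C x)"
  by (rule bounded_clinearI[where c = "cmod a"])
    (auto simp: scaleC_add_right scaleC_scaleC norm_scaleC mult.commute)

lemma bounded_clinear_compose:
  "bounded_clinear A \<Longrightarrow> bounded_clinear B \<Longrightarrow> bounded_clinear (\<lambda>x. A (B x))"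
  by (simp add: bounded_clinear_def bounded_linear_compose)

lemma bounded_clinear_add:
  "bounded_clinear A \<Longrightarrow> bounded_clinear B \<Longrightarrow> bounded_clinear (\<lambda>x. A x + B x)"
  by (simp add: bounded_clinear_def bounded_linear_add scaleC_add_right)

lemma scaleC_diff_right: "a *\<^sub>C (x - y) = a *\<^sub>C x - a *\<^sub>C y" for x y :: "'a::complex_hilbert"
  by (metis add_diff_cancel_right' diff_add_cancel scaleC_add_right)

lemma bounded_clinear_diff:
  "bounded_clinear A \<Longrightarrow> bounded_clinear B \<Longrightarrow> bounded_clinear (\<lambda>x. A x - B x)"
  by (simp add: bounded_clinear_def bounded_linear_sub scaleC_diff_right)

lemma bounded_clinear_sum:
  "(\<And>i. i \<in> I \<Longrightarrow> bounded_clinear (A i)) \<Longrightarrow> bounded_clinear (\<lambda>x. \<Sum>i\<in>I. A i x)"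
  by (simp add: bounded_clinear_def bounded_linear_sum scaleC_sum_right)

lemma scaleC_scaleR_commute: "a *\<^sub>C (r *\<^sub>R x) = r *\<^sub>R (a *\<^sub>C x)" for x :: "'a::complex_hilbert"
  by (simp add: scaleR_scaleC scaleC_scaleC mult.commute)

lemma bounded_clinear_scaleR: "bounded_clinear A \<Longrightarrow> bounded_clinear (\<lambda>x. r *\<^sub>R A x)"
  by (simp add: bounded_clinear_def bounded_linear_const_scaleR scaleC_scaleR_commute)

lemma bounded_clinear_continuous_on: "bounded_clinear A \<Longrightarrow> continuous_on S A"
  by (simp add: bounded_clinear_def linear_continuous_on)

lemma bounded_clinear_tendsto:
  "bounded_clinear A \<Longrightarrow> (f \<longlongrightarrow> l) F \<Longrightarrow> ((\<lambda>x. A (f x)) \<longlongrightarrow> A l) F"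
  by (simp add: bounded_clinear_def bounded_linear.tendsto)

lemma bounded_clinear_bound:
  assumes "bounded_clinear A"
  obtains c where "c > 0" "\<And>x. norm (A x) \<le> norm x * c"
  using bounded_linear.pos_bounded[OF bounded_clinear_imp_linear[OF assms]] by blast

subsection \<open>Orthogonal projections and adjoints\<close>

text \<open>A minimizing sequence for the distance to \<open>S\<close> is Cauchy by the
  parallelogram law, since midpoints stay in \<open>S\<close>; minimality of its limit then forces
  orthogonality.\<close>

lemma ex_orthogonal_projection:
  fixes S :: "'a::{real_inner, complete_space} set"
  assumes "subspace S" "closed S"
  shows "\<exists>y\<in>S. \<forall>z\<in>S. inner (x - y) z = 0"
proof -
  define D where "D = (INF y\<in>S. (norm (x - y))\<^sup>2)"
  have "S \<noteq> {}" using assms(1) subspace_0 by blast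
  have bdd: "bdd_below ((\<lambda>y. (norm (x - y))\<^sup>2) ` S)" by (rule bdd_belowI[of _ 0]) auto
  have D_le: "D \<le> (norm (x - y))\<^sup>2" if "y \<in> S" for y
    unfolding D_def using bdd that by (rule cINF_lower)
  have "\<exists>y\<in>S. (norm (x - y))\<^sup>2 < D + 1 / Suc m" for m
    using cINF_less_iff[OF \<open>S \<noteq> {}\<close> bdd, of "D + 1 / Suc m"] by (auto simp: D_def)
  then obtain y where y: "\<And>m. y m \<in> S" "\<And>m. (norm (x - y m))\<^sup>2 < D + 1 / Suc m" by metis
  have dist_y: "(norm (y m - y p))\<^sup>2 \<le> 2 / Suc m + 2 / Suc p" for m p
  proof -
    have mid: "(1/2) *\<^sub>R (y m + y p) \<in> S"
      using assms(1) y(1) by (simp add: subspace_add subspace_scale)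
    have "(norm (y m - y p))\<^sup>2 = 2 * (norm (x - y m))\<^sup>2 + 2 * (norm (x - y p))\<^sup>2
        - 4 * (norm (x - (1/2) *\<^sub>R (y m + y p)))\<^sup>2"
      by (simp add: power2_norm_eq_inner inner_diff_left inner_diff_right inner_add_left
          inner_add_right inner_commute algebra_simps)
    then show ?thesis using y(2)[of m] y(2)[of p] D_le[OF mid] by simp
  qed
  have "Cauchy y"
  proof (rule metric_CauchyI)
    fix e :: real assume "e > 0"
    then have "4 / e\<^sup>2 \<ge> 0" by simp
    obtain N :: nat where N: "4 / e\<^sup>2 < real N" using reals_Archimedean2 by blast
    have "dist (y m) (y p) < e" if "m \<ge> N" "p \<ge> N" for m p
    proof -
      have "0 < real N" using N \<open>4 / e\<^sup>2 \<ge> 0\<close> by linarith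
      have *: "2 / real (Suc q) < e\<^sup>2 / 2" if "q \<ge> N" for q
      proof -
        have "4 / e\<^sup>2 < real (Suc q)" using N that by simp
        then show ?thesis using \<open>e > 0\<close> by (simp add: field_simps)
      qed
      have "(norm (y m - y p))\<^sup>2 < e\<^sup>2" using dist_y[of m p] *[OF that(1)] *[OF that(2)] by simp
      then show ?thesis using \<open>e > 0\<close> by (simp add: dist_norm power2_less_imp_less)
    qed
    then show "\<exists>M. \<forall>m\<ge>M. \<forall>n\<ge>M. dist (y m) (y n) < e" by blast
  qed
  then obtain l where l: "y \<longlonglongrightarrow> l" using Cauchy_convergent convergent_def by blast
  have "l \<in> S" using closed_sequentially[OF assms(2)] y(1) l by blast
  have "(norm (x - l))\<^sup>2 \<le> D"
  proof (rule LIMSEQ_le)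
    show "(\<lambda>m. (norm (x - y m))\<^sup>2) \<longlonglongrightarrow> (norm (x - l))\<^sup>2" by (intro tendsto_intros l)
    show "(\<lambda>m. D + 1 / Suc m) \<longlonglongrightarrow> D"
      using tendsto_add[OF tendsto_const[of D] LIMSEQ_Suc[OF lim_1_over_n]] by simp
    show "\<exists>N. \<forall>m\<ge>N. (norm (x - y m))\<^sup>2 \<le> D + 1 / Suc m" using y(2) less_imp_le by blast
  qed
  have "inner (x - l) z = 0" if "z \<in> S" for z
  proof (rule ccontr)
    assume nz: "inner (x - l) z \<noteq> 0"
    then have "inner z z > 0" by auto
    \<comment> \<open>The minimizer of the quadratic polynomial t \<mapsto> |x - l - t z|^2.\<close>
    define t where "t = inner (x - l) z / inner z z"
    have "l + t *\<^sub>R z \<in> S" using assms(1) \<open>l \<in> S\<close> that by (simp add: subspace_add subspace_scale)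
    then have "(norm (x - l))\<^sup>2 \<le> (norm (x - l - t *\<^sub>R z))\<^sup>2"
      using order_trans[OF \<open>(norm (x - l))\<^sup>2 \<le> D\<close> D_le[of "l + t *\<^sub>R z"]] by (simp only: diff_diff_eq)
    also have "\<dots> = (norm (x - l))\<^sup>2 - 2 * t * inner (x - l) z + t\<^sup>2 * inner z z"
      unfolding power2_norm_eq_inner inner_diff_left[of "x - l"] inner_diff_right[of _ "x - l"]
      by (simp add: inner_commute power2_eq_square)
    also have "\<dots> = (norm (x - l))\<^sup>2 - (inner (x - l) z)\<^sup>2 / inner z z"
      using \<open>inner z z > 0\<close> by (simp add: t_def power2_eq_square)
    finally show False using nz \<open>inner z z > 0\<close> by (simp add: divide_le_0_iff not_le)
  qed
  then show ?thesis using \<open>l \<in> S\<close> by blast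
qed

text \<open>A vector w orthogonal to the kernel of f represents f up to a scalar, because x - (f x /
  f w) w lies in the kernel.\<close>

lemma riesz_representation:
  fixes f :: "'a::{real_inner, complete_space} \<Rightarrow> real"
  assumes "bounded_linear f"
  shows "\<exists>z. \<forall>x. f x = inner x z"
proof (cases "\<forall>x. f x = 0")
  case True
  then show ?thesis by (intro exI[of _ 0]) simp
next
  case False
  then obtain x0 where x0: "f x0 \<noteq> 0" by blast
  interpret f: bounded_linear f by fact
  have "subspace {x. f x = 0}" by (simp add: subspace_def f.add f.scale)
  moreover have "closed {x. f x = 0}"
    by (intro closed_Collect_eq continuous_intros linear_continuous_on assms)
  ultimately obtain y where y: "f y = 0" "\<And>z. f z = 0 \<Longrightarrow> inner (x0 - y) z = 0"
    using ex_orthogonal_projection[of "{x. f x = 0}" x0] by auto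
  define w where "w = x0 - y"
  have fw: "f w \<noteq> 0" using x0 y by (simp add: w_def f.diff)
  then have ww: "inner w w > 0" using f.zero by auto
  have "f x = inner x ((f w / inner w w) *\<^sub>R w)" for x
  proof -
    have "f (x - (f x / f w) *\<^sub>R w) = 0" using fw by (simp add: f.diff f.scale)
    then have "inner w (x - (f x / f w) *\<^sub>R w) = 0" using y(2) w_def by blast
    then have "inner x w = f x / f w * inner w w" by (simp add: inner_diff_right inner_commute)
    then show ?thesis using fw ww by simp
  qed
  then show ?thesis by blast
qed

text \<open>The imaginary part comes from the real identity at \<open>-\<i> *\<^sub>C x\<close>;
  hence an adjoint need only be tested with the real inner product.\<close>

lemma cinner_adjointI:
  assumes "bounded_clinear A" "\<And>x y. inner (A x) y = inner x (B y)"
  shows "cinner (A x) y = cinner x (B y)"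
proof -
  have "inner (A x) (\<i> *\<^sub>C y) = inner x (\<i> *\<^sub>C B y)"
    using assms(2)[of "-\<i> *\<^sub>C x" y]
    by (simp only: bounded_clinear_scaleC[OF assms(1)] inner_scaleC_left) simp
  then show ?thesis by (simp add: cinner_eq_Complex assms(2))
qed

lemma cadjoint_eqI:
  assumes "bounded_clinear A" "\<And>x y. inner (A x) y = inner x (B y)"
  shows "cadjoint A = B"
  unfolding cadjoint_def
proof (rule the_equality)
  show "\<forall>x y. cinner (A x) y = cinner x (B y)" using cinner_adjointI[OF assms] by blast
  fix C assume C: "\<forall>x y. cinner (A x) y = cinner x (C y)"
  have "C y = B y" for y
  proof -
    have "inner x (C y) = inner x (B y)" for x
      using C assms(2) by (metis inner_eq_Re_cinner)
    then show ?thesis using vector_eq_ldot by blast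
  qed
  then show "C = B" by blast
qed

lemma adjoint_bounded_clinear:
  assumes "bounded_clinear A" "\<And>x y. inner (A x) y = inner x (B y)"
  shows "bounded_clinear B"
proof -
  obtain c where c: "c > 0" "\<And>x. norm (A x) \<le> norm x * c"
    using bounded_clinear_bound[OF assms(1)] by blast
  show ?thesis
  proof (rule bounded_clinearI)
    show "B (x + y) = B x + B y" for x y
      by (subst vector_eq_ldot[symmetric]) (simp add: assms(2)[symmetric] inner_add_right)
    show "B (a *\<^sub>C x) = a *\<^sub>C B x" for a x
    proof (subst vector_eq_ldot[symmetric], intro allI)
      fix z
      have "inner z (B (a *\<^sub>C x)) = inner (cnj a *\<^sub>C A z) x"
        by (simp add: assms(2)[symmetric] inner_scaleC_left)
      also have "\<dots> = inner (cnj a *\<^sub>C z) (B x)"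
        by (simp add: assms(2)[symmetric] bounded_clinear_scaleC[OF assms(1)])
      finally show "inner z (B (a *\<^sub>C x)) = inner z (a *\<^sub>C B x)" by (simp add: inner_scaleC_left)
    qed
    show "norm (B x) \<le> norm x * c" for x
    proof -
      have "(norm (B x))\<^sup>2 = inner (A (B x)) x" by (simp add: assms(2) power2_norm_eq_inner)
      also have "\<dots> \<le> norm (A (B x)) * norm x" by (rule norm_cauchy_schwarz)
      also have "\<dots> \<le> norm (B x) * c * norm x" by (simp add: c(2) mult_right_mono)
      finally have "norm (B x) * norm (B x) \<le> norm (B x) * (norm x * c)"
        by (simp add: power2_eq_square mult_ac)
      then show ?thesis
        by (cases "norm (B x) = 0") (use c(1) in \<open>simp_all add: mult_le_cancel_left_pos\<close>)
    qed
  qed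
qed

lemma ex_adjoint:
  fixes A :: "'a::complex_hilbert \<Rightarrow> 'b::complex_hilbert"
  assumes "bounded_clinear A"
  shows "\<exists>B. \<forall>x y. inner (A x) y = inner x (B y)"
proof -
  have "\<exists>z. \<forall>x. inner (A x) y = inner x z" for y
    by (rule riesz_representation)
      (rule bounded_linear_compose[OF bounded_linear_inner_left bounded_clinear_imp_linear[OF assms]])
  then show ?thesis by metis
qed

lemma inner_cadjoint:
  assumes "bounded_clinear A"
  shows "inner (A x) y = inner x (cadjoint A y)"
  using ex_adjoint[OF assms] cadjoint_eqI[OF assms] by metis

lemma inner_cadjoint_left:
  assumes "bounded_clinear A"
  shows "inner (cadjoint A x) y = inner x (A y)"
  by (metis assms inner_cadjoint inner_commute)

lemma bounded_clinear_cadjoint: "bounded_clinear A \<Longrightarrow> bounded_clinear (cadjoint A)"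
  using adjoint_bounded_clinear inner_cadjoint by blast

lemma cadjoint_cadjoint: "bounded_clinear A \<Longrightarrow> cadjoint (cadjoint A) = A"
  by (rule cadjoint_eqI) (auto simp: bounded_clinear_cadjoint inner_cadjoint_left)

lemma cadjoint_compose:
  assumes "bounded_clinear A" "bounded_clinear B"
  shows "cadjoint (\<lambda>x. A (B x)) = (\<lambda>x. cadjoint B (cadjoint A x))"
  by (rule cadjoint_eqI) (auto simp: assms bounded_clinear_compose inner_cadjoint)

lemma cadjoint_selfadjoint:
  "bounded_clinear A \<Longrightarrow> (\<And>x y. inner (A x) y = inner x (A y)) \<Longrightarrow> cadjoint A = A"
  by (rule cadjoint_eqI)

lemma closed_csubspaceD:
  assumes "closed_csubspace H"
  shows "closed H" "0 \<in> H" "x \<in> H \<Longrightarrow> y \<in> H \<Longrightarrow> x + y \<in> H" "x \<in> H \<Longrightarrow> a *\<^sub>C x \<in> H" "subspace H"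
  using assms by (auto simp: closed_csubspace_def subspace_def scaleR_scaleC)

text \<open>\<open>H\<close> is stable under multiplication by \<i>, so real orthogonality to
  \<open>H\<close> already implies complex orthogonality.\<close>

lemma ocomplement_iff:
  assumes "closed_csubspace H"
  shows "x \<in> ocomplement H \<longleftrightarrow> (\<forall>y\<in>H. inner x y = 0)"
  using closed_csubspaceD(4)[OF assms, of _ \<i>]
  by (auto simp: ocomplement_def cinner_eq_Complex complex_eq_iff)

lemma closed_csubspace_diff: "closed_csubspace H \<Longrightarrow> x \<in> H \<Longrightarrow> y \<in> H \<Longrightarrow> x - y \<in> H"
  using closed_csubspaceD(5) subspace_diff by blast

lemma proj_unique:
  assumes "closed_csubspace H" "y \<in> H" "\<And>z. z \<in> H \<Longrightarrow> inner (x - y) z = 0"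
  shows "proj H x = y"
  unfolding proj_def
proof (rule the_equality)
  show "y \<in> H \<and> x - y \<in> ocomplement H" using assms ocomplement_iff by blast
  fix y' assume y': "y' \<in> H \<and> x - y' \<in> ocomplement H"
  have "y' - y \<in> H" using assms(1,2) y' closed_csubspace_diff by blast
  then have "inner (x - y) (y' - y) = 0" "inner (x - y') (y' - y) = 0"
    using assms y' ocomplement_iff by blast+
  then have "inner (y' - y) (y' - y) = 0" by (simp add: inner_diff_left)
  then show "y' = y" by simp
qed

lemma
  assumes "closed_csubspace H"
  shows proj_in: "proj H x \<in> H"
    and proj_orth: "z \<in> H \<Longrightarrow> inner (x - proj H x) z = 0"
proof -
  obtain y where y: "y \<in> H" "\<And>z. z \<in> H \<Longrightarrow> inner (x - y) z = 0"
    using ex_orthogonal_projection[of H x] closed_csubspaceD[OF assms] by blast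
  then have "proj H x = y" using proj_unique[OF assms] by blast
  then show "proj H x \<in> H" "z \<in> H \<Longrightarrow> inner (x - proj H x) z = 0" using y by auto
qed

lemma proj_idem: "closed_csubspace H \<Longrightarrow> x \<in> H \<Longrightarrow> proj H x = x"
  by (rule proj_unique) auto

lemma diff_proj_ocomplement: "closed_csubspace H \<Longrightarrow> x - proj H x \<in> ocomplement H"
  by (simp add: ocomplement_iff proj_orth)

lemma proj_ocomplement: "closed_csubspace H \<Longrightarrow> x \<in> ocomplement H \<Longrightarrow> proj H x = 0"
  by (rule proj_unique) (auto simp: closed_csubspaceD ocomplement_iff)

lemma inner_proj:
  assumes "closed_csubspace H"
  shows "inner (proj H x) y = inner x (proj H y)"
proof -
  have "inner (proj H x) (y - proj H y) = 0" "inner (x - proj H x) (proj H y) = 0"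
    using proj_orth[OF assms] proj_in[OF assms] by (auto simp: inner_commute)
  then show ?thesis by (simp add: inner_diff_left inner_diff_right)
qed

lemma norm_proj_sq: "closed_csubspace H \<Longrightarrow> (norm (proj H x))\<^sup>2 = inner (proj H x) x"
  by (metis inner_proj power2_norm_eq_inner proj_idem proj_in)

lemma norm_proj_le:
  assumes "closed_csubspace H"
  shows "norm (proj H x) \<le> norm x"
proof -
  have "norm (proj H x) * norm (proj H x) \<le> norm (proj H x) * norm x"
    using norm_proj_sq[OF assms, of x] norm_cauchy_schwarz[of "proj H x" x]
    by (simp add: power2_eq_square)
  then show ?thesis
    by (cases "norm (proj H x) = 0") (simp_all add: mult_le_cancel_left_pos)
qed

lemma bounded_clinear_proj:
  assumes "closed_csubspace H"
  shows "bounded_clinear (proj H)"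
proof (rule bounded_clinearI[where c = 1])
  note D = closed_csubspaceD[OF assms]
  show "proj H (x + y) = proj H x + proj H y" for x y
  proof (rule proj_unique[OF assms])
    show "inner (x + y - (proj H x + proj H y)) z = 0" if "z \<in> H" for z
      using proj_orth[OF assms that, of x] proj_orth[OF assms that, of y]
      by (simp add: inner_diff_left inner_add_left)
  qed (simp add: D(3) proj_in[OF assms])
  show "proj H (a *\<^sub>C x) = a *\<^sub>C proj H x" for a x
  proof (rule proj_unique[OF assms])
    show "inner (a *\<^sub>C x - a *\<^sub>C proj H x) z = 0" if "z \<in> H" for z
      using proj_orth[OF assms D(4)[OF that]]
      by (simp add: inner_scaleC_left scaleC_diff_right[symmetric])
  qed (simp add: D(4) proj_in[OF assms])
qed (use norm_proj_le[OF assms] in simp)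

lemma cadjoint_proj: "closed_csubspace H \<Longrightarrow> cadjoint (proj H) = proj H"
  by (rule cadjoint_selfadjoint) (auto simp: bounded_clinear_proj inner_proj)

lemma bopsD:
  assumes "A \<in> bops H K"
  shows "bounded_clinear A" "A x \<in> K" "x \<in> ocomplement H \<Longrightarrow> A x = 0"
  using assms by (auto simp: bops_def)

lemma bops_proj:
  assumes "A \<in> bops H K" "closed_csubspace H"
  shows "A (proj H x) = A x"
  using bopsD(3)[OF assms(1) diff_proj_ocomplement[OF assms(2), of x]]
  by (simp add: bounded_clinear_simps[OF bopsD(1)[OF assms(1)]])

lemma bopsI:
  assumes "bounded_clinear A" "closed_csubspace H" "\<And>x. A x \<in> K" "\<And>x. A (proj H x) = A x"
  shows "A \<in> bops H K"
  using assms by (auto simp: bops_def) (metis bounded_clinear_simps(3) proj_ocomplement)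

lemma bops_cadjoint:
  assumes "A \<in> bops H K" "closed_csubspace H" "closed_csubspace K"
  shows "cadjoint A \<in> bops K H"
proof (rule bopsI[OF bounded_clinear_cadjoint[OF bopsD(1)[OF assms(1)]] assms(3)])
  note A = bopsD[OF assms(1)]
  have "proj H (cadjoint A x) = cadjoint A x" for x
    by (subst vector_eq_ldot[symmetric])
      (metis A(1) assms(1,2) bops_proj inner_cadjoint inner_proj)
  then show "cadjoint A x \<in> H" for x using proj_in[OF assms(2)] by metis
  show "cadjoint A (proj K x) = cadjoint A x" for x
    by (subst vector_eq_ldot[symmetric])
      (metis A(1) A(2) assms(3) inner_cadjoint inner_proj proj_idem)
qed

lemma bops_compose:
  "A \<in> bops K L \<Longrightarrow> B \<in> bops H K' \<Longrightarrow> (\<lambda>x. A (B x)) \<in> bops H L"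
  by (auto simp: bops_def bounded_clinear_compose bounded_clinear_simps)

lemma proj_bops: "closed_csubspace H \<Longrightarrow> proj H \<in> bops H H"
  by (auto simp: bops_def bounded_clinear_proj proj_in proj_ocomplement)

text \<open>Polarization at x + y with y = A x - B x. This is the way back from computations with
  quadratic forms to operators.\<close>

lemma selfadjoint_eqI:
  assumes "bounded_clinear A" "bounded_clinear B"
    and "\<And>x y. inner (A x) y = inner x (A y)" "\<And>x y. inner (B x) y = inner x (B y)"
    and "\<And>x. inner (A x) x = inner (B x) x"
  shows "A = B"
proof
  fix x
  define y where "y = A x - B x"
  have "inner (A (x + y)) (x + y) = inner (B (x + y)) (x + y)" by (rule assms)
  then have "inner (A x) y + inner (A y) x = inner (B x) y + inner (B y) x"
    using assms(5)[of x] assms(5)[of y]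
    by (simp add: bounded_clinear_simps[OF assms(1)] bounded_clinear_simps[OF assms(2)]
        inner_add_left inner_add_right)
  moreover have "inner (A y) x = inner (A x) y" "inner (B y) x = inner (B x) y"
    using assms(3,4) by (metis inner_commute)+
  ultimately have "inner (A x - B x) y = 0" by (simp add: inner_diff_left)
  then show "A x = B x" by (simp add: y_def)
qed

subsection \<open>Positive operators and their square roots\<close>

lemma selfadjoint_inner_ii:
  assumes "bounded_clinear A" "\<And>x y. inner (A x) y = inner x (A y)"
  shows "inner (A x) (\<i> *\<^sub>C x) = 0"
proof -
  have "inner (A x) (\<i> *\<^sub>C x) = inner x (\<i> *\<^sub>C A x)"
    using assms(2)[of x "\<i> *\<^sub>C x"] by (simp add: bounded_clinear_scaleC[OF assms(1)])
  also have "\<dots> = inner (cnj \<i> *\<^sub>C x) (A x)" by (simp add: inner_scaleC_left)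
  also have "\<dots> = - inner (A x) (\<i> *\<^sub>C x)"
    by (simp add: scaleC_minus_left inner_commute)
  finally show ?thesis by simp
qed

text \<open>Over the complex numbers a real-valued quadratic form forces self-adjointness:
  polarizing \<open>real\<close> gives \<open>skew\<close>, and putting \<i> y for y in it removes
  the imaginary unit.\<close>

lemma pos_op_iff:
  "pos_op A \<longleftrightarrow> bounded_clinear A \<and> (\<forall>x y. inner (A x) y = inner x (A y)) \<and> (\<forall>x. 0 \<le> inner (A x) x)"
proof safe
  assume A: "pos_op A"
  then show lin: "bounded_clinear A" by (simp add: pos_op_def)
  note s = bounded_clinear_simps[OF lin]
  show "0 \<le> inner (A x) x" for x
    using A by (auto simp: pos_op_def inner_eq_Re_cinner complex_nonneg_Reals_iff)
  have real: "inner (A x) (\<i> *\<^sub>C x) = 0" for x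
    using A by (auto simp: pos_op_def cinner_eq_Complex complex_nonneg_Reals_iff)
  have skew: "inner (A x) (\<i> *\<^sub>C y) = - inner (A y) (\<i> *\<^sub>C x)" for x y
    using real[of "x + y"] real[of x] real[of y]
    by (simp add: s scaleC_add_right inner_add_left inner_add_right)
  show "inner (A x) y = inner x (A y)" for x y
  proof -
    have "inner (A x) y = - inner (A x) (\<i> *\<^sub>C \<i> *\<^sub>C y)"
      by (simp add: scaleC_scaleC scaleC_minus_left)
    also have "\<dots> = inner (\<i> *\<^sub>C A y) (\<i> *\<^sub>C x)" using skew[of x "\<i> *\<^sub>C y"] by (simp add: s)
    also have "\<dots> = inner (A y) x" by (simp add: inner_scaleC_scaleC)
    finally show ?thesis by (simp add: inner_commute)
  qed
next
  assume A: "bounded_clinear A" "\<forall>x y. inner (A x) y = inner x (A y)" "\<forall>x. 0 \<le> inner (A x) x"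
  have "inner (A x) (\<i> *\<^sub>C x) = 0" for x
    using selfadjoint_inner_ii[OF A(1)] A(2) by blast
  then show "pos_op A" using A(1,3) by (auto simp: pos_op_def cinner_eq_Complex complex_nonneg_Reals_iff)
qed

lemma pos_opD:
  assumes "pos_op A"
  shows "bounded_clinear A" "inner (A x) y = inner x (A y)" "0 \<le> inner (A x) x" "cadjoint A = A"
  using assms cadjoint_selfadjoint by (auto simp: pos_op_iff)

text \<open>If A x were nonzero, the form would become negative a little way from x in the direction
  - A x.\<close>

lemma pos_op_inner_zero:
  assumes "pos_op A" "inner (A x) x = 0"
  shows "A x = 0"
proof (rule ccontr)
  assume "A x \<noteq> 0"
  then have n: "inner (A x) (A x) > 0" by simp
  note A = pos_opD[OF assms(1)]
  note s = bounded_clinear_simps[OF A(1)]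
  define c where "c = inner (A (A x)) (A x)"
  define m where "m = inner (A x) (A x)"
  \<comment> \<open>Negative, but with |t| c at most m, so that 2 m + t c stays positive; the
    summand 1 covers c = 0.\<close>
  define t where "t = - m / (c + 1)"
  have c: "c \<ge> 0" and m: "m > 0" using A(3) n by (simp_all add: c_def m_def)
  have "0 \<le> inner (A (x + t *\<^sub>R A x)) (x + t *\<^sub>R A x)" by (rule A(3))
  also have "\<dots> = t * (2 * m + t * c)"
    using assms(2) A(2)[of "A x" x] by (simp add: s inner_add_left inner_add_right c_def m_def
        algebra_simps)
  finally have "0 \<le> t * (2 * m + t * c)" .
  moreover have "t < 0" using m c by (simp add: t_def divide_less_0_iff)
  ultimately have "2 * m + t * c \<le> 0" by (simp add: zero_le_mult_iff)
  moreover have "t * c \<ge> - m" using m c by (simp add: t_def field_simps)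
  ultimately show False using m by simp
qed

text \<open>Positivity at the single vector x - A x already yields the norm bound.\<close>

lemma pos_op_contraction:
  assumes "pos_op A" "\<And>x. inner (A x) x \<le> (norm x)\<^sup>2"
  shows "norm (A x) \<le> norm x"
proof -
  note A = pos_opD[OF assms(1)]
  note s = bounded_clinear_simps[OF A(1)]
  have "0 \<le> inner (A (x - A x)) (x - A x)" by (rule A(3))
  also have "\<dots> = inner (A x) x - 2 * (norm (A x))\<^sup>2 + inner (A (A x)) (A x)"
    using A(2)[of "A x" x] by (simp add: s inner_diff_left inner_diff_right power2_norm_eq_inner)
  also have "\<dots> \<le> (norm x)\<^sup>2 - (norm (A x))\<^sup>2" using assms(2)[of x] assms(2)[of "A x"] by simp
  finally have "(norm (A x))\<^sup>2 \<le> (norm x)\<^sup>2" by linarith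
  then show ?thesis by (rule power2_le_imp_le) simp
qed

text \<open>The iteration \<open>R \<mapsto> (X + R\<^sup>2) / 2\<close> has a fixed point \<open>R\<close>, for which \<open>(I - R)\<^sup>2 = I - X\<close>.  Its
  increments are dominated by those of the scalar iteration for \<open>X = 1\<close>.\<close>

primrec sqrt_iter :: "('a::complex_hilbert \<Rightarrow> 'a) \<Rightarrow> nat \<Rightarrow> 'a \<Rightarrow> 'a"
  where "sqrt_iter X 0 = (\<lambda>x. 0)"
  | "sqrt_iter X (Suc m) = (\<lambda>x. (1/2) *\<^sub>R (X x + sqrt_iter X m (sqrt_iter X m x)))"

primrec scalar_iter :: "nat \<Rightarrow> real"
  where "scalar_iter 0 = 0"
  | "scalar_iter (Suc m) = (1 + (scalar_iter m)\<^sup>2) / 2"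

lemma scalar_iter_bounds: "0 \<le> scalar_iter m" "scalar_iter m \<le> 1"
  by (induction m) (auto simp: power_le_one)

lemma scalar_iter_Suc_ge: "scalar_iter m \<le> scalar_iter (Suc m)"
  using zero_le_power2[of "scalar_iter m - 1"] by (simp add: power2_eq_square algebra_simps)

lemma Cauchy_scalar_iter: "Cauchy scalar_iter"
  using incseq_convergent[of scalar_iter 1] incseq_SucI[of scalar_iter] scalar_iter_Suc_ge
    scalar_iter_bounds(2) LIMSEQ_imp_Cauchy by metis

lemma bounded_clinear_sqrt_iter: "bounded_clinear X \<Longrightarrow> bounded_clinear (sqrt_iter X m)"
proof (induction m)
  case (Suc m)
  have "bounded_clinear (\<lambda>x. sqrt_iter X m (sqrt_iter X m x))"
    by (rule bounded_clinear_compose[OF Suc.IH[OF Suc.prems] Suc.IH[OF Suc.prems]])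
  with Suc.prems show ?case
    unfolding sqrt_iter.simps by (intro bounded_clinear_scaleR bounded_clinear_add)
qed (simp add: bounded_clinear_zero)

lemma sqrt_iter_commute:
  assumes "bounded_clinear C" "\<And>x. C (X x) = X (C x)"
  shows "C (sqrt_iter X m x) = sqrt_iter X m (C x)"
proof (induction m arbitrary: x)
  case 0
  then show ?case by (simp add: bounded_clinear_simps[OF assms(1)])
next
  case (Suc m)
  then show ?case by (simp add: bounded_clinear_simps(1,5)[OF assms(1)] assms(2))
qed

lemma sqrt_iter_selfadjoint:
  assumes "\<And>x y. inner (X x) y = inner x (X y)"
  shows "inner (sqrt_iter X m x) y = inner x (sqrt_iter X m y)"
  by (induction m arbitrary: x y) (auto simp: inner_add_left inner_add_right assms)

lemma norm_sqrt_iter: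
  assumes "\<And>x. norm (X x) \<le> norm x"
  shows "norm (sqrt_iter X m x) \<le> scalar_iter m * norm x"
proof (induction m arbitrary: x)
  case (Suc m)
  have "norm (sqrt_iter X m (sqrt_iter X m x)) \<le> scalar_iter m * (scalar_iter m * norm x)"
    using Suc[of "sqrt_iter X m x"] mult_left_mono[OF Suc[of x] scalar_iter_bounds(1)]
    by (rule order_trans)
  then have "norm (X x + sqrt_iter X m (sqrt_iter X m x)) \<le> norm x + scalar_iter m * (scalar_iter m * norm x)"
    using assms[of x] norm_triangle_ineq[of "X x" "sqrt_iter X m (sqrt_iter X m x)"] by linarith
  then show ?case by (simp add: power2_eq_square distrib_right mult.assoc)
qed simp

lemma norm_sqrt_iter_Suc_diff:
  assumes X: "bounded_clinear X" "\<And>x. norm (X x) \<le> norm x"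
  shows "norm (sqrt_iter X (Suc m) x - sqrt_iter X m x)
    \<le> (scalar_iter (Suc m) - scalar_iter m) * norm x"
proof (induction m arbitrary: x)
  case 0
  then show ?case using X(2)[of x] by simp
next
  case (Suc m)
  let ?a = "sqrt_iter X (Suc m)" and ?b = "sqrt_iter X m"
  let ?s = "scalar_iter (Suc m)" and ?t = "scalar_iter m"
  \<comment> \<open>Noncommutative form of s^2 - t^2 = s (s - t) + (s - t) t; bounding each piece by
    its scalar counterpart reproduces exactly s^2 - t^2.\<close>
  have "?a (?a x) - ?b (?b x) = ?a (?a x - ?b x) + (?a (?b x) - ?b (?b x))"
    by (simp only: bounded_clinear_simps(2)[OF bounded_clinear_sqrt_iter[OF X(1)]]) simp
  then have "norm (?a (?a x) - ?b (?b x)) \<le> norm (?a (?a x - ?b x)) + norm (?a (?b x) - ?b (?b x))"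
    by (metis norm_triangle_ineq)
  also have "\<dots> \<le> ?s * norm (?a x - ?b x) + (?s - ?t) * norm (?b x)"
    by (intro add_mono norm_sqrt_iter Suc X)
  also have "\<dots> \<le> ?s * ((?s - ?t) * norm x) + (?s - ?t) * (?t * norm x)"
    by (intro add_mono mult_left_mono Suc norm_sqrt_iter X scalar_iter_bounds)
      (use scalar_iter_Suc_ge[of m] in simp)
  also have "\<dots> = (?s\<^sup>2 - ?t\<^sup>2) * norm x" by (simp add: power2_eq_square algebra_simps del: scalar_iter.simps)
  finally have "norm (?a (?a x) - ?b (?b x)) \<le> (?s\<^sup>2 - ?t\<^sup>2) * norm x" .
  moreover have "sqrt_iter X (Suc (Suc m)) x - ?a x = (1/2) *\<^sub>R (?a (?a x) - ?b (?b x))"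
    by (simp only: sqrt_iter.simps(2)[of X "Suc m"] sqrt_iter.simps(2)[of X m]) (simp add: algebra_simps)
  moreover have "scalar_iter (Suc (Suc m)) - ?s = (?s\<^sup>2 - ?t\<^sup>2) / 2"
    by (simp add: field_simps)
  ultimately show ?case by (simp only: norm_scaleR)
qed

lemma norm_sqrt_iter_diff:
  assumes "bounded_clinear X" "\<And>x. norm (X x) \<le> norm x" "m \<le> p"
  shows "norm (sqrt_iter X p x - sqrt_iter X m x) \<le> (scalar_iter p - scalar_iter m) * norm x"
  using assms(3)
proof (induction p rule: dec_induct)
  case (step p)
  then show ?case
    using norm_sqrt_iter_Suc_diff[OF assms(1,2), of p x]
      norm_triangle_ineq[of "sqrt_iter X (Suc p) x - sqrt_iter X p x" "sqrt_iter X p x - sqrt_iter X m x"]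
    by (simp only: left_diff_distrib) simp
qed simp

text \<open>The commutation clause is carried along for the uniqueness of square roots: the iterates
  are built from \<open>X\<close>, so whatever commutes with \<open>X\<close> commutes with their
  strong limit.\<close>

lemma ex_sqrt_one_minus:
  fixes X :: "'a::complex_hilbert \<Rightarrow> 'a"
  assumes X: "bounded_clinear X" "\<And>x. norm (X x) \<le> norm x" "\<And>x y. inner (X x) y = inner x (X y)"
  shows "\<exists>B. pos_op B \<and> (\<forall>x. B (B x) = x - X x) \<and>
    (\<forall>C. bounded_clinear C \<longrightarrow> (\<forall>x. C (X x) = X (C x)) \<longrightarrow> (\<forall>x. C (B x) = B (C x)))"
proof -
  have "Cauchy (\<lambda>m. sqrt_iter X m x)" for x
  proof (rule metric_CauchyI)
    fix e :: real assume "e > 0"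
    then have "e / (norm x + 1) > 0" by (simp add: add_nonneg_pos)
    then obtain N where N: "\<And>m p. m \<ge> N \<Longrightarrow> p \<ge> N \<Longrightarrow> dist (scalar_iter m) (scalar_iter p) < e / (norm x + 1)"
      using metric_CauchyD[OF Cauchy_scalar_iter] by blast
    have *: "dist (sqrt_iter X m x) (sqrt_iter X p x) < e" if "N \<le> m" "m \<le> p" for m p
    proof -
      have "dist (sqrt_iter X m x) (sqrt_iter X p x) \<le> (scalar_iter p - scalar_iter m) * norm x"
        using norm_sqrt_iter_diff[OF X(1,2) that(2)] by (simp add: dist_norm norm_minus_commute)
      also have "\<dots> \<le> e / (norm x + 1) * norm x"
        using N[of m p] that by (intro mult_right_mono) (auto simp: dist_real_def)
      also have "\<dots> < e / (norm x + 1) * (norm x + 1)"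
        using \<open>e / (norm x + 1) > 0\<close> by (intro mult_strict_left_mono) auto
      also have "\<dots> = e" using norm_ge_zero[of x] by (simp add: add_nonneg_eq_0_iff)
      finally show ?thesis .
    qed
    show "\<exists>M. \<forall>m\<ge>M. \<forall>p\<ge>M. dist (sqrt_iter X m x) (sqrt_iter X p x) < e"
    proof (intro exI[of _ N] allI impI)
      fix m p assume "N \<le> m" "N \<le> p"
      then show "dist (sqrt_iter X m x) (sqrt_iter X p x) < e"
        using *[of m p] *[of p m] by (cases "m \<le> p") (auto simp: dist_commute)
    qed
  qed
  then have "\<exists>l. (\<lambda>m. sqrt_iter X m x) \<longlonglongrightarrow> l" for x
    using Cauchy_convergent convergent_def by blast
  then obtain R where R: "\<And>x. (\<lambda>m. sqrt_iter X m x) \<longlonglongrightarrow> R x" by metis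
  note S = bounded_clinear_simps[OF bounded_clinear_sqrt_iter[OF X(1)]]
  have norm_iter: "norm (sqrt_iter X m x) \<le> norm x" for m x
    using norm_sqrt_iter[OF X(2), of m x] mult_right_mono[OF scalar_iter_bounds(2)[of m], of "norm x"]
    by simp
  have norm_R: "norm (R x) \<le> norm x" for x
    by (rule LIMSEQ_le_const2[OF tendsto_norm[OF R]]) (use norm_iter in blast)
  have linR: "bounded_clinear R"
  proof (rule bounded_clinearI[where c = 1])
    show "R (x + y) = R x + R y" for x y
      using LIMSEQ_unique[OF R[of "x + y"]] tendsto_add[OF R[of x] R[of y]] by (simp add: S)
    show "R (a *\<^sub>C x) = a *\<^sub>C R x" for a x
    proof -
      from bounded_clinear_tendsto[OF bounded_clinear_scaleC_right R[of x]]
      show ?thesis using LIMSEQ_unique[OF R[of "a *\<^sub>C x"]] by (simp add: S)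
    qed
  qed (use norm_R in simp)
  have saR: "inner (R x) y = inner x (R y)" for x y
    using LIMSEQ_unique[OF tendsto_inner[OF R[of x] tendsto_const[of y]]]
      tendsto_inner[OF tendsto_const[of x] R[of y]] sqrt_iter_selfadjoint[of X, OF X(3)] by simp
  \<comment> \<open>Convergence is only pointwise; the uniform bound \<open>norm_iter\<close> is
    what lets it pass to the product.\<close>
  have RR: "(\<lambda>m. sqrt_iter X m (sqrt_iter X m x)) \<longlonglongrightarrow> R (R x)" for x
  proof -
    have "(\<lambda>m. norm (sqrt_iter X m x - R x)) \<longlonglongrightarrow> 0"
      using tendsto_norm[OF LIM_zero[OF R[of x]]] by simp
    then have "(\<lambda>m. sqrt_iter X m (sqrt_iter X m x - R x)) \<longlonglongrightarrow> 0"
      by (rule tendsto_0_le[where K = 1]) (use norm_iter in simp)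
    from tendsto_add[OF this R[of "R x"]] show ?thesis by (simp add: S)
  qed
  have fixR: "2 *\<^sub>R R x = X x + R (R x)" for x
  proof -
    have "(\<lambda>m. sqrt_iter X (Suc m) x) \<longlonglongrightarrow> (1/2) *\<^sub>R (X x + R (R x))"
      unfolding sqrt_iter.simps by (intro tendsto_intros RR)
    then have "R x = (1/2) *\<^sub>R (X x + R (R x))" using LIMSEQ_unique LIMSEQ_Suc[OF R[of x]] by blast
    then have "2 *\<^sub>R R x = 2 *\<^sub>R ((1/2) *\<^sub>R (X x + R (R x)))" by simp
    then show ?thesis by simp
  qed
  have comR: "C (R x) = R (C x)" if "bounded_clinear C" "\<And>x. C (X x) = X (C x)" for C x
    using LIMSEQ_unique[OF R[of "C x"]] bounded_clinear_tendsto[OF that(1) R[of x]]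
      sqrt_iter_commute[of C X, OF that] by simp
  define B where "B = (\<lambda>x. x - R x)"
  have "pos_op B"
    unfolding pos_op_iff
  proof (intro conjI allI)
    show "bounded_clinear B" unfolding B_def by (intro bounded_clinear_diff bounded_clinear_id linR)
    show "inner (B x) y = inner x (B y)" for x y
      by (simp add: B_def inner_diff_left inner_diff_right saR)
    show "0 \<le> inner (B x) x" for x
    proof -
      have "inner (R x) x \<le> norm (R x) * norm x" by (rule norm_cauchy_schwarz)
      also have "\<dots> \<le> norm x * norm x" using norm_R by (simp add: mult_right_mono)
      finally show ?thesis by (simp add: B_def inner_diff_left power2_norm_eq_inner[symmetric]
            power2_eq_square)
    qed
  qed
  moreover have "B (B x) = x - X x" for x
    using fixR[of x] by (simp add: B_def bounded_clinear_simps[OF linR] scaleR_2 algebra_simps)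
  moreover have "C (B x) = B (C x)" if "bounded_clinear C" "\<And>x. C (X x) = X (C x)" for C x
    using comR[OF that] by (simp add: B_def bounded_clinear_simps[OF that(1)])
  ultimately show ?thesis by blast
qed

lemma ex_pos_sqrt:
  assumes "pos_op A"
  shows "\<exists>B. pos_op B \<and> (\<forall>x. B (B x) = A x) \<and>
    (\<forall>C. bounded_clinear C \<longrightarrow> (\<forall>x. C (A x) = A (C x)) \<longrightarrow> (\<forall>x. C (B x) = B (C x)))"
proof -
  note A = pos_opD[OF assms]
  obtain c where c: "c > 0" "\<And>x. norm (A x) \<le> norm x * c"
    using bounded_clinear_bound A(1) by blast
  \<comment> \<open>Scaling by the norm bound c gives 0 <= X <= I, so \<open>X\<close> is a
    contraction; the root of I - X = A / c is scaled back by sqrt c.\<close>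
  define X where "X = (\<lambda>x. x - (1/c) *\<^sub>R A x)"
  have lin: "bounded_clinear X"
    unfolding X_def using A(1) by (intro bounded_clinear_diff bounded_clinear_id bounded_clinear_scaleR)
  have sa: "inner (X x) y = inner x (X y)" for x y
    using A(2) by (simp add: X_def inner_diff_left inner_diff_right)
  have Ale: "inner (A x) x \<le> c * (norm x)\<^sup>2" for x
    using norm_cauchy_schwarz[of "A x" x] mult_right_mono[OF c(2)[of x] norm_ge_zero[of x]]
    by (simp add: power2_eq_square mult_ac)
  have "0 \<le> inner (X x) x" for x
    using Ale[of x] c(1) by (simp add: X_def inner_diff_left power2_norm_eq_inner field_simps)
  then have "pos_op X" using lin sa unfolding pos_op_iff by blast
  moreover have Xle: "inner (X x) x \<le> (norm x)\<^sup>2" for x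
    using A(3) c(1) by (simp add: X_def inner_diff_left power2_norm_eq_inner)
  ultimately have "norm (X x) \<le> norm x" for x using pos_op_contraction by blast
  from ex_sqrt_one_minus[OF lin this sa] obtain B where B: "pos_op B" "\<And>x. B (B x) = x - X x"
    "\<And>C x. bounded_clinear C \<Longrightarrow> (\<forall>x. C (X x) = X (C x)) \<Longrightarrow> C (B x) = B (C x)" by blast
  note Bs = pos_opD[OF B(1)]
  show ?thesis
  proof (intro exI[of _ "\<lambda>x. sqrt c *\<^sub>R B x"] conjI allI impI)
    show "pos_op (\<lambda>x. sqrt c *\<^sub>R B x)"
      unfolding pos_op_iff using Bs(2,3) c(1) by (auto intro: bounded_clinear_scaleR Bs(1))
    show "sqrt c *\<^sub>R B (sqrt c *\<^sub>R B x) = A x" for x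
      using c(1) by (simp add: bounded_clinear_simps[OF Bs(1)] B(2) X_def)
    fix C x assume C: "bounded_clinear C" "\<forall>x. C (A x) = A (C x)"
    then have "\<forall>x. C (X x) = X (C x)" by (simp add: X_def bounded_clinear_simps[OF C(1)])
    then show "C (sqrt c *\<^sub>R B x) = sqrt c *\<^sub>R B (C x)"
      using B(3)[OF C(1)] by (simp add: bounded_clinear_simps[OF C(1)])
  qed
qed

text \<open>Another root C commutes with A = C^2 and hence with the constructed root S. For w = S x
  - C x this gives (S + C) w = 0, positivity splits it into S w = C w = 0, and then |w|^2 = <x, (S -
  C) w> = 0.\<close>

lemma op_sqrt_unique:
  assumes "pos_op B" "\<And>x. B (B x) = A x" "pos_op A"
  shows "op_sqrt A = B"
proof -
  obtain S where S: "pos_op S" "\<And>x. S (S x) = A x"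
    "\<And>C x. bounded_clinear C \<Longrightarrow> (\<forall>x. C (A x) = A (C x)) \<Longrightarrow> C (S x) = S (C x)"
    using ex_pos_sqrt[OF assms(3)] by blast
  have *: "C = S" if C: "pos_op C" "\<And>x. C (C x) = A x" for C
  proof
    fix x
    note Cs = pos_opD[OF C(1)] and Ss = pos_opD[OF S(1)]
    note lin = bounded_clinear_simps[OF Cs(1)] bounded_clinear_simps[OF Ss(1)]
    have com: "C (S x) = S (C x)" for x using S(3)[OF Cs(1), of x] C(2) by metis
    define w where "w = S x - C x"
    have "S w + C w = 0" by (simp add: w_def lin com S(2) C(2))
    then have "inner (S w) w + inner (C w) w = 0" by (metis inner_add_left inner_zero_left)
    moreover have "inner (S w) w \<ge> 0" "inner (C w) w \<ge> 0" using Cs(3) Ss(3) by blast+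
    ultimately have "S w = 0" "C w = 0" using pos_op_inner_zero S(1) C(1)
      by (metis add_nonneg_eq_0_iff)+
    then have "inner (S x - C x) w = 0"
      by (simp add: inner_diff_left Cs(2) Ss(2))
    then show "C x = S x" by (simp add: w_def)
  qed
  show ?thesis
    unfolding op_sqrt_def
  proof (rule the_equality)
    show "pos_op B \<and> B \<circ> B = A" using assms by auto
    show "C = B" if "pos_op C \<and> C \<circ> C = A" for C
      using *[of C] *[of B] that assms by (metis comp_apply)
  qed
qed

lemma
  assumes "pos_op A"
  shows pos_op_sqrt: "pos_op (op_sqrt A)" and op_sqrt_sqrt: "op_sqrt A (op_sqrt A x) = A x"
  using ex_pos_sqrt[OF assms] op_sqrt_unique[OF _ _ assms] by metis+

lemma norm_op_sqrt_sq:
  assumes "pos_op A"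
  shows "(norm (op_sqrt A x))\<^sup>2 = inner (A x) x"
  by (metis assms op_sqrt_sqrt pos_opD(2) pos_op_sqrt power2_norm_eq_inner)

lemma op_sqrt_eq_0_iff: "pos_op A \<Longrightarrow> op_sqrt A x = 0 \<longleftrightarrow> A x = 0"
  by (metis bounded_clinear_simps(3) inner_zero_left norm_eq_zero norm_op_sqrt_sq op_sqrt_sqrt
      pos_opD(1) pos_op_sqrt power_zero_numeral zero_eq_power2)

subsection \<open>Ranges of operators\<close>

lemma closure_seqE:
  fixes S :: "'a::metric_space set"
  assumes "x \<in> closure S"
  obtains f where "\<And>m::nat. f m \<in> S" "f \<longlonglongrightarrow> x"
  using assms unfolding closure_sequential by auto

lemma closed_csubspace_closure:
  fixes S :: "'a::complex_hilbert set"
  assumes "0 \<in> S" "\<And>x y. x \<in> S \<Longrightarrow> y \<in> S \<Longrightarrow> x + y \<in> S" "\<And>a x. x \<in> S \<Longrightarrow> a *\<^sub>C x \<in> S"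
  shows "closed_csubspace (closure S)"
  unfolding closed_csubspace_def
proof (intro conjI ballI allI)
  show "0 \<in> closure S" using assms(1) closure_subset by blast
  show "x + y \<in> closure S" if xy: "x \<in> closure S" "y \<in> closure S" for x y
  proof -
    obtain f where "\<And>m. f m \<in> S" "f \<longlonglongrightarrow> x" using closure_seqE[OF xy(1)] by blast
    moreover obtain g where "\<And>m. g m \<in> S" "g \<longlonglongrightarrow> y" using closure_seqE[OF xy(2)] by blast
    ultimately show ?thesis unfolding closure_sequential
      by (intro exI[of _ "\<lambda>m. f m + g m"]) (auto intro: assms tendsto_add)
  qed
  show "a *\<^sub>C x \<in> closure S" if x: "x \<in> closure S" for a x
  proof -
    obtain f where f: "\<And>m. f m \<in> S" "f \<longlonglongrightarrow> x"
      using closure_seqE[OF x] by blast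
    from bounded_clinear_tendsto[OF bounded_clinear_scaleC_right f(2)] show ?thesis unfolding closure_sequential
      by (intro exI[of _ "\<lambda>m. a *\<^sub>C f m"]) (auto intro: assms f)
  qed
qed simp

lemma closed_csubspace_closure_range:
  assumes "bounded_clinear A"
  shows "closed_csubspace (closure (range A))"
proof (rule closed_csubspace_closure)
  note s = bounded_clinear_simps[OF assms]
  show "0 \<in> range A" using s(3) by (metis rangeI)
  show "x + y \<in> range A" if "x \<in> range A" "y \<in> range A" for x y
    using that by (auto simp: s(1)[symmetric])
  show "a *\<^sub>C x \<in> range A" if "x \<in> range A" for a x
    using that by (auto simp: s(7)[symmetric])
qed

lemma image_bops_eq_range:
  assumes "A \<in> bops H K" "closed_csubspace H"
  shows "A ` H = range A"
  using bops_proj[OF assms] proj_in[OF assms(2)] by (metis (no_types, opaque_lifting) UNIV_I image_eqI image_subset_iff subset_antisym top_greatest image_mono)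

lemma in_closed_csubspaceI:
  assumes "closed_csubspace H" "\<And>z. (\<And>y. y \<in> H \<Longrightarrow> inner y z = 0) \<Longrightarrow> inner x z = 0"
  shows "x \<in> H"
proof -
  define z where "z = x - proj H x"
  have z: "inner y z = 0" if "y \<in> H" for y
    using proj_orth[OF assms(1) that, of x] by (simp add: z_def inner_commute)
  then have "inner x z = 0" using assms(2) by blast
  moreover have "inner (proj H x) z = 0" using z proj_in[OF assms(1)] by blast
  ultimately have "inner z z = 0" by (simp add: inner_diff_left z_def)
  then have "x = proj H x" by (simp add: z_def)
  then show ?thesis using proj_in[OF assms(1)] by metis
qed

text \<open>The orthogonal complement of the range is the kernel of the adjoint.\<close>

lemma in_closure_rangeI:
  assumes "bounded_clinear A" "\<And>z. cadjoint A z = 0 \<Longrightarrow> inner x z = 0"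
  shows "x \<in> closure (range A)"
proof (rule in_closed_csubspaceI[OF closed_csubspace_closure_range[OF assms(1)]])
  fix z assume z: "\<And>y. y \<in> closure (range A) \<Longrightarrow> inner y z = 0"
  have "inner y (cadjoint A z) = 0" for y
    using z[of "A y"] closure_subset[of "range A"] by (auto simp: inner_cadjoint[OF assms(1), symmetric])
  then have "cadjoint A z = 0" using inner_eq_zero_iff by blast
  then show "inner x z = 0" by (rule assms(2))
qed

lemma cadjoint_zero_iff_ocomplement:
  assumes "bounded_clinear A"
  shows "z \<in> ocomplement (closure (range A)) \<longleftrightarrow> cadjoint A z = 0"
proof
  assume "z \<in> ocomplement (closure (range A))"
  then have "inner z (A y) = 0" for y
    using closure_subset[of "range A"]
    by (auto simp: ocomplement_iff[OF closed_csubspace_closure_range[OF assms]])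
  then have "inner (cadjoint A z) y = 0" for y by (simp add: inner_cadjoint_left assms)
  then show "cadjoint A z = 0" using inner_eq_zero_iff by blast
next
  assume *: "cadjoint A z = 0"
  have "inner z y = 0" if y: "y \<in> closure (range A)" for y
  proof -
    obtain f where f: "\<And>m. f m \<in> range A" "f \<longlonglongrightarrow> y" using closure_seqE[OF y] by blast
    have "inner z (f m) = 0" for m
      using f(1)[of m] * by (auto simp: inner_cadjoint_left[OF assms, symmetric])
    then show ?thesis using LIMSEQ_unique[OF tendsto_inner[OF tendsto_const[of z] f(2)]] by simp
  qed
  then show "z \<in> ocomplement (closure (range A))"
    by (simp add: ocomplement_iff[OF closed_csubspace_closure_range[OF assms]])
qed

text \<open>A positive operator and its square root have the same kernel, hence ranges with the same
  closure.\<close>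

lemma closure_range_op_sqrt:
  assumes "pos_op A"
  shows "closure (range (op_sqrt A)) = closure (range A)"
proof (rule antisym)
  note S = pos_opD[OF pos_op_sqrt[OF assms]] and A = pos_opD[OF assms]
  show "closure (range A) \<subseteq> closure (range (op_sqrt A))"
    by (rule closure_mono) (metis assms image_subset_iff op_sqrt_sqrt rangeI)
  have "op_sqrt A x \<in> closure (range A)" for x
    by (rule in_closure_rangeI[OF A(1)])
      (simp add: A(4) S(2) op_sqrt_eq_0_iff[OF assms, symmetric])
  then show "closure (range (op_sqrt A)) \<subseteq> closure (range A)"
    by (simp add: closure_minimal image_subset_iff)
qed

lemma op_sqrt_bops:
  assumes "pos_op A"
  shows "op_sqrt A \<in> bops (closure (range A)) (closure (range A))"
proof -
  note S = pos_opD[OF pos_op_sqrt[OF assms]] and A = pos_opD[OF assms]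
  have "op_sqrt A x \<in> closure (range A)" for x
    using closure_range_op_sqrt[OF assms] closure_subset[of "range (op_sqrt A)"] by blast
  moreover have "op_sqrt A x = 0" if "x \<in> ocomplement (closure (range A))" for x
    using that by (simp add: cadjoint_zero_iff_ocomplement A op_sqrt_eq_0_iff assms)
  ultimately show ?thesis using S(1) by (simp add: bops_def)
qed

text \<open>The inequality makes B f \<mapsto> C f well defined and contractive on the range of
  \<open>B\<close>; it extends by uniform continuity to the closure and by zero to the complement.
  Both the operators of the model tuple and the unitary between two tuples are obtained in this
  way.\<close>

lemma douglas_factorization:
  fixes B :: "'a::complex_hilbert \<Rightarrow> 'b::complex_hilbert" and C :: "'a \<Rightarrow> 'c::complex_hilbert"
  assumes B: "bounded_clinear B" and C: "bounded_clinear C"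
    and le: "\<And>f. norm (C f) \<le> norm (B f)"
  obtains A where "A \<in> bops (closure (range B)) (closure (range C))" "\<And>f. A (B f) = C f"
    "\<And>x. norm (A x) \<le> norm x"
proof -
  note sB = bounded_clinear_simps[OF B] and sC = bounded_clinear_simps[OF C]
  let ?L = "closure (range B)"
  note cL = closed_csubspace_closure_range[OF B]
  have wd: "C f = C g" if "B f = B g" for f g
    using le[of "f - g"] that by (simp add: sB sC)
  \<comment> \<open>By \<open>wd\<close> the choice of the preimage does not affect the
    value.\<close>
  define g where "g = (\<lambda>y. C (SOME f. B f = y))"
  have gB: "g (B f) = C f" for f
    unfolding g_def using someI[of "\<lambda>h. B h = B f" f] wd by metis
  have "uniformly_continuous_on (range B) g"
    unfolding uniformly_continuous_on_def
  proof (intro allI impI)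
    fix e :: real assume e: "e > 0"
    have "dist (g y) (g x) \<le> dist y x" if xy: "x \<in> range B" "y \<in> range B" for x y
    proof -
      obtain p q where pq: "x = B p" "y = B q" using xy by blast
      show ?thesis using le[of "q - p"] by (simp add: pq gB dist_norm sB sC)
    qed
    then show "\<exists>d>0. \<forall>x\<in>range B. \<forall>x'\<in>range B. dist x' x < d \<longrightarrow> dist (g x') (g x) < e"
      using e by (meson le_less_trans)
  qed
  then obtain G where G: "uniformly_continuous_on ?L G" "\<And>x. x \<in> range B \<Longrightarrow> g x = G x"
    using uniformly_continuous_on_extension_on_closure by metis
  have GB: "G (B f) = C f" for f using G(2)[of "B f"] gB by simp
  have lim: "(\<lambda>m. C (f m)) \<longlonglongrightarrow> G y" if "(\<lambda>m. B (f m)) \<longlonglongrightarrow> y" "y \<in> ?L" for f y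
  proof -
    have "(\<lambda>m. G (B (f m))) \<longlonglongrightarrow> G y"
      using uniformly_continuous_imp_continuous[OF G(1)] that closure_subset[of "range B"]
      by (auto simp: continuous_on_sequentially o_def image_subset_iff)
    then show ?thesis by (simp add: GB)
  qed
  have app: "\<exists>f. (\<lambda>m. B (f m)) \<longlonglongrightarrow> y" if y: "y \<in> ?L" for y
  proof -
    obtain h where h: "\<And>m. h m \<in> range B" "h \<longlonglongrightarrow> y" using closure_seqE[OF y] by blast
    have "\<forall>m. \<exists>f. h m = B f" using h(1) by blast
    then obtain f where "\<And>m. h m = B (f m)" by metis
    then have "h = (\<lambda>m. B (f m))" by blast
    then show ?thesis using h(2) by blast
  qed
  have add: "G (x + y) = G x + G y" if xy: "x \<in> ?L" "y \<in> ?L" for x y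
  proof -
    obtain f h where fh: "(\<lambda>m. B (f m)) \<longlonglongrightarrow> x" "(\<lambda>m. B (h m)) \<longlonglongrightarrow> y" using app xy by metis
    have "(\<lambda>m. C (f m + h m)) \<longlonglongrightarrow> G (x + y)"
      by (rule lim) (use tendsto_add[OF fh] closed_csubspaceD(3)[OF cL xy] in \<open>simp_all add: sB\<close>)
    then show ?thesis
      using LIMSEQ_unique tendsto_add[OF lim[OF fh(1) xy(1)] lim[OF fh(2) xy(2)]] by (simp add: sC) 
  qed
  have scale: "G (a *\<^sub>C x) = a *\<^sub>C G x" if x: "x \<in> ?L" for a x
  proof -
    obtain f where f: "(\<lambda>m. B (f m)) \<longlonglongrightarrow> x" using app x by metis
    have "(\<lambda>m. C (a *\<^sub>C f m)) \<longlonglongrightarrow> G (a *\<^sub>C x)"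
      by (rule lim) (use bounded_clinear_tendsto[OF bounded_clinear_scaleC_right f] closed_csubspaceD(4)[OF cL x] in \<open>simp_all add: sB\<close>)
    then show ?thesis
      using LIMSEQ_unique[OF _ bounded_clinear_tendsto[OF bounded_clinear_scaleC_right lim[OF f x]]]
      by (simp add: sC)
  qed
  have nrm: "norm (G x) \<le> norm x" and in_C: "G x \<in> closure (range C)" if x: "x \<in> ?L" for x
  proof -
    obtain f where f: "(\<lambda>m. B (f m)) \<longlonglongrightarrow> x" using app x by metis
    show "norm (G x) \<le> norm x"
      by (rule LIMSEQ_le[OF tendsto_norm[OF lim[OF f x]] tendsto_norm[OF f]]) (use le in blast)
    show "G x \<in> closure (range C)" unfolding closure_sequential using lim[OF f x] by (intro exI[of _ "\<lambda>m. C (f m)"]) simp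
  qed
  note pL = proj_in[OF cL] and sp = bounded_clinear_simps[OF bounded_clinear_proj[OF cL]]
  have nA: "norm (G (proj ?L x)) \<le> norm x" for x
    by (rule order_trans[OF nrm[OF pL] norm_proj_le[OF cL]])
  show ?thesis
  proof (rule that[of "\<lambda>x. G (proj ?L x)"])
    show "(\<lambda>x. G (proj ?L x)) \<in> bops ?L (closure (range C))"
    proof (rule bopsI[OF _ cL])
      show "bounded_clinear (\<lambda>x. G (proj ?L x))"
        by (rule bounded_clinearI[where c = 1]) (simp_all add: sp(1,7) add scale pL nA)
      show "G (proj ?L x) \<in> closure (range C)" for x by (rule in_C[OF pL])
    qed (simp add: proj_idem[OF cL pL])
    show "G (proj ?L (B f)) = C f" for f
      using proj_idem[OF cL subsetD[OF closure_subset rangeI]] by (simp add: GB)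
  qed (rule nA)
qed

lemma bops_eqI_dense:
  assumes "A \<in> bops H K" "A' \<in> bops H K'" "H = closure (range B)" "bounded_clinear B"
    "\<And>f. A (B f) = A' (B f)"
  shows "A = A'"
proof
  fix x
  have cH: "closed_csubspace H" using assms closed_csubspace_closure_range by blast
  have "A y = A' y" if y: "y \<in> H" for y
  proof -
    obtain f where f: "\<And>m. f m \<in> range B" "f \<longlonglongrightarrow> y" using closure_seqE y assms(3) by blast
    have "A (f m) = A' (f m)" for m using f(1)[of m] assms(5) by auto
    then show ?thesis
      using LIMSEQ_unique[OF bounded_clinear_tendsto[OF bopsD(1)[OF assms(1)] f(2)]]
        bounded_clinear_tendsto[OF bopsD(1)[OF assms(2)] f(2)] by simp
  qed
  then show "A x = A' x" using bops_proj[OF assms(1) cH] bops_proj[OF assms(2) cH] proj_in[OF cH]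
    by metis
qed

section \<open>Vector-valued Fock spaces\<close>

lemma inner_elem_tensor: "inner (elem_tensor i x) g = inner x (coord g i)"
proof -
  have "inner (elem_tensor i x) g = (\<Sum>\<^sub>\<infinity>j\<in>{i}. inner (coord (elem_tensor i x) j) (coord g j))"
    unfolding inner_ell2_def by (rule infsum_cong_neutral) (auto simp: coord_elem_tensor)
  then show ?thesis by (simp add: coord_elem_tensor)
qed

lemma scaleC_elem_tensor: "a *\<^sub>C elem_tensor i x = elem_tensor i (a *\<^sub>C x)"
  by (rule ell2_eqI) (simp add: coord_elem_tensor)

lemma elem_tensor_zero [simp]: "elem_tensor i 0 = 0"
  by (rule ell2_eqI) (simp add: coord_elem_tensor)

lemma coord_sum: "coord (sum f F) i = (\<Sum>a\<in>F. coord (f a) i)"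
  by (induction F rule: infinite_finite_induct) auto

lemma square_summableI:
  assumes "\<And>F. finite F \<Longrightarrow> (\<Sum>i\<in>F. (norm (h i))\<^sup>2) \<le> c"
  shows "(\<lambda>i. (norm (h i))\<^sup>2) summable_on A"
  by (rule nonneg_bdd_above_summable_on) (use assms in \<open>auto simp: bdd_above_def\<close>)

lemma norm_ell2_sq_leI:
  assumes "\<And>F. finite F \<Longrightarrow> (\<Sum>i\<in>F. (norm (coord f i))\<^sup>2) \<le> c"
  shows "(norm f)\<^sup>2 \<le> c"
  unfolding norm_ell2_sq
  by (rule infsum_le_finite_sums) (use assms coord_summable in auto)

text \<open>By orthogonality the squared distance from a finite partial sum to f is the tail of the
  convergent series for the squared norm.\<close>

lemma has_sum_elem_tensor: "((\<lambda>i. elem_tensor i (coord f i)) has_sum f) UNIV"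
proof -
  have *: "(norm (sum (\<lambda>i. elem_tensor i (coord f i)) F - f))\<^sup>2
      = (norm f)\<^sup>2 - (\<Sum>i\<in>F. (norm (coord f i))\<^sup>2)" if F: "finite F" for F
  proof -
    let ?s = "sum (\<lambda>i. elem_tensor i (coord f i)) F"
    have "inner ?s f = (\<Sum>i\<in>F. (norm (coord f i))\<^sup>2)"
      by (simp add: inner_sum_left inner_elem_tensor power2_norm_eq_inner)
    moreover have "inner ?s ?s = (\<Sum>i\<in>F. inner (coord f i) (coord ?s i))"
      by (subst inner_sum_left) (simp add: inner_elem_tensor)
    moreover have "\<dots> = (\<Sum>i\<in>F. (norm (coord f i))\<^sup>2)"
    proof (rule sum.cong)
      fix i assume "i \<in> F"
      then have "coord ?s i = coord f i" using F by (simp add: coord_sum coord_elem_tensor)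
      then show "inner (coord f i) (coord ?s i) = (norm (coord f i))\<^sup>2"
        by (simp add: power2_norm_eq_inner)
    qed simp
    ultimately show ?thesis
      by (simp add: power2_norm_eq_inner inner_diff_left inner_diff_right inner_commute)
  qed
  have "((\<lambda>i. (norm (coord f i))\<^sup>2) has_sum (norm f)\<^sup>2) UNIV"
    unfolding norm_ell2_sq by (rule has_sum_infsum[OF coord_summable])
  then have "((\<lambda>F. (norm f)\<^sup>2 - (\<Sum>i\<in>F. (norm (coord f i))\<^sup>2)) \<longlongrightarrow> (norm f)\<^sup>2 - (norm f)\<^sup>2)
      (finite_subsets_at_top UNIV)"
    unfolding has_sum_def by (intro tendsto_intros)
  then have lim: "((\<lambda>F. (norm f)\<^sup>2 - (\<Sum>i\<in>F. (norm (coord f i))\<^sup>2)) \<longlongrightarrow> 0)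
      (finite_subsets_at_top UNIV)" by (simp only: diff_self)
  have "\<forall>\<^sub>F F in finite_subsets_at_top UNIV. (norm f)\<^sup>2 - (\<Sum>i\<in>F. (norm (coord f i))\<^sup>2)
      = (norm (sum (\<lambda>i. elem_tensor i (coord f i)) F - f))\<^sup>2"
    by (rule eventually_finite_subsets_at_top_weakI) (simp add: *)
  with lim have "((\<lambda>F. (norm (sum (\<lambda>i. elem_tensor i (coord f i)) F - f))\<^sup>2) \<longlongrightarrow> 0)
      (finite_subsets_at_top UNIV)"
    by (rule Lim_transform_eventually)
  from tendsto_real_sqrt[OF this]
  have "((\<lambda>F. norm (sum (\<lambda>i. elem_tensor i (coord f i)) F - f)) \<longlongrightarrow> 0)
      (finite_subsets_at_top UNIV)" by simp
  then show ?thesis unfolding has_sum_def by (rule LIM_zero_cancel[OF tendsto_norm_zero_cancel])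
qed

text \<open>\<open>infsum\<close> is 0 for a divergent family, so the vector-valued sums defining
  ampliations, shifts and Berezin kernels acquire their coordinates only through this convergence.
  The injection \<open>j\<close> is the identity except for shifts, where it prepends a
  letter.\<close>

lemma ex_has_sum_elem_tensor:
  fixes g :: "'i \<Rightarrow> 'a::complex_hilbert" and j :: "'i \<Rightarrow> 'j"
  assumes sm: "(\<lambda>\<alpha>. (norm (g \<alpha>))\<^sup>2) summable_on S" and inj: "inj_on j S"
  obtains f where "((\<lambda>\<alpha>. elem_tensor (j \<alpha>) (g \<alpha>)) has_sum f) S"
    "\<And>\<alpha>. \<alpha> \<in> S \<Longrightarrow> coord f (j \<alpha>) = g \<alpha>" "\<And>\<beta>. \<beta> \<notin> j ` S \<Longrightarrow> coord f \<beta> = 0"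
proof -
  define h where "h = (\<lambda>\<beta>. if \<beta> \<in> j ` S then g (inv_into S j \<beta>) else 0)"
  have hj: "h (j \<alpha>) = g \<alpha>" if "\<alpha> \<in> S" for \<alpha>
    using that inj by (simp add: h_def)
  have "(\<lambda>\<beta>. (norm (h \<beta>))\<^sup>2) summable_on (j ` S)"
    by (subst summable_on_reindex[OF inj], rule summable_on_cong[THEN iffD1, OF _ sm]) (simp add: hj)
  then have "(\<lambda>\<beta>. (norm (h \<beta>))\<^sup>2) summable_on UNIV"
    by (rule summable_on_cong_neutral[THEN iffD1, rotated 3]) (auto simp: h_def)
  then have coord: "coord (Abs_ell2 h) = h" by (rule coord_Abs_ell2)
  have "((\<lambda>\<beta>. elem_tensor \<beta> (h \<beta>)) has_sum Abs_ell2 h) UNIV"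
    using has_sum_elem_tensor[of "Abs_ell2 h"] by (simp add: coord)
  then have "((\<lambda>\<beta>. elem_tensor \<beta> (h \<beta>)) has_sum Abs_ell2 h) (j ` S)"
    by (rule has_sum_cong_neutral[THEN iffD1, rotated 3]) (auto simp: h_def)
  then have "((\<lambda>\<alpha>. elem_tensor (j \<alpha>) (g \<alpha>)) has_sum Abs_ell2 h) S"
    unfolding has_sum_reindex[OF inj]
    by (rule has_sum_cong[THEN iffD1, rotated]) (simp add: hj)
  then show ?thesis by (rule that) (simp_all only: coord hj, simp add: h_def)
qed

subsection \<open>Ampliations and Fock spaces over subspaces\<close>

lemma norm_sq_bounded_clinear_le:
  assumes "\<And>x. norm (u x) \<le> norm x * c"
  shows "(norm (u x))\<^sup>2 \<le> c\<^sup>2 * (norm x)\<^sup>2"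
  using power_mono[OF assms[of x] norm_ge_zero, of 2] by (simp add: power_mult_distrib mult.commute)

lemma coord_ampliation:
  assumes u: "bounded_clinear u"
  shows "coord (ampliation k n u f) \<alpha> = (if \<alpha> \<in> mwords k n then u (coord f \<alpha>) else 0)"
proof -
  obtain c where c: "\<And>x. norm (u x) \<le> norm x * c" using bounded_clinear_bound[OF u] by blast
  have "(\<lambda>\<alpha>. (norm (u (coord f \<alpha>)))\<^sup>2) summable_on mwords k n"
  proof (rule square_summableI)
    fix F :: "mword set" assume F: "finite F"
    have "(\<Sum>i\<in>F. (norm (u (coord f i)))\<^sup>2) \<le> c\<^sup>2 * (\<Sum>i\<in>F. (norm (coord f i))\<^sup>2)"
      unfolding sum_distrib_left by (intro sum_mono norm_sq_bounded_clinear_le c)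
    also have "\<dots> \<le> c\<^sup>2 * (norm f)\<^sup>2" by (intro mult_left_mono sum_coord_le F) simp
    finally show "(\<Sum>i\<in>F. (norm (u (coord f i)))\<^sup>2) \<le> c\<^sup>2 * (norm f)\<^sup>2" .
  qed
  then obtain F where F: "((\<lambda>\<alpha>. elem_tensor \<alpha> (u (coord f \<alpha>))) has_sum F) (mwords k n)"
    "\<And>\<alpha>. \<alpha> \<in> mwords k n \<Longrightarrow> coord F \<alpha> = u (coord f \<alpha>)" "\<And>\<beta>. \<beta> \<notin> mwords k n \<Longrightarrow> coord F \<beta> = 0"
    by (rule ex_has_sum_elem_tensor[where j = "\<lambda>x. x"]) auto
  then have "ampliation k n u f = F" unfolding ampliation_def by (simp add: infsumI)
  then show ?thesis using F by simp
qed

lemma bounded_clinear_ampliation: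
  assumes u: "bounded_clinear u"
  shows "bounded_clinear (ampliation k n u)"
proof -
  obtain c where c: "c > 0" "\<And>x. norm (u x) \<le> norm x * c" using bounded_clinear_bound[OF u] by blast
  note s = bounded_clinear_simps[OF u]
  show ?thesis
  proof (rule bounded_clinearI[where c = c])
    fix f
    have "(norm (ampliation k n u f))\<^sup>2 \<le> c\<^sup>2 * (norm f)\<^sup>2"
    proof (rule norm_ell2_sq_leI)
      fix F :: "mword set" assume F: "finite F"
      have "(\<Sum>i\<in>F. (norm (coord (ampliation k n u f) i))\<^sup>2) \<le> c\<^sup>2 * (\<Sum>i\<in>F. (norm (coord f i))\<^sup>2)"
        unfolding sum_distrib_left
        by (intro sum_mono) (use norm_sq_bounded_clinear_le[of u, OF c(2)] in \<open>auto simp: coord_ampliation u\<close>)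
      also have "\<dots> \<le> c\<^sup>2 * (norm f)\<^sup>2" by (intro mult_left_mono sum_coord_le F) simp
      finally show "(\<Sum>i\<in>F. (norm (coord (ampliation k n u f) i))\<^sup>2) \<le> c\<^sup>2 * (norm f)\<^sup>2" .
    qed
    then have "(norm (ampliation k n u f))\<^sup>2 \<le> (norm f * c)\<^sup>2"
      by (simp only: power_mult_distrib mult.commute)
    then show "norm (ampliation k n u f) \<le> norm f * c"
      by (rule power2_le_imp_le) (use c(1) in simp)
  qed (auto intro!: ell2_eqI simp: coord_ampliation u s)
qed

lemma ampliation_ampliation:
  "bounded_clinear u \<Longrightarrow> bounded_clinear v \<Longrightarrow>
    ampliation k n u (ampliation k n v f) = ampliation k n (\<lambda>x. u (v x)) f"
  by (rule ell2_eqI) (simp add: coord_ampliation bounded_clinear_compose)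

lemma cadjoint_ampliation:
  assumes "bounded_clinear u"
  shows "cadjoint (ampliation k n u) = ampliation k n (cadjoint u)"
proof (rule cadjoint_eqI[OF bounded_clinear_ampliation[OF assms]])
  show "inner (ampliation k n u x) y = inner x (ampliation k n (cadjoint u) y)" for x y
    unfolding inner_ell2_def
    by (rule infsum_cong) (simp add: coord_ampliation assms bounded_clinear_cadjoint inner_cadjoint)
qed

lemma bounded_clinear_coord: "bounded_clinear (\<lambda>f. coord f \<alpha>)"
  by (rule bounded_clinearI[where c = 1]) (auto simp: norm_coord_le)

lemma closed_csubspace_fock:
  assumes "closed_csubspace E"
  shows "closed_csubspace (fock k n E)"
proof -
  note D = closed_csubspaceD[OF assms]
  have "fock k n E = (\<Inter>\<alpha>. {f. coord f \<alpha> \<in> (if \<alpha> \<in> mwords k n then E else {0})})"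
    by (auto simp: fock_def split: if_splits)
  moreover have "closed {f :: (mword, 'a) ell2. coord f \<alpha> \<in> C}" if "closed C" for C \<alpha>
    using closed_vimage[OF that bounded_clinear_continuous_on[OF bounded_clinear_coord]]
    by (simp add: vimage_def)
  ultimately have "closed (fock k n E)" using D(1) by auto
  then show ?thesis using D by (auto simp: closed_csubspace_def fock_def)
qed

lemma proj_fock:
  assumes E: "closed_csubspace E"
  shows "proj (fock k n E) = ampliation k n (proj E)"
proof
  fix f
  note P = bounded_clinear_proj[OF E]
  show "proj (fock k n E) f = ampliation k n (proj E) f"
  proof (rule proj_unique[OF closed_csubspace_fock[OF E]])
    show "ampliation k n (proj E) f \<in> fock k n E"
      by (simp add: fock_def coord_ampliation P proj_in[OF E])
    fix z assume z: "z \<in> fock k n E"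
    have "inner (coord (f - ampliation k n (proj E) f) \<alpha>) (coord z \<alpha>) = 0" for \<alpha>
      using z by (cases "\<alpha> \<in> mwords k n") (simp_all add: fock_def coord_ampliation P proj_orth[OF E])
    then show "inner (f - ampliation k n (proj E) f) z = 0"
      unfolding inner_ell2_def by simp
  qed
qed

lemma ampliation_bops:
  assumes u: "u \<in> bops E K" and E: "closed_csubspace E" and K: "closed_csubspace K"
  shows "ampliation k n u \<in> bops (fock k n E) (fock k n K)"
proof (rule bopsI[OF bounded_clinear_ampliation[OF bopsD(1)[OF u]] closed_csubspace_fock[OF E]])
  show "ampliation k n u x \<in> fock k n K" for x
    by (simp add: fock_def coord_ampliation bopsD(1)[OF u] bopsD(2)[OF u])
  show "ampliation k n u (proj (fock k n E) x) = ampliation k n u x" for x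
    by (simp add: proj_fock E ampliation_ampliation bopsD(1)[OF u] bounded_clinear_proj bops_proj[OF u])
qed

lemma unitary_betweenD:
  assumes "unitary_between H K W"
  shows "W \<in> bops H K" "cadjoint W (W x) = proj H x" "W (cadjoint W y) = proj K y"
    "bounded_clinear W"
  using assms bopsD(1)[of W H K] by (auto simp: unitary_between_def fun_eq_iff)

lemma unitary_betweenI:
  assumes "W \<in> bops H K" "\<And>x. cadjoint W (W x) = proj H x" "\<And>y. W (cadjoint W y) = proj K y"
  shows "unitary_between H K W"
  using assms by (auto simp: unitary_between_def fun_eq_iff)

lemma unitary_ampliation:
  assumes u: "unitary_between E K u" and E: "closed_csubspace E" and K: "closed_csubspace K"
  shows "unitary_between (fock k n E) (fock k n K) (ampliation k n u)"
proof (rule unitary_betweenI)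
  note U = unitary_betweenD[OF u]
  show "ampliation k n u \<in> bops (fock k n E) (fock k n K)" by (rule ampliation_bops[OF U(1) E K])
  show "cadjoint (ampliation k n u) (ampliation k n u x) = proj (fock k n E) x" for x
    by (simp add: cadjoint_ampliation U ampliation_ampliation bounded_clinear_cadjoint proj_fock[OF E])
  show "ampliation k n u (cadjoint (ampliation k n u) x) = proj (fock k n K) x" for x
    by (simp add: cadjoint_ampliation U ampliation_ampliation bounded_clinear_cadjoint proj_fock[OF K])
qed

subsection \<open>The universal model\<close>

lemma mwords_upd:
  "\<alpha> \<in> mwords k n \<Longrightarrow> i \<in> {1..k} \<Longrightarrow> s \<in> {1..n i} \<Longrightarrow> \<alpha>(i := s # \<alpha> i) \<in> mwords k n"
  by (auto simp: mwords_def)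

lemma inj_cons_upd: "inj (\<lambda>\<alpha> :: mword. \<alpha>(i := s # \<alpha> i))"
proof (rule injI)
  fix \<alpha> \<beta> :: mword assume eq: "\<alpha>(i := s # \<alpha> i) = \<beta>(i := s # \<beta> i)"
  have "\<alpha> l = \<beta> l" for l using fun_cong[OF eq, of l] by (cases "l = i") auto
  then show "\<alpha> = \<beta>" by blast
qed

locale phase_matrices =
  fixes k :: nat and n :: "nat \<Rightarrow> nat" and \<Lambda> :: "nat \<Rightarrow> nat \<Rightarrow> nat \<Rightarrow> nat \<Rightarrow> complex"
  assumes cmod_\<Lambda>: "\<lbrakk>i \<in> {1..k}; j \<in> {1..k}; i \<noteq> j; s \<in> {1..n i}; t \<in> {1..n j}\<rbrakk> \<Longrightarrow> cmod (\<Lambda> i j s t) = 1"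
begin

lemma cmod_phase:
  assumes "\<alpha> \<in> mwords k n" "i \<in> {1..k}" "s \<in> {1..n i}"
  shows "cmod (phase \<Lambda> i s \<alpha>) = 1"
proof -
  have "cmod (prod_list (map (\<Lambda> i j s) w)) = 1" if "set w \<subseteq> {1..n j}" "j \<in> {1..<i}" for j w
    using that by (induction w) (use assms(2,3) cmod_\<Lambda>[of i j s] in \<open>auto simp: norm_mult\<close>)
  moreover have "set (\<alpha> j) \<subseteq> {1..n j}" if "j \<in> {1..<i}" for j
    using assms(1,2) that by (auto simp: mwords_def)
  ultimately show ?thesis unfolding phase_def prod_norm[symmetric] by (intro prod.neutral) blast
qed

text \<open>The adjoint of the shift in coordinates. It is bounded by inspection, and the
  boundedness of the shift itself is deduced from it.\<close>

definition shift_adj ::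
    "nat \<Rightarrow> nat \<Rightarrow> (mword, 'a::complex_hilbert) ell2 \<Rightarrow> (mword, 'a) ell2"
  where "shift_adj i s f = Abs_ell2 (\<lambda>\<alpha>. if \<alpha> \<in> mwords k n
    then cnj (phase \<Lambda> i s \<alpha>) *\<^sub>C coord f (\<alpha>(i := s # \<alpha> i)) else 0)"

context
  fixes i s assumes i: "i \<in> {1..k}" and s: "s \<in> {1..n i}"
begin

lemma sum_shift_adj_le:
  assumes "finite F"
  shows "(\<Sum>\<alpha>\<in>F. (norm (if \<alpha> \<in> mwords k n then cnj (phase \<Lambda> i s \<alpha>) *\<^sub>C coord f (\<alpha>(i := s # \<alpha> i)) else 0))\<^sup>2)
    \<le> (norm f)\<^sup>2"
proof -
  have "(\<Sum>\<alpha>\<in>F. (norm (if \<alpha> \<in> mwords k n then cnj (phase \<Lambda> i s \<alpha>) *\<^sub>C coord f (\<alpha>(i := s # \<alpha> i)) else 0))\<^sup>2)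
      \<le> (\<Sum>\<alpha>\<in>F. (norm (coord f (\<alpha>(i := s # \<alpha> i))))\<^sup>2)"
    by (intro sum_mono) (auto simp: norm_scaleC cmod_phase[OF _ i s])
  also have "\<dots> = (\<Sum>\<beta>\<in>(\<lambda>\<alpha>. \<alpha>(i := s # \<alpha> i)) ` F. (norm (coord f \<beta>))\<^sup>2)"
    by (subst sum.reindex[OF inj_on_subset[OF inj_cons_upd subset_UNIV]]) simp
  also have "\<dots> \<le> (norm f)\<^sup>2" by (rule sum_coord_le) (use assms in simp)
  finally show ?thesis .
qed

lemma coord_shift_adj:
  "coord (shift_adj i s f) \<alpha> = (if \<alpha> \<in> mwords k n
    then cnj (phase \<Lambda> i s \<alpha>) *\<^sub>C coord f (\<alpha>(i := s # \<alpha> i)) else 0)"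
  unfolding shift_adj_def
  by (subst coord_Abs_ell2) (rule square_summableI, rule sum_shift_adj_le, auto)

lemma norm_shift_adj_le: "norm (shift_adj i s f) \<le> norm f"
proof -
  have "(norm (shift_adj i s f))\<^sup>2 \<le> (norm f)\<^sup>2"
    by (rule norm_ell2_sq_leI) (simp only: coord_shift_adj sum_shift_adj_le)
  then show ?thesis by (rule power2_le_imp_le) simp
qed

lemma bounded_clinear_shift_adj: "bounded_clinear (shift_adj i s)"
  by (rule bounded_clinearI[where c = 1])
    (auto intro!: ell2_eqI simp: coord_shift_adj scaleC_add_right scaleC_scaleC mult.commute norm_shift_adj_le)

lemma inner_model_shift: "inner (model_shift k n \<Lambda> i s f) g = inner f (shift_adj i s g)"
proof -
  let ?j = "\<lambda>\<alpha>::mword. \<alpha>(i := s # \<alpha> i)"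
  have "(\<lambda>\<alpha>. (norm (phase \<Lambda> i s \<alpha> *\<^sub>C coord f \<alpha>))\<^sup>2) summable_on mwords k n"
    by (rule summable_on_cong[THEN iffD1, OF _ summable_on_subset_banach[OF coord_summable[of f]]])
      (auto simp: norm_scaleC cmod_phase[OF _ i s])
  then obtain F where F: "((\<lambda>\<alpha>. elem_tensor (?j \<alpha>) (phase \<Lambda> i s \<alpha> *\<^sub>C coord f \<alpha>)) has_sum F) (mwords k n)"
    by (rule ex_has_sum_elem_tensor[where j = ?j]) (use inj_cons_upd in \<open>blast intro: inj_on_subset\<close>)
  then have "model_shift k n \<Lambda> i s f = F"
    unfolding model_shift_def scaleC_elem_tensor by (rule infsumI)
  moreover have "((\<lambda>\<alpha>. inner (elem_tensor (?j \<alpha>) (phase \<Lambda> i s \<alpha> *\<^sub>C coord f \<alpha>)) g) has_sum inner F g) (mwords k n)"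
    using has_sum_bounded_linear[OF bounded_linear_inner_left F, of g] by simp
  moreover have "((\<lambda>\<alpha>. inner (coord f \<alpha>) (coord (shift_adj i s g) \<alpha>)) has_sum inner f (shift_adj i s g)) UNIV"
    unfolding inner_ell2_def by (rule has_sum_infsum[OF ell2_inner_summable])
  then have "((\<lambda>\<alpha>. inner (coord f \<alpha>) (coord (shift_adj i s g) \<alpha>)) has_sum inner f (shift_adj i s g)) (mwords k n)"
    by (rule has_sum_cong_neutral[THEN iffD1, rotated 3]) (auto simp: coord_shift_adj)
  then have "((\<lambda>\<alpha>. inner (elem_tensor (?j \<alpha>) (phase \<Lambda> i s \<alpha> *\<^sub>C coord f \<alpha>)) g) has_sum inner f (shift_adj i s g)) (mwords k n)"
    by (rule has_sum_cong[THEN iffD1, rotated])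
      (simp add: coord_shift_adj inner_elem_tensor inner_scaleC_left del: fun_upd_apply)
  ultimately show ?thesis using has_sum_unique by blast
qed

lemma bounded_clinear_model_shift: "bounded_clinear (model_shift k n \<Lambda> i s)"
  by (rule adjoint_bounded_clinear[OF bounded_clinear_shift_adj])
    (metis inner_commute inner_model_shift)

lemma cadjoint_model_shift: "cadjoint (model_shift k n \<Lambda> i s) = shift_adj i s"
  by (rule cadjoint_eqI[OF bounded_clinear_model_shift inner_model_shift])

lemma coord_cadjoint_model_shift:
  "coord (cadjoint (model_shift k n \<Lambda> i s) f) \<alpha> = (if \<alpha> \<in> mwords k n
    then cnj (phase \<Lambda> i s \<alpha>) *\<^sub>C coord f (\<alpha>(i := s # \<alpha> i)) else 0)"
  by (simp only: cadjoint_model_shift coord_shift_adj)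

lemma norm_cadjoint_model_shift_le: "norm (cadjoint (model_shift k n \<Lambda> i s) f) \<le> norm f"
  by (simp only: cadjoint_model_shift norm_shift_adj_le)

lemma ampliation_cadjoint_model_shift:
  assumes "bounded_clinear u"
  shows "ampliation k n u (cadjoint (model_shift k n \<Lambda> i s) f)
    = cadjoint (model_shift k n \<Lambda> i s) (ampliation k n u f)"
  by (rule ell2_eqI) (simp add: coord_ampliation assms coord_cadjoint_model_shift
      bounded_clinear_simps[OF assms] mwords_upd[OF _ i, of _ n s, OF _ s] del: fun_upd_apply)

text \<open>Proved on adjoints, where both operators have explicit coordinates.\<close>

lemma ampliation_model_shift:
  assumes "bounded_clinear u"
  shows "ampliation k n u (model_shift k n \<Lambda> i s f) = model_shift k n \<Lambda> i s (ampliation k n u f)"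
proof (subst vector_eq_ldot[symmetric], intro allI)
  fix z
  note u = bounded_clinear_ampliation[OF assms]
  show "inner z (ampliation k n u (model_shift k n \<Lambda> i s f))
      = inner z (model_shift k n \<Lambda> i s (ampliation k n u f))"
    by (simp add: inner_cadjoint_left[OF u, symmetric] cadjoint_ampliation[OF assms]
        inner_cadjoint_left[OF bounded_clinear_model_shift, symmetric]
        ampliation_cadjoint_model_shift bounded_clinear_cadjoint assms)
qed

end

end

section \<open>Defect forms\<close>

declare One_nat_def [simp del]

text \<open>Operators \<open>X\<close> are replaced by their quadratic forms \<open>q h = \<langle>X h, h\<rangle>\<close>, on which the maps \<open>\<Phi>\<^sub>i\<close> act
  as follows; this needs no linearity of \<open>q\<close>.\<close>

definition phi_form ::
    "(nat \<Rightarrow> nat) \<Rightarrow> 'a::complex_hilbert optuple \<Rightarrow> nat \<Rightarrow> ('a \<Rightarrow> real) \<Rightarrow> 'a \<Rightarrow> real"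
  where "phi_form n T i q h = (\<Sum>s\<in>{1..n i}. q (cadjoint (T i s) h))"

text \<open>The factors with index 1 to j are applied. The start \<open>q\<close> is a parameter so
  that forms pulled back along an intertwining map, not only the form of the identity, are
  covered.\<close>

primrec defect_form ::
    "(nat \<Rightarrow> nat) \<Rightarrow> 'a::complex_hilbert optuple \<Rightarrow> (nat \<Rightarrow> nat) \<Rightarrow> ('a \<Rightarrow> real) \<Rightarrow> nat \<Rightarrow> 'a \<Rightarrow> real"
  where "defect_form n T p q 0 = q"
  | "defect_form n T p q (Suc j) =
      (\<lambda>h. defect_form n T p q j h - (phi_form n T (Suc j) ^^ p (Suc j)) (defect_form n T p q j) h)"

lemma defect_form_one_Suc:
  "defect_form n T (\<lambda>_. 1) q (Suc j) =
    (\<lambda>h. defect_form n T (\<lambda>_. 1) q j h - phi_form n T (Suc j) (defect_form n T (\<lambda>_. 1) q j) h)"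
  by (simp add: One_nat_def)

definition mword_adj :: "'a::complex_hilbert optuple \<Rightarrow> nat \<Rightarrow> mword \<Rightarrow> 'a \<Rightarrow> 'a"
  where "mword_adj T j \<beta> = fold (\<lambda>i. cadjoint (word_op (T i) (\<beta> i))) [1..<Suc j]"

lemma mword_adj_0: "mword_adj T 0 \<beta> h = h"
  by (simp add: mword_adj_def)

lemma mword_adj_Suc:
  "mword_adj T (Suc j) \<beta> h = cadjoint (word_op (T (Suc j)) (\<beta> (Suc j))) (mword_adj T j \<beta> h)"
  by (simp add: mword_adj_def)

lemma mword_adj_cong: "(\<And>i. i \<in> {1..j} \<Longrightarrow> \<beta> i = \<beta>' i) \<Longrightarrow> mword_adj T j \<beta> h = mword_adj T j \<beta>' h"
  unfolding mword_adj_def by (rule fold_cong) auto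

lemma word_op_Nil: "word_op X [] = (\<lambda>x. x)"
  by (simp add: word_op_def id_def)

lemma word_op_Cons: "word_op X (s # w) = (\<lambda>x. X s (word_op X w x))"
  by (simp add: word_op_def comp_def)

lemma cadjoint_id: "cadjoint (\<lambda>x. x) = (\<lambda>x. x)"
  by (rule cadjoint_eqI) (simp_all add: bounded_clinear_id)

section \<open>Sums over words and multi-words of bounded length\<close>

definition words_lt :: "nat \<Rightarrow> nat \<Rightarrow> nat list set"
  where "words_lt m p = {w. set w \<subseteq> {1..m} \<and> length w < p}"

lemma finite_words_lt: "finite (words_lt m p)"
  by (rule finite_subset[OF _ finite_lists_length_le[of "{1..m}" p]]) (auto simp: words_lt_def)

lemma sum_words_lt_Suc:
  fixes f :: "nat list \<Rightarrow> real"
  shows "sum f (words_lt m (Suc p)) = f [] + (\<Sum>s\<in>{1..m}. \<Sum>w\<in>words_lt m p. f (s # w))"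
proof -
  let ?U = "\<Union>s\<in>{1..m}. (\<lambda>w. s # w) ` words_lt m p"
  have eq: "words_lt m (Suc p) = insert [] ?U"
  proof (intro set_eqI)
    fix w show "w \<in> words_lt m (Suc p) \<longleftrightarrow> w \<in> insert [] ?U"
      by (cases w) (auto simp: words_lt_def)
  qed
  have "sum f ?U = (\<Sum>s\<in>{1..m}. sum f ((\<lambda>w. s # w) ` words_lt m p))"
    by (rule sum.UNION_disjoint) (auto simp: finite_words_lt)
  also have "\<dots> = (\<Sum>s\<in>{1..m}. \<Sum>w\<in>words_lt m p. f (s # w))"
    by (simp add: sum.reindex inj_on_def)
  finally have "sum f ?U = (\<Sum>s\<in>{1..m}. \<Sum>w\<in>words_lt m p. f (s # w))" .
  moreover have "sum f (insert [] ?U) = f [] + sum f ?U"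
    by (rule sum.insert) (auto simp: finite_words_lt)
  ultimately show ?thesis by (simp only: eq)
qed

definition mwords_lt :: "(nat \<Rightarrow> nat) \<Rightarrow> (nat \<Rightarrow> nat) \<Rightarrow> nat \<Rightarrow> mword set"
  where "mwords_lt n p j = {\<beta> \<in> mwords j n. \<forall>i\<in>{1..j}. length (\<beta> i) < p i}"

lemma mwords_lt_0: "mwords_lt n p 0 = {\<lambda>_. []}"
  by (auto simp: mwords_lt_def mwords_def)

lemma mwords_lt_Suc:
  "mwords_lt n p (Suc j) =
    (\<lambda>(\<beta>, w). \<beta>(Suc j := w)) ` (mwords_lt n p j \<times> words_lt (n (Suc j)) (p (Suc j)))"
proof (intro set_eqI iffI)
  fix \<beta> assume \<beta>: "\<beta> \<in> mwords_lt n p (Suc j)"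
  have "\<beta> = (\<lambda>(\<beta>, w). \<beta>(Suc j := w)) (\<beta>(Suc j := []), \<beta> (Suc j))" by simp
  moreover have "\<beta>(Suc j := []) \<in> mwords_lt n p j" "\<beta> (Suc j) \<in> words_lt (n (Suc j)) (p (Suc j))"
    using \<beta> by (auto simp: mwords_lt_def mwords_def words_lt_def)
  ultimately show "\<beta> \<in> (\<lambda>(\<beta>, w). \<beta>(Suc j := w)) ` (mwords_lt n p j \<times> words_lt (n (Suc j)) (p (Suc j)))"
    by blast
next
  fix \<beta> assume "\<beta> \<in> (\<lambda>(\<beta>, w). \<beta>(Suc j := w)) ` (mwords_lt n p j \<times> words_lt (n (Suc j)) (p (Suc j)))"
  then obtain \<gamma> w where \<gamma>: "\<gamma> \<in> mwords_lt n p j" and w: "w \<in> words_lt (n (Suc j)) (p (Suc j))"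
    and \<beta>: "\<beta> = \<gamma>(Suc j := w)" by auto
  have "i \<in> {1..j}" if "i \<in> {1..Suc j}" "i \<noteq> Suc j" for i using that by auto
  then show "\<beta> \<in> mwords_lt n p (Suc j)"
    using \<gamma> w by (auto simp: \<beta> mwords_lt_def mwords_def words_lt_def)
qed

lemma finite_mwords_lt: "finite (mwords_lt n p j)"
  by (induction j) (auto simp: mwords_lt_0 mwords_lt_Suc finite_words_lt)

lemma sum_mwords_lt_Suc:
  fixes f :: "mword \<Rightarrow> real"
  shows "sum f (mwords_lt n p (Suc j)) =
    (\<Sum>\<beta>\<in>mwords_lt n p j. \<Sum>w\<in>words_lt (n (Suc j)) (p (Suc j)). f (\<beta>(Suc j := w)))"
proof -
  have "inj_on (\<lambda>(\<beta>, w). \<beta>(Suc j := w)) (mwords_lt n p j \<times> words_lt (n (Suc j)) (p (Suc j)))"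
  proof (rule inj_onI, clarsimp)
    fix \<beta> w \<gamma> v assume *: "\<beta> \<in> mwords_lt n p j" "\<gamma> \<in> mwords_lt n p j"
      "\<beta>(Suc j := w) = \<gamma>(Suc j := v)"
    have "\<beta> l = \<gamma> l" for l
      using fun_cong[OF *(3), of l] *(1,2) by (cases "l = Suc j") (auto simp: mwords_lt_def mwords_def)
    then show "\<beta> = \<gamma> \<and> w = v" using fun_cong[OF *(3), of "Suc j"] by auto
  qed
  then show ?thesis
    unfolding mwords_lt_Suc by (subst sum.reindex) (auto simp: sum.cartesian_product intro!: sum.cong)
qed

lemma finite_subset_mwords_lt:
  assumes "finite F" "F \<subseteq> mwords k n"
  obtains p where "F \<subseteq> mwords_lt n p k"
proof -
  define p where "p = Suc (Max (insert 0 ((\<lambda>(\<beta>, i). length (\<beta> i)) ` (F \<times> {1..k}))))"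
  have "length (\<beta> i) < p" if "\<beta> \<in> F" "i \<in> {1..k}" for \<beta> i
  proof -
    have "length (\<beta> i) \<le> Max (insert 0 ((\<lambda>(\<beta>, i). length (\<beta> i)) ` (F \<times> {1..k})))"
      by (rule Max_ge) (use assms(1) that in force)+
    then show ?thesis by (simp add: p_def)
  qed
  then show ?thesis using assms(2) by (intro that[of "\<lambda>_. p"]) (auto simp: mwords_lt_def)
qed

lemma phi_form_diff: "phi_form n T i (\<lambda>h. q h - r h) = (\<lambda>h. phi_form n T i q h - phi_form n T i r h)"
  by (simp add: phi_form_def sum_subtractf fun_eq_iff)

lemma phi_form_mono: "(\<And>h. q h \<le> r h) \<Longrightarrow> phi_form n T i q h \<le> phi_form n T i r h"
  by (simp add: phi_form_def sum_mono)

lemma phi_form_pow_nonneg: "(\<And>h. 0 \<le> q h) \<Longrightarrow> 0 \<le> (phi_form n T i ^^ p) q h"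
proof (induction p arbitrary: h)
  case (Suc p)
  then show ?case by (simp add: phi_form_def sum_nonneg)
qed simp

lemma phi_form_transport:
  assumes "\<And>s h. s \<in> {1..n i} \<Longrightarrow> cadjoint (T i s) (V h) = V (cadjoint (R i s) h)"
  shows "(phi_form n T i ^^ p) q (V h) = (phi_form n R i ^^ p) (\<lambda>h. q (V h)) h"
proof (induction p arbitrary: h)
  case (Suc p)
  then show ?case by (simp add: phi_form_def assms)
qed simp

text \<open>The defect form sees the tuple only through its adjoints, so intertwining the adjoints
  is enough to pull it back. It is applied to Y^(1/2), to the adjoint of \<Psi>, to the projection
  onto the model space and to unitaries.\<close>

lemma defect_form_transport:
  assumes "\<And>i s h. i \<in> {1..k} \<Longrightarrow> s \<in> {1..n i} \<Longrightarrow> cadjoint (T i s) (V h) = V (cadjoint (R i s) h)"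
    and "j \<le> k"
  shows "defect_form n T p q j (V h) = defect_form n R p (\<lambda>h. q (V h)) j h"
  using assms(2)
proof (induction j arbitrary: h)
  case (Suc j)
  then have "(phi_form n T (Suc j) ^^ m) r (V h) = (phi_form n R (Suc j) ^^ m) (\<lambda>h. r (V h)) h" for m r h
    by (intro phi_form_transport assms(1)) auto
  moreover have "(\<lambda>h. defect_form n T p q j (V h)) = defect_form n R p (\<lambda>h. q (V h)) j"
    using Suc by auto
  ultimately show ?case using Suc by simp
qed simp

section \<open>Defect operators and their quadratic forms\<close>

definition selfadjoint :: "('a::complex_hilbert \<Rightarrow> 'a) \<Rightarrow> bool"
  where "selfadjoint A \<longleftrightarrow> bounded_clinear A \<and> (\<forall>x y. inner (A x) y = inner x (A y))"

lemma defect_pow_Suc: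
  "defect_pow (Suc k) n H T p =
    (\<lambda>h. defect_pow k n H T p h - (Phi n T (Suc k) ^^ p (Suc k)) (defect_pow k n H T p) h)"
  by (simp add: defect_pow_def)

lemma defect_pow_0: "defect_pow 0 n H T p = proj H"
  by (simp add: defect_pow_def)

locale bounded_tuple =
  fixes k :: nat and n :: "nat \<Rightarrow> nat" and T :: "'a::complex_hilbert optuple"
  assumes bounded: "\<lbrakk>i \<in> {1..k}; s \<in> {1..n i}\<rbrakk> \<Longrightarrow> bounded_clinear (T i s)"
begin

lemma bounded_clinear_word_op:
  "i \<in> {1..k} \<Longrightarrow> set w \<subseteq> {1..n i} \<Longrightarrow> bounded_clinear (word_op (T i) w)"
  by (induction w) (auto simp: word_op_Nil word_op_Cons bounded_clinear_id
      intro: bounded_clinear_compose[OF bounded])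

lemma cadjoint_word_op_Cons:
  assumes "i \<in> {1..k}" "set (s # w) \<subseteq> {1..n i}"
  shows "cadjoint (word_op (T i) (s # w)) h = cadjoint (word_op (T i) w) (cadjoint (T i s) h)"
  unfolding word_op_Cons
  by (subst cadjoint_compose[of "T i s" "word_op (T i) w"])
    (use assms in \<open>auto intro: bounded bounded_clinear_word_op\<close>)

lemma bounded_clinear_mword_adj:
  "\<beta> \<in> mwords k n \<Longrightarrow> j \<le> k \<Longrightarrow> bounded_clinear (mword_adj T j \<beta>)"
proof (induction j)
  case 0
  then show ?case using bounded_clinear_id by (simp add: mword_adj_0[abs_def])
next
  case (Suc j)
  have "Suc j \<in> {1..k}" using Suc.prems(2) by simp
  then have A: "bounded_clinear (cadjoint (word_op (T (Suc j)) (\<beta> (Suc j))))"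
    using Suc.prems(1) by (intro bounded_clinear_cadjoint bounded_clinear_word_op) (auto simp: mwords_def)
  have "bounded_clinear (mword_adj T j \<beta>)" using Suc by simp
  from bounded_clinear_compose[OF A this] show ?case by (simp add: mword_adj_Suc[abs_def])
qed

lemma inner_Phi:
  assumes "i \<in> {1..k}"
  shows "inner (Phi n T i X x) y = (\<Sum>s\<in>{1..n i}. inner (X (cadjoint (T i s) x)) (cadjoint (T i s) y))"
  unfolding Phi_def inner_sum_left
  by (intro sum.cong refl) (use assms inner_cadjoint[OF bounded] in auto)

lemma inner_Phi_pow:
  assumes "i \<in> {1..k}"
  shows "inner ((Phi n T i ^^ p) X h) h = (phi_form n T i ^^ p) (\<lambda>h. inner (X h) h) h"
proof (induction p arbitrary: h)
  case (Suc p)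
  then show ?case by (simp add: inner_Phi[OF assms] phi_form_def)
qed simp

lemma inner_defect_pow:
  "j \<le> k \<Longrightarrow> inner (defect_pow j n H T p h) h = defect_form n T p (\<lambda>h. inner (proj H h) h) j h"
proof (induction j arbitrary: h)
  case 0
  then show ?case by (simp add: defect_pow_0)
next
  case (Suc j)
  have "Suc j \<in> {1..k}" using Suc.prems by simp
  with Suc show ?case by (simp add: defect_pow_Suc inner_diff_left inner_Phi_pow)
qed

lemma selfadjoint_Phi_pow:
  assumes i: "i \<in> {1..k}" and X: "selfadjoint X"
  shows "selfadjoint ((Phi n T i ^^ p) X)"
proof (induction p)
  case (Suc p)
  have "selfadjoint (Phi n T i Z)" if Z: "selfadjoint Z" for Z
    unfolding selfadjoint_def
  proof (intro conjI allI)
    have "bounded_clinear (\<lambda>h. T i s (Z (cadjoint (T i s) h)))" if s: "s \<in> {1..n i}" for s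
    proof -
      have "bounded_clinear (\<lambda>h. Z (cadjoint (T i s) h))"
        using Z bounded_clinear_compose bounded_clinear_cadjoint[OF bounded[OF i s]]
        unfolding selfadjoint_def by blast
      then show ?thesis by (rule bounded_clinear_compose[OF bounded[OF i s]])
    qed
    then show "bounded_clinear (Phi n T i Z)" unfolding Phi_def by (rule bounded_clinear_sum)
    show "inner (Phi n T i Z x) y = inner x (Phi n T i Z y)" for x y
      using Z inner_Phi[OF i, of Z x y] inner_Phi[OF i, of Z y x]
      by (simp add: selfadjoint_def inner_commute)
  qed
  with Suc show ?case by simp
qed (simp add: X)

lemma selfadjoint_defect_pow:
  assumes "closed_csubspace H"
  shows "j \<le> k \<Longrightarrow> selfadjoint (defect_pow j n H T p)"
proof (induction j)
  case 0
  show ?case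
    by (simp add: defect_pow_0 selfadjoint_def bounded_clinear_proj inner_proj assms)
next
  case (Suc j)
  have "Suc j \<in> {1..k}" using Suc.prems by simp
  then have "selfadjoint ((Phi n T (Suc j) ^^ p (Suc j)) (defect_pow j n H T p))"
    using Suc selfadjoint_Phi_pow by simp
  moreover have "selfadjoint (defect_pow j n H T p)" using Suc by simp
  ultimately show ?case
    by (simp add: defect_pow_Suc selfadjoint_def bounded_clinear_diff inner_diff_left inner_diff_right)
qed

text \<open>The geometric sum \<open>\<Sum>\<^sub>m \<Phi>\<^sub>i\<^sup>m \<circ> (id - \<Phi>\<^sub>i)\<close> telescopes.\<close>

lemma sum_words_lt_telescope:
  assumes i: "i \<in> {1..k}"
  shows "(\<Sum>w\<in>words_lt (n i) p. q (cadjoint (word_op (T i) w) h) - phi_form n T i q (cadjoint (word_op (T i) w) h))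
    = q h - (phi_form n T i ^^ p) q h"
proof (induction p arbitrary: h)
  case 0
  then show ?case by (simp add: words_lt_def)
next
  case (Suc p)
  let ?r = "\<lambda>h. q h - phi_form n T i q h"
  have "(\<Sum>w\<in>words_lt (n i) (Suc p). ?r (cadjoint (word_op (T i) w) h))
      = ?r h + (\<Sum>s\<in>{1..n i}. \<Sum>w\<in>words_lt (n i) p. ?r (cadjoint (word_op (T i) w) (cadjoint (T i s) h)))"
    unfolding sum_words_lt_Suc
    by (intro arg_cong2[where f = "(+)"] sum.cong refl)
      (simp_all add: word_op_Nil cadjoint_id, subst (1 2) cadjoint_word_op_Cons, auto simp: words_lt_def i[simplified])
  also have "\<dots> = ?r h + phi_form n T i (\<lambda>h. q h - (phi_form n T i ^^ p) q h) h"
    unfolding phi_form_def[of n T i "\<lambda>h. q h - (phi_form n T i ^^ p) q h"] by (simp only: Suc)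
  also have "\<dots> = q h - (phi_form n T i ^^ Suc p) q h" by (simp add: phi_form_diff)
  finally show ?case .
qed

text \<open>The inner sum over the words of the last component telescopes, because the last factor
  of the defect is id - \<Phi>.\<close>

lemma sum_mwords_lt_defect_form_Suc:
  assumes "Suc j \<le> k"
  shows "(\<Sum>\<beta>\<in>mwords_lt n p (Suc j). defect_form n T (\<lambda>_. 1) q (Suc j) (mword_adj T (Suc j) \<beta> h))
    = (\<Sum>\<beta>\<in>mwords_lt n p j. defect_form n T (\<lambda>_. 1) q j (mword_adj T j \<beta> h)
        - (phi_form n T (Suc j) ^^ p (Suc j)) (defect_form n T (\<lambda>_. 1) q j) (mword_adj T j \<beta> h))"
proof -
  have "mword_adj T j (\<beta>(Suc j := w)) h = mword_adj T j \<beta> h" for \<beta> w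
    by (rule mword_adj_cong) auto
  then show ?thesis
    unfolding sum_mwords_lt_Suc using assms
    by (simp add: mword_adj_Suc sum_words_lt_telescope defect_form_one_Suc fun_upd_same
        del: fun_upd_apply defect_form.simps)
qed

text \<open>Each telescoped component leaves a subtracted power of \<Phi> applied to a partial
  defect form; discarding it uses positivity for every j, not just for j = k. The bound is what
  makes the Berezin kernel a contraction.\<close>

lemma sum_mwords_lt_defect_form_le:
  assumes "\<And>j h. j \<le> k \<Longrightarrow> 0 \<le> defect_form n T (\<lambda>_. 1) q j h"
  shows "j \<le> k \<Longrightarrow> (\<Sum>\<beta>\<in>mwords_lt n p j. defect_form n T (\<lambda>_. 1) q j (mword_adj T j \<beta> h)) \<le> q h"
proof (induction j)
  case 0
  then show ?case by (simp add: mwords_lt_0 mword_adj_0)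
next
  case (Suc j)
  have "(\<Sum>\<beta>\<in>mwords_lt n p (Suc j). defect_form n T (\<lambda>_. 1) q (Suc j) (mword_adj T (Suc j) \<beta> h))
      \<le> (\<Sum>\<beta>\<in>mwords_lt n p j. defect_form n T (\<lambda>_. 1) q j (mword_adj T j \<beta> h))"
    unfolding sum_mwords_lt_defect_form_Suc[OF Suc.prems]
  proof (rule sum_mono)
    fix \<beta>
    have "0 \<le> (phi_form n T (Suc j) ^^ p (Suc j)) (defect_form n T (\<lambda>_. 1) q j) (mword_adj T j \<beta> h)"
      using Suc.prems assms by (intro phi_form_pow_nonneg) simp
    then show "defect_form n T (\<lambda>_. 1) q j (mword_adj T j \<beta> h)
        - (phi_form n T (Suc j) ^^ p (Suc j)) (defect_form n T (\<lambda>_. 1) q j) (mword_adj T j \<beta> h)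
        \<le> defect_form n T (\<lambda>_. 1) q j (mword_adj T j \<beta> h)" by simp
  qed
  then show ?case using Suc by simp
qed

end

section \<open>The Berezin kernel\<close>

text \<open>What the construction of a Berezin kernel consumes. A tuple in the polyball supplies the
  last two assumptions through its partial defects, the model tuple through the factorization of
  Y.\<close>

locale berezin_tuple = bounded_tuple k n T
  for k :: nat and n :: "nat \<Rightarrow> nat" and T :: "'a::complex_hilbert optuple" +
  fixes H :: "'a set"
  assumes H: "closed_csubspace H"
    and bops: "\<lbrakk>i \<in> {1..k}; s \<in> {1..n i}\<rbrakk> \<Longrightarrow> T i s \<in> bops H H"
    and defect_nonneg: "0 \<le> inner (defect k n H T h) h"
    and sum_defect_le: "\<lbrakk>finite F; F \<subseteq> mwords k n\<rbrakk> \<Longrightarrow>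
      (\<Sum>\<beta>\<in>F. inner (defect k n H T (mword_adj T k \<beta> h)) (mword_adj T k \<beta> h)) \<le> (norm (proj H h))\<^sup>2"
begin

lemma pos_op_defect: "pos_op (defect k n H T)"
  using selfadjoint_defect_pow[OF H order_refl, of "\<lambda>_. 1"] defect_nonneg
  by (simp add: pos_op_iff selfadjoint_def defect_def)

lemma inner_defect: "inner (defect k n H T h) h = defect_form n T (\<lambda>_. 1) (\<lambda>h. inner (proj H h) h) k h"
  by (simp add: defect_def inner_defect_pow)

lemma cadjoint_proj_tuple:
  assumes "i \<in> {1..k}" "s \<in> {1..n i}"
  shows "cadjoint (T i s) (proj H h) = cadjoint (T i s) h" "proj H (cadjoint (T i s) h) = cadjoint (T i s) h"
  using bops_cadjoint[OF bops[OF assms] H H] bops_proj[OF _ H] bopsD(2) proj_idem[OF H] by metis+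

lemma defect_bops: "defect k n H T \<in> bops H H"
proof -
  have *: "defect_pow j n H T p (proj H h) = defect_pow j n H T p h \<and> proj H (defect_pow j n H T p h) = defect_pow j n H T p h"
    if "j \<le> k" for j p h
    using that
  proof (induction j arbitrary: h)
    case 0
    then show ?case by (simp add: defect_pow_0 proj_idem[OF H proj_in[OF H]])
  next
    case (Suc j)
    have i: "Suc j \<in> {1..k}" using Suc.prems by simp
    have "(Phi n T (Suc j) ^^ m) X (proj H h) = (Phi n T (Suc j) ^^ m) X h
        \<and> proj H ((Phi n T (Suc j) ^^ m) X h) = (Phi n T (Suc j) ^^ m) X h"
      if "\<And>h. X (proj H h) = X h \<and> proj H (X h) = X h" for m X h
    proof (cases m)
      case (Suc m')
      have "proj H (T (Suc j) s y) = T (Suc j) s y" if "s \<in> {1..n (Suc j)}" for s y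
        by (rule proj_idem[OF H bopsD(2)[OF bops[OF i that]]])
      then show ?thesis using i
        by (simp add: Suc Phi_def cadjoint_proj_tuple bounded_clinear_simps[OF bounded_clinear_proj[OF H]])
    qed (use that in simp)
    from this[of "defect_pow j n H T p"] Suc show ?case
      by (simp add: defect_pow_Suc bounded_clinear_simps[OF bounded_clinear_proj[OF H]])
  qed
  show ?thesis
    by (rule bopsI[OF pos_opD(1)[OF pos_op_defect] H])
      (metis * defect_def order_refl proj_in[OF H])+
qed

lemma defect_space_eq: "defect_space k n H T = closure (range (defect k n H T))"
  by (simp add: defect_space_def image_bops_eq_range[OF defect_bops H])

lemma closed_csubspace_defect_space: "closed_csubspace (defect_space k n H T)"
  unfolding defect_space_eq by (rule closed_csubspace_closure_range[OF pos_opD(1)[OF pos_op_defect]])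

lemma defect_space_subset: "defect_space k n H T \<subseteq> H"
  unfolding defect_space_eq
  by (rule closure_minimal) (use bopsD(2)[OF defect_bops] closed_csubspaceD(1)[OF H] in auto)

lemma closed_csubspace_fock_defect: "closed_csubspace (fock k n (defect_space k n H T))"
  by (rule closed_csubspace_fock[OF closed_csubspace_defect_space])

lemma sum_sqrt_defect_le:
  assumes "finite F"
  shows "(\<Sum>\<beta>\<in>F. (norm (if \<beta> \<in> mwords k n then op_sqrt (defect k n H T) (mword_adj T k \<beta> h) else 0))\<^sup>2)
    \<le> (norm (proj H h))\<^sup>2"
proof -
  have "(\<Sum>\<beta>\<in>F. (norm (if \<beta> \<in> mwords k n then op_sqrt (defect k n H T) (mword_adj T k \<beta> h) else 0))\<^sup>2)
      = (\<Sum>\<beta>\<in>F \<inter> mwords k n. inner (defect k n H T (mword_adj T k \<beta> h)) (mword_adj T k \<beta> h))"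
    using assms by (intro sum.mono_neutral_cong_right) (auto simp: norm_op_sqrt_sq pos_op_defect)
  also have "\<dots> \<le> (norm (proj H h))\<^sup>2" by (rule sum_defect_le) (use assms in auto)
  finally show ?thesis .
qed

lemma coord_berezin:
  "coord (berezin k n H T h) \<beta> =
    (if \<beta> \<in> mwords k n then op_sqrt (defect k n H T) (mword_adj T k \<beta> h) else 0)"
proof -
  let ?g = "\<lambda>\<beta>. op_sqrt (defect k n H T) (mword_adj T k \<beta> h)"
  have "(\<lambda>\<beta>. (norm (if \<beta> \<in> mwords k n then ?g \<beta> else 0))\<^sup>2) summable_on mwords k n"
    by (rule square_summableI[OF sum_sqrt_defect_le])
  then have "(\<lambda>\<beta>. (norm (?g \<beta>))\<^sup>2) summable_on mwords k n"
    by (rule summable_on_cong[THEN iffD1, rotated]) simp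
  then obtain F where F: "((\<lambda>\<beta>. elem_tensor \<beta> (?g \<beta>)) has_sum F) (mwords k n)"
    "\<And>\<beta>. \<beta> \<in> mwords k n \<Longrightarrow> coord F \<beta> = ?g \<beta>" "\<And>\<beta>. \<beta> \<notin> mwords k n \<Longrightarrow> coord F \<beta> = 0"
    by (rule ex_has_sum_elem_tensor[where j = "\<lambda>x. x"]) auto
  have "berezin k n H T h = F"
    unfolding berezin_def using infsumI[OF F(1)] by (simp add: mword_adj_def)
  then show ?thesis using F by simp
qed

lemma norm_berezin_le: "norm (berezin k n H T h) \<le> norm (proj H h)"
proof -
  have "(norm (berezin k n H T h))\<^sup>2 \<le> (norm (proj H h))\<^sup>2"
    by (rule norm_ell2_sq_leI) (simp only: coord_berezin sum_sqrt_defect_le)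
  then show ?thesis by (rule power2_le_imp_le) simp
qed

lemma berezin_bops: "berezin k n H T \<in> bops H (fock k n (defect_space k n H T))"
proof -
  let ?D = "op_sqrt (defect k n H T)"
  note sD = bounded_clinear_simps[OF pos_opD(1)[OF pos_op_sqrt[OF pos_op_defect]]]
  have sW: "mword_adj T k \<beta> (x + y) = mword_adj T k \<beta> x + mword_adj T k \<beta> y"
    "mword_adj T k \<beta> (a *\<^sub>C x) = a *\<^sub>C mword_adj T k \<beta> x" if "\<beta> \<in> mwords k n" for \<beta> x y a
    using bounded_clinear_simps[OF bounded_clinear_mword_adj[OF that order_refl]] by auto
  have "bounded_clinear (berezin k n H T)"
  proof (rule bounded_clinearI[where c = 1])
    show "norm (berezin k n H T x) \<le> norm x * 1" for x
      using order_trans[OF norm_berezin_le norm_proj_le[OF H]] by simp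
  qed (auto intro!: ell2_eqI simp: coord_berezin sW sD)
  moreover have "berezin k n H T x \<in> fock k n (defect_space k n H T)" for x
    by (simp add: fock_def coord_berezin defect_space_eq bopsD(2)[OF op_sqrt_bops[OF pos_op_defect]])
  moreover have "berezin k n H T x = 0" if "x \<in> ocomplement H" for x
    using norm_berezin_le[of x] that by (simp add: proj_ocomplement[OF H])
  ultimately show ?thesis by (simp add: bops_def)
qed

end

section \<open>Regular polyballs\<close>

lemma cadjoint_scaleR:
  "bounded_clinear A \<Longrightarrow> cadjoint (\<lambda>h. r *\<^sub>R A h) = (\<lambda>h. r *\<^sub>R cadjoint A h)"
  by (rule cadjoint_eqI) (auto intro: bounded_clinear_scaleR simp: inner_cadjoint)

text \<open>The defect forms of the dilated tuple \<open>rT\<close>; the factor comes from \<open>\<Phi>\<^sub>r\<^sub>T = r\<^sup>2 \<Phi>\<^sub>T\<close>.\<close>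

primrec scaled_form ::
    "(nat \<Rightarrow> nat) \<Rightarrow> 'a::complex_hilbert optuple \<Rightarrow> real \<Rightarrow> ('a \<Rightarrow> real) \<Rightarrow> nat \<Rightarrow> 'a \<Rightarrow> real"
  where "scaled_form n T r q 0 = q"
  | "scaled_form n T r q (Suc j) =
      (\<lambda>h. scaled_form n T r q j h - r\<^sup>2 * phi_form n T (Suc j) (scaled_form n T r q j) h)"

lemma scaled_form_1: "scaled_form n T 1 q j = defect_form n T (\<lambda>_. 1) q j"
  by (induction j) (auto simp: defect_form_one_Suc simp del: defect_form.simps(2))

lemma tendsto_scaled_form:
  "((\<lambda>r. scaled_form n T r q j h) \<longlongrightarrow> scaled_form n T 1 q j h) (at 1 within A)"
proof (induction j arbitrary: h)
  case (Suc j)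
  have "((\<lambda>r. scaled_form n T r q j h - r\<^sup>2 * phi_form n T (Suc j) (scaled_form n T r q j) h) \<longlongrightarrow>
      scaled_form n T 1 q j h - 1\<^sup>2 * phi_form n T (Suc j) (scaled_form n T 1 q j) h) (at 1 within A)"
    unfolding phi_form_def by (intro tendsto_intros Suc)
  then show ?case by simp
qed simp

lemma mwords_mono:
  assumes "\<beta> \<in> mwords j n" "j \<le> k"
  shows "\<beta> \<in> mwords k n"
proof -
  have "set (\<beta> i) \<subseteq> {1..n i}" for i
    using assms(1) by (cases "i \<in> {1..j}") (auto simp: mwords_def)
  then show ?thesis using assms by (auto simp: mwords_def)
qed

locale polyball_tuple = phase_matrices k n \<Lambda>
  for k :: nat and n :: "nat \<Rightarrow> nat" and \<Lambda> :: "nat \<Rightarrow> nat \<Rightarrow> nat \<Rightarrow> nat \<Rightarrow> complex" +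
  fixes T :: "'a::complex_hilbert optuple" and H :: "'a set"
  assumes H: "closed_csubspace H" and T: "T \<in> polyball k n \<Lambda> H"
begin

lemma tuple_bops: "i \<in> {1..k} \<Longrightarrow> s \<in> {1..n i} \<Longrightarrow> T i s \<in> bops H H"
  using T by (simp add: polyball_def)

sublocale bounded_tuple k n T
  by unfold_locales (rule bopsD(1)[OF tuple_bops])

section \<open>Positivity of the partial defects of a tuple in the polyball\<close>

lemma row_contraction:
  assumes i: "i \<in> {1..k}"
  shows "phi_form n T i (\<lambda>h. (norm h)\<^sup>2) h \<le> (norm h)\<^sup>2"
proof -
  have "pos_op (\<lambda>h. proj H h - (\<Sum>s\<in>{1..n i}. T i s (cadjoint (T i s) h)))"
    using T i by (simp add: polyball_def)
  from pos_opD(3)[OF this, of h]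
  have "(\<Sum>s\<in>{1..n i}. inner (T i s (cadjoint (T i s) h)) h) \<le> inner (proj H h) h"
    by (simp add: inner_diff_left inner_sum_left)
  also have "\<dots> \<le> (norm h)\<^sup>2"
    using norm_proj_le[OF H, of h] by (simp add: norm_proj_sq[OF H, symmetric])
  also have "(\<Sum>s\<in>{1..n i}. inner (T i s (cadjoint (T i s) h)) h) = phi_form n T i (\<lambda>h. (norm h)\<^sup>2) h"
    unfolding phi_form_def
    by (intro sum.cong refl) (use inner_cadjoint[OF bounded[OF i]] in \<open>simp add: power2_norm_eq_inner\<close>)
  finally show ?thesis .
qed

lemma abs_phi_form_le:
  assumes i: "i \<in> {1..k}" and q: "\<And>h. \<bar>q h\<bar> \<le> c * (norm h)\<^sup>2" and c: "c \<ge> 0"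
  shows "\<bar>phi_form n T i q h\<bar> \<le> c * (norm h)\<^sup>2"
proof -
  have "\<bar>phi_form n T i q h\<bar> \<le> (\<Sum>s\<in>{1..n i}. \<bar>q (cadjoint (T i s) h)\<bar>)"
    unfolding phi_form_def by (rule sum_abs)
  also have "\<dots> \<le> (\<Sum>s\<in>{1..n i}. c * (norm (cadjoint (T i s) h))\<^sup>2)" by (intro sum_mono q)
  also have "\<dots> = c * phi_form n T i (\<lambda>h. (norm h)\<^sup>2) h" by (simp add: phi_form_def sum_distrib_left)
  also have "\<dots> \<le> c * (norm h)\<^sup>2" by (rule mult_left_mono[OF row_contraction[OF i] c])
  finally show ?thesis .
qed

text \<open>The map \<Phi> preserves a bound by c |h|^2, so each factor id - r^2 \<Phi> at most
  doubles it. The decay argument needs some such bound uniform in h.\<close>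

lemma abs_scaled_form_le:
  assumes r: "0 \<le> r" "r \<le> 1" and q: "\<And>h. \<bar>q h\<bar> \<le> (norm h)\<^sup>2"
  shows "j \<le> k \<Longrightarrow> \<bar>scaled_form n T r q j h\<bar> \<le> 2 ^ j * (norm h)\<^sup>2"
proof (induction j arbitrary: h)
  case 0
  then show ?case using q by simp
next
  case (Suc j)
  have "\<bar>phi_form n T (Suc j) (scaled_form n T r q j) h\<bar> \<le> 2 ^ j * (norm h)\<^sup>2"
    by (rule abs_phi_form_le) (use Suc in auto)
  then have "r\<^sup>2 * \<bar>phi_form n T (Suc j) (scaled_form n T r q j) h\<bar> \<le> 1 * (2 ^ j * (norm h)\<^sup>2)"
    using r by (intro mult_mono) (auto simp: power_le_one)
  moreover have "\<bar>scaled_form n T r q j h\<bar> \<le> 2 ^ j * (norm h)\<^sup>2" using Suc by simp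
  moreover have "\<bar>scaled_form n T r q (Suc j) h\<bar>
      \<le> \<bar>scaled_form n T r q j h\<bar> + r\<^sup>2 * \<bar>phi_form n T (Suc j) (scaled_form n T r q j) h\<bar>"
    using abs_triangle_ineq4[of "scaled_form n T r q j h" "r\<^sup>2 * phi_form n T (Suc j) (scaled_form n T r q j) h"]
    by (simp add: abs_mult)
  ultimately show ?case by simp
qed

text \<open>If \<open>q - r\<^sup>2 \<Phi>\<^sub>i q \<ge> 0\<close> then \<open>q \<ge> r\<^sup>2\<^sup>m \<Phi>\<^sub>i\<^sup>m q\<close> for all \<open>m\<close>, and the right-hand side tends to 0.  This is where
  the condition for all \<open>r < 1\<close> enters.\<close>

lemma scaled_form_nonneg_step:
  assumes r: "0 \<le> r" "r < 1" and i: "i \<in> {1..k}"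
    and q: "\<And>h. \<bar>q h\<bar> \<le> c * (norm h)\<^sup>2" and c: "c \<ge> 0"
    and nonneg: "\<And>h. 0 \<le> q h - r\<^sup>2 * phi_form n T i q h"
  shows "0 \<le> q h"
proof -
  have bound: "\<bar>(phi_form n T i ^^ m) q h\<bar> \<le> c * (norm h)\<^sup>2" for m h
    by (induction m arbitrary: h) (use q abs_phi_form_le[OF i _ c] in auto)
  have ge: "q h \<ge> (r\<^sup>2) ^ m * (phi_form n T i ^^ m) q h" for m h
  proof (induction m arbitrary: h)
    case (Suc m)
    have "(r\<^sup>2) ^ Suc m * (phi_form n T i ^^ Suc m) q h
        = r\<^sup>2 * phi_form n T i (\<lambda>h. (r\<^sup>2) ^ m * (phi_form n T i ^^ m) q h) h"
      by (simp add: phi_form_def sum_distrib_left mult.assoc)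
    also have "\<dots> \<le> r\<^sup>2 * phi_form n T i q h"
      by (intro mult_left_mono phi_form_mono Suc) simp
    also have "\<dots> \<le> q h" using nonneg[of h] by simp
    finally show ?case .
  qed simp
  have lim: "(\<lambda>m. (r\<^sup>2) ^ m) \<longlonglongrightarrow> 0"
  proof (rule LIMSEQ_power_zero)
    have "r\<^sup>2 < 1\<^sup>2" using r by (intro power_strict_mono) auto
    then show "norm (r\<^sup>2) < 1" by simp
  qed
  have "(\<lambda>m. (r\<^sup>2) ^ m * (- (c * (norm h)\<^sup>2))) \<longlonglongrightarrow> 0 * (- (c * (norm h)\<^sup>2))"
    by (intro tendsto_mult lim tendsto_const)
  moreover have "(r\<^sup>2) ^ m * (- (c * (norm h)\<^sup>2)) \<le> q h" for m
    using ge[of m h] mult_left_mono[of "- (c * (norm h)\<^sup>2)" "(phi_form n T i ^^ m) q h" "(r\<^sup>2) ^ m"]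
      bound[of m h] by fastforce
  ultimately show ?thesis using LIMSEQ_le_const2 by force
qed

text \<open>Homogeneity of degree two converts the factor r in the adjoint into r^2. It is part of
  the induction because the next application of \<Phi> needs it for the form already
  reached.\<close>

lemma defect_form_scaled:
  assumes q: "\<And>h. q (r *\<^sub>R h) = r\<^sup>2 * q h"
  shows "j \<le> k \<Longrightarrow> defect_form n (\<lambda>i s h. r *\<^sub>R T i s h) (\<lambda>_. 1) q j h = scaled_form n T r q j h
    \<and> scaled_form n T r q j (r *\<^sub>R h) = r\<^sup>2 * scaled_form n T r q j h"
proof (induction j arbitrary: h)
  case 0
  then show ?case by (simp add: q)
next
  case (Suc j)
  have i: "Suc j \<in> {1..k}" using Suc.prems by simp
  have D: "defect_form n (\<lambda>i s h. r *\<^sub>R T i s h) (\<lambda>_. 1) q j = scaled_form n T r q j"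
    using Suc by auto
  have hom: "scaled_form n T r q j (r *\<^sub>R h) = r\<^sup>2 * scaled_form n T r q j h" for h
    using Suc by auto
  show ?case
    using i by (simp add: defect_form_one_Suc D phi_form_def cadjoint_scaleR bounded hom
        sum_distrib_left bounded_clinear_simps[OF bounded_clinear_cadjoint] right_diff_distrib
        del: defect_form.simps)
qed

abbreviation "q0 \<equiv> (\<lambda>h. inner (proj H h) h)"

lemma abs_q0_le: "\<bar>q0 h\<bar> \<le> (norm h)\<^sup>2"
  using norm_proj_le[OF H, of h] by (simp add: norm_proj_sq[OF H, symmetric])

text \<open>Downward induction: at j = k this is the regularity condition for rT, and the preceding
  lemma on one factor removes the factors from the outside.\<close>

lemma scaled_form_nonneg:
  assumes r: "0 \<le> r" "r < 1" and j: "j \<le> k"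
  shows "0 \<le> scaled_form n T r q0 j h"
  using j
proof (induction arbitrary: h rule: inc_induct)
  case base
  have "bounded_tuple k n (\<lambda>i s h. r *\<^sub>R T i s h)"
    by unfold_locales (intro bounded_clinear_scaleR bounded)
  from bounded_tuple.inner_defect_pow[OF this order_refl, of H "\<lambda>_. 1" h]
  have "inner (defect k n H (\<lambda>i s h. r *\<^sub>R T i s h) h) h = scaled_form n T r q0 k h"
    by (simp add: defect_def defect_form_scaled bounded_clinear_simps[OF bounded_clinear_proj[OF H]]
        power2_eq_square)
  moreover have "pos_op (defect k n H (\<lambda>i s h. r *\<^sub>R T i s h))"
    using T r by (simp add: polyball_def)
  ultimately show ?case using pos_opD(3) by metis
next
  case (step j)
  have "0 \<le> scaled_form n T r q0 j h - r\<^sup>2 * phi_form n T (Suc j) (scaled_form n T r q0 j) h" for h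
    using step.IH by simp
  then show ?case
    using step.hyps r abs_scaled_form_le[of r q0 j]
    by (intro scaled_form_nonneg_step[of r "Suc j" "scaled_form n T r q0 j" "2 ^ j"])
      (auto simp: abs_q0_le)
qed

lemma defect_form_nonneg:
  assumes j: "j \<le> k"
  shows "0 \<le> defect_form n T (\<lambda>_. 1) q0 j h"
proof -
  \<comment> \<open>Removing factors needs r < 1 for the powers of r^2 to vanish, so r = 1 is
    reached as a left-hand limit.\<close>
  have "\<forall>\<^sub>F r in at_left (1::real). 0 \<le> scaled_form n T r q0 j h"
    by (rule eventually_mono[OF eventually_at_left_real[of 0 "1::real"]])
      (use scaled_form_nonneg[OF _ _ j] in auto)
  then have "0 \<le> scaled_form n T 1 q0 j h"
    by (intro tendsto_lowerbound[OF tendsto_scaled_form]) auto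
  then show ?thesis by (simp add: scaled_form_1)
qed

sublocale berezin_tuple k n T H
proof
  show "closed_csubspace H" by (rule H)
  show "T i s \<in> bops H H" if "i \<in> {1..k}" "s \<in> {1..n i}" for i s by (rule tuple_bops[OF that])
  have inner_defect: "inner (defect k n H T h) h = defect_form n T (\<lambda>_. 1) q0 k h" for h
    by (simp add: defect_def inner_defect_pow)
  show nonneg: "0 \<le> inner (defect k n H T h) h" for h
    by (simp add: inner_defect defect_form_nonneg)
  fix F :: "mword set" and h :: 'a assume F: "finite F" "F \<subseteq> mwords k n"
  obtain p where p: "F \<subseteq> mwords_lt n p k" by (rule finite_subset_mwords_lt[OF F])
  have "(\<Sum>\<beta>\<in>F. inner (defect k n H T (mword_adj T k \<beta> h)) (mword_adj T k \<beta> h))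
      \<le> (\<Sum>\<beta>\<in>mwords_lt n p k. inner (defect k n H T (mword_adj T k \<beta> h)) (mword_adj T k \<beta> h))"
    using p nonneg by (intro sum_mono2) (auto simp: finite_mwords_lt)
  also have "\<dots> \<le> q0 h"
    unfolding inner_defect by (rule sum_mwords_lt_defect_form_le) (auto simp: defect_form_nonneg)
  finally show "(\<Sum>\<beta>\<in>F. inner (defect k n H T (mword_adj T k \<beta> h)) (mword_adj T k \<beta> h)) \<le> (norm (proj H h))\<^sup>2"
    by (simp add: norm_proj_sq[OF H])
qed

subsection \<open>Commutation relations\<close>

lemma cadjoint_commute:
  assumes i: "i \<in> {1..k}" "s \<in> {1..n i}" and l: "l \<in> {1..k}" "t \<in> {1..n l}" and ne: "i \<noteq> l"
  shows "cadjoint (T l t) (cadjoint (T i s) h) = cnj (\<Lambda> i l s t) *\<^sub>C cadjoint (T i s) (cadjoint (T l t) h)"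
proof (subst vector_eq_ldot[symmetric], intro allI)
  fix x
  have rel: "T i s (T l t x) = \<Lambda> i l s t *\<^sub>C T l t (T i s x)"
  proof -
    have "\<forall>i\<in>{1..k}. \<forall>j\<in>{1..k}. i \<noteq> j \<longrightarrow> (\<forall>s\<in>{1..n i}. \<forall>t\<in>{1..n j}. \<forall>h.
        T i s (T j t h) = \<Lambda> i j s t *\<^sub>C T j t (T i s h))"
      using T unfolding polyball_def by blast
    then show ?thesis using i l ne by blast
  qed
  have "inner x (cadjoint (T l t) (cadjoint (T i s) h)) = inner (T i s (T l t x)) h"
    by (simp only: inner_cadjoint[OF bounded[OF i]] inner_cadjoint[OF bounded[OF l]])
  also have "\<dots> = inner x (cadjoint (T i s) (cadjoint (T l t) (cnj (\<Lambda> i l s t) *\<^sub>C h)))"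
    by (simp only: rel inner_scaleC_left inner_cadjoint[OF bounded[OF i]] inner_cadjoint[OF bounded[OF l]])
  also have "\<dots> = inner x (cnj (\<Lambda> i l s t) *\<^sub>C cadjoint (T i s) (cadjoint (T l t) h))"
    by (simp only: bounded_clinear_simps(7)[OF bounded_clinear_cadjoint[OF bounded[OF i]]]
        bounded_clinear_simps(7)[OF bounded_clinear_cadjoint[OF bounded[OF l]]])
  finally show "inner x (cadjoint (T l t) (cadjoint (T i s) h))
    = inner x (cnj (\<Lambda> i l s t) *\<^sub>C cadjoint (T i s) (cadjoint (T l t) h))" .
qed

lemma cadjoint_word_op_commute:
  assumes i: "i \<in> {1..k}" "s \<in> {1..n i}" and l: "l \<in> {1..k}" and ne: "i \<noteq> l"
  shows "set w \<subseteq> {1..n l} \<Longrightarrow> cadjoint (word_op (T l) w) (cadjoint (T i s) h)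
    = cnj (prod_list (map (\<Lambda> i l s) w)) *\<^sub>C cadjoint (T i s) (cadjoint (word_op (T l) w) h)"
proof (induction w arbitrary: h)
  case Nil
  then show ?case by (simp add: word_op_Nil cadjoint_id)
next
  case (Cons t w)
  then have t: "t \<in> {1..n l}" and w: "set w \<subseteq> {1..n l}" by auto
  have lin: "bounded_clinear (cadjoint (word_op (T l) w))"
    by (rule bounded_clinear_cadjoint[OF bounded_clinear_word_op[OF l w]])
  show ?case
    by (simp only: cadjoint_word_op_Cons[OF l Cons.prems] cadjoint_commute[OF i l t ne]
        bounded_clinear_simps(7)[OF lin] Cons.IH[OF w])
      (simp add: scaleC_scaleC)
qed

text \<open>The adjoint of \<open>T i s\<close> passes the components 1 to j, none of which has
  index i, and collects one conjugated entry of \<Lambda> for every letter.\<close>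

lemma mword_adj_commute:
  assumes i: "i \<in> {1..k}" "s \<in> {1..n i}" and \<beta>: "\<beta> \<in> mwords k n"
  shows "j \<le> k \<Longrightarrow> i \<notin> {1..j} \<Longrightarrow> mword_adj T j \<beta> (cadjoint (T i s) h)
    = cnj (\<Prod>l\<in>{1..<Suc j}. prod_list (map (\<Lambda> i l s) (\<beta> l))) *\<^sub>C cadjoint (T i s) (mword_adj T j \<beta> h)"
proof (induction j)
  case 0
  then show ?case by (simp add: mword_adj_0)
next
  case (Suc j)
  have l: "Suc j \<in> {1..k}" and ne: "i \<noteq> Suc j" and ij: "i \<notin> {1..j}" using Suc.prems by auto
  have w: "set (\<beta> (Suc j)) \<subseteq> {1..n (Suc j)}" using \<beta> l by (auto simp: mwords_def)
  have lin: "bounded_clinear (cadjoint (word_op (T (Suc j)) (\<beta> (Suc j))))"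
    by (rule bounded_clinear_cadjoint[OF bounded_clinear_word_op[OF l w]])
  have "j \<le> k" using Suc.prems by simp
  then show ?case
    by (simp only: mword_adj_Suc Suc.IH ij not_False_eq_True bounded_clinear_simps(7)[OF lin]
        cadjoint_word_op_commute[OF i l ne w])
      (simp add: scaleC_scaleC prod.atLeastLessThan_Suc mult.commute)
qed

text \<open>Passing the components of index below i produces precisely the phase of the model shift;
  at index i the operator is absorbed as a new first letter, and later components act on both sides
  alike.\<close>

lemma mword_adj_cadjoint:
  assumes i: "i \<in> {1..k}" "s \<in> {1..n i}" and \<beta>: "\<beta> \<in> mwords k n" and j: "i \<le> j" "j \<le> k"
  shows "mword_adj T j \<beta> (cadjoint (T i s) h) = cnj (phase \<Lambda> i s \<beta>) *\<^sub>C mword_adj T j (\<beta>(i := s # \<beta> i)) h"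
  using j
proof (induction j rule: dec_induct)
  case base
  obtain i' where i': "i = Suc i'" using i(1) by (cases i) auto
  have w: "set (s # \<beta> i) \<subseteq> {1..n i}" using \<beta> i by (auto simp: mwords_def)
  have lin: "bounded_clinear (cadjoint (word_op (T i) (\<beta> i)))"
    by (rule bounded_clinear_cadjoint[OF bounded_clinear_word_op[OF i(1)]]) (use w in simp)
  have "mword_adj T i' \<beta> h = mword_adj T i' (\<beta>(i := s # \<beta> i)) h"
    by (rule mword_adj_cong) (use i' in auto)
  moreover have "mword_adj T i' \<beta> (cadjoint (T i s) h)
      = cnj (phase \<Lambda> i s \<beta>) *\<^sub>C cadjoint (T i s) (mword_adj T i' \<beta> h)"
    unfolding phase_def i'[symmetric] by (subst mword_adj_commute[OF i \<beta>]) (use i' i in auto)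
  ultimately show ?case
    unfolding i' mword_adj_Suc unfolding i'[symmetric]
    by (simp add: bounded_clinear_simps(7)[OF lin] cadjoint_word_op_Cons[OF i(1) w])
next
  case (step j)
  have l: "Suc j \<in> {1..k}" using step by simp
  have "set (\<beta> (Suc j)) \<subseteq> {1..n (Suc j)}" using \<beta> l by (auto simp: mwords_def)
  then have lin: "bounded_clinear (cadjoint (word_op (T (Suc j)) (\<beta> (Suc j))))"
    by (rule bounded_clinear_cadjoint[OF bounded_clinear_word_op[OF l]])
  have "(\<beta>(i := s # \<beta> i)) (Suc j) = \<beta> (Suc j)" using step by simp
  then show ?case using step by (simp add: mword_adj_Suc bounded_clinear_simps(7)[OF lin])
qed

theorem berezin_cadjoint:
  assumes i: "i \<in> {1..k}" "s \<in> {1..n i}"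
  shows "berezin k n H T (cadjoint (T i s) h) = cadjoint (model_shift k n \<Lambda> i s) (berezin k n H T h)"
proof (rule ell2_eqI)
  fix \<beta>
  have "i \<le> k" using i by simp
  then show "coord (berezin k n H T (cadjoint (T i s) h)) \<beta>
      = coord (cadjoint (model_shift k n \<Lambda> i s) (berezin k n H T h)) \<beta>"
    by (simp add: coord_berezin coord_cadjoint_model_shift[OF i] mword_adj_cadjoint[OF i]
        mwords_upd[OF _ i(1), of _ n s, OF _ i(2)]
        bounded_clinear_simps(7)[OF pos_opD(1)[OF pos_op_sqrt[OF pos_op_defect]]] del: fun_upd_apply)
qed

corollary cadjoint_berezin_model_shift:
  assumes i: "i \<in> {1..k}" "s \<in> {1..n i}"
  shows "cadjoint (berezin k n H T) (model_shift k n \<Lambda> i s f) = T i s (cadjoint (berezin k n H T) f)"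
proof -
  note bK = bopsD(1)[OF berezin_bops]
  have "inner x (cadjoint (berezin k n H T) (model_shift k n \<Lambda> i s f))
      = inner x (T i s (cadjoint (berezin k n H T) f))" for x
  proof -
    have "inner x (cadjoint (berezin k n H T) (model_shift k n \<Lambda> i s f))
        = inner (cadjoint (model_shift k n \<Lambda> i s) (berezin k n H T x)) f"
      by (simp only: inner_cadjoint[OF bK, symmetric] inner_cadjoint_left[OF bounded_clinear_model_shift[OF i]])
    also have "\<dots> = inner (cadjoint (T i s) x) (cadjoint (berezin k n H T) f)"
      by (simp only: berezin_cadjoint[OF i, symmetric] inner_cadjoint[OF bK])
    also have "\<dots> = inner x (T i s (cadjoint (berezin k n H T) f))"
      by (rule inner_cadjoint_left[OF bounded[OF i]])
    finally show ?thesis .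
  qed
  then show ?thesis using vector_eq_ldot by blast
qed

subsection \<open>Completely non-coisometric tuples\<close>

text \<open>Reordering adjoints costs unimodular scalars, which such forms do not see; this lets the
  maps \<Phi> be treated as if the tuples commuted.\<close>

definition phase_invariant :: "('a \<Rightarrow> real) \<Rightarrow> bool"
  where "phase_invariant q \<longleftrightarrow> (\<forall>c h. cmod c = 1 \<longrightarrow> q (c *\<^sub>C h) = q h)"

lemma phase_invariant_phi_form_pow:
  assumes i: "i \<in> {1..k}" and q: "phase_invariant q"
  shows "phase_invariant ((phi_form n T i ^^ m) q)"
proof (induction m)
  case (Suc m)
  have "cadjoint (T i s) (c *\<^sub>C h) = c *\<^sub>C cadjoint (T i s) h" if "s \<in> {1..n i}" for s c h
    by (rule bounded_clinear_simps(7)[OF bounded_clinear_cadjoint[OF bounded[OF i that]]])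
  then show ?case using Suc by (simp add: phase_invariant_def phi_form_def)
qed (use q in simp)

lemma phase_invariant_defect_form:
  assumes q: "phase_invariant q"
  shows "j \<le> k \<Longrightarrow> phase_invariant (defect_form n T p q j)"
proof (induction j)
  case (Suc j)
  then have D: "phase_invariant (defect_form n T p q j)" by simp
  have "phase_invariant ((phi_form n T (Suc j) ^^ p (Suc j)) (defect_form n T p q j))"
    by (rule phase_invariant_phi_form_pow[OF _ D]) (use Suc.prems in simp)
  then show ?case using D by (simp add: phase_invariant_def)
qed (use q in simp)

text \<open>The sum over words commutes with \<Phi> for an index outside 1 to j, because the
  adjoints involved commute up to unimodular scalars.\<close>

lemma sum_phi_form_pow_mword_adj:
  assumes i: "i \<in> {1..k}" and j: "j \<le> k" and ij: "i \<notin> {1..j}" and q: "phase_invariant q"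
  shows "(\<Sum>\<beta>\<in>mwords_lt n p j. (phi_form n T i ^^ m) q (mword_adj T j \<beta> h))
    = (phi_form n T i ^^ m) (\<lambda>h. \<Sum>\<beta>\<in>mwords_lt n p j. q (mword_adj T j \<beta> h)) h"
proof (induction m arbitrary: h)
  case (Suc m)
  let ?q = "(phi_form n T i ^^ m) q"
  have "?q (cadjoint (T i s) (mword_adj T j \<beta> h)) = ?q (mword_adj T j \<beta> (cadjoint (T i s) h))"
    if s: "s \<in> {1..n i}" and \<beta>: "\<beta> \<in> mwords_lt n p j" for s \<beta>
  proof -
    have \<beta>': "\<beta> \<in> mwords k n" using \<beta> mwords_mono[OF _ j] by (simp add: mwords_lt_def)
    let ?c = "\<Prod>l\<in>{1..<Suc j}. prod_list (map (\<Lambda> i l s) (\<beta> l))"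
    have "cmod (prod_list (map (\<Lambda> i l s) w)) = 1" if "set w \<subseteq> {1..n l}" "l \<in> {1..k}" "l \<noteq> i" for l w
      using that by (induction w) (use i s cmod_\<Lambda>[of i l s] in \<open>auto simp: norm_mult\<close>)
    moreover have "l \<in> {1..k} \<and> l \<noteq> i \<and> set (\<beta> l) \<subseteq> {1..n l}" if "l \<in> {1..<Suc j}" for l
      using \<beta>' ij j that by (auto simp: mwords_def)
    ultimately have "cmod ?c = 1" unfolding prod_norm[symmetric] by (intro prod.neutral) blast
    then have "cmod (cnj ?c) = 1" by (simp only: complex_mod_cnj)
    then show ?thesis
      using mword_adj_commute[OF i s \<beta>' j ij, of h] phase_invariant_phi_form_pow[OF i q, of m]
      unfolding phase_invariant_def by simp
  qed
  then have "(\<Sum>\<beta>\<in>mwords_lt n p j. (phi_form n T i ^^ Suc m) q (mword_adj T j \<beta> h))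
      = (\<Sum>\<beta>\<in>mwords_lt n p j. \<Sum>s\<in>{1..n i}. ?q (mword_adj T j \<beta> (cadjoint (T i s) h)))"
    by (simp add: phi_form_def)
  also have "\<dots> = phi_form n T i (\<lambda>h. \<Sum>\<beta>\<in>mwords_lt n p j. ?q (mword_adj T j \<beta> h)) h"
    unfolding phi_form_def by (rule sum.swap)
  finally show ?case by (simp only: Suc) simp
qed simp

text \<open>Telescoping leaves a power of \<Phi> inside the sum over the earlier components. The
  commutation relations bring it outside, which upgrades the inequality for these sums to an
  equality.\<close>

lemma sum_mwords_lt_defect_form:
  assumes q: "phase_invariant q"
  shows "j \<le> k \<Longrightarrow> (\<Sum>\<beta>\<in>mwords_lt n p j. defect_form n T (\<lambda>_. 1) q j (mword_adj T j \<beta> h))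
    = defect_form n T p q j h"
proof (induction j arbitrary: h)
  case 0
  then show ?case by (simp add: mwords_lt_0 mword_adj_0)
next
  case (Suc j)
  have i: "Suc j \<in> {1..k}" and j: "j \<le> k" using Suc.prems by auto
  show ?case
    unfolding sum_mwords_lt_defect_form_Suc[OF Suc.prems] sum_subtractf
    by (simp only: Suc.IH[OF j] defect_form.simps
        sum_phi_form_pow_mword_adj[OF i j _ phase_invariant_defect_form[OF q j], simplified])
qed

theorem berezin_eq_0:
  assumes cnc: "completely_non_coisometric k n H T" and h: "h \<in> H" and K: "berezin k n H T h = 0"
  shows "h = 0"
proof -
  have q0: "phase_invariant q0"
    by (simp add: phase_invariant_def bounded_clinear_simps[OF bounded_clinear_proj[OF H]]
        inner_scaleC_scaleC)
  have "cinner (defect_pow k n H T p h) h = 0" for p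
  proof -
    have "inner (defect k n H T (mword_adj T k \<beta> h)) (mword_adj T k \<beta> h) = 0" if "\<beta> \<in> mwords_lt n p k" for \<beta>
    proof -
      have "coord (berezin k n H T h) \<beta> = op_sqrt (defect k n H T) (mword_adj T k \<beta> h)"
        using that by (simp add: coord_berezin mwords_lt_def)
      then show ?thesis by (simp add: K norm_op_sqrt_sq[OF pos_op_defect, symmetric])
    qed
    then have "(\<Sum>\<beta>\<in>mwords_lt n p k. inner (defect k n H T (mword_adj T k \<beta> h)) (mword_adj T k \<beta> h)) = 0"
      by (rule sum.neutral[OF ballI])
    then have "inner (defect_pow k n H T p h) h = 0"
      by (simp only: inner_defect_pow[OF order_refl] inner_defect sum_mwords_lt_defect_form[OF q0 order_refl])
    moreover have "inner (defect_pow k n H T p h) (\<i> *\<^sub>C h) = 0"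
      using selfadjoint_inner_ii selfadjoint_defect_pow[OF H order_refl] by (metis selfadjoint_def)
    ultimately show ?thesis by (simp add: cinner_eq_Complex complex_eq_iff)
  qed
  then show ?thesis using cnc h by (auto simp: completely_non_coisometric_def)
qed

end

section \<open>The model tuple and the characteristic function\<close>

lemma infsum_finite_UN_disjoint:
  fixes f :: "'a \<Rightarrow> real"
  assumes "finite I" "f summable_on UNIV"
    and "\<And>i j. i \<in> I \<Longrightarrow> j \<in> I \<Longrightarrow> i \<noteq> j \<Longrightarrow> B i \<inter> B j = {}"
  shows "infsum f (\<Union>i\<in>I. B i) = (\<Sum>i\<in>I. infsum f (B i))"
  using assms(1,3)
proof (induction I rule: finite_induct)
  case (insert x I)
  have "infsum f (B x \<union> (\<Union>i\<in>I. B i)) = infsum f (B x) + infsum f (\<Union>i\<in>I. B i)"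
    by (rule infsum_Un_disjoint) (use insert summable_on_subset_banach[OF assms(2)] in auto)
  then show ?case using insert by simp
qed simp

text \<open>Letter by letter and then component by component, \<open>V\<close> is moved past the
  adjoints.\<close>

lemma mword_adj_transport:
  assumes "bounded_tuple k n T" "bounded_tuple k n R"
    and rel: "\<And>i s h. i \<in> {1..k} \<Longrightarrow> s \<in> {1..n i} \<Longrightarrow> cadjoint (T i s) (V h) = V (cadjoint (R i s) h)"
    and \<beta>: "\<beta> \<in> mwords k n"
  shows "j \<le> k \<Longrightarrow> mword_adj T j \<beta> (V h) = V (mword_adj R j \<beta> h)"
proof (induction j)
  case 0
  then show ?case by (simp add: mword_adj_0)
next
  case (Suc j)
  interpret T: bounded_tuple k n T by fact
  interpret R: bounded_tuple k n R by fact
  have i: "Suc j \<in> {1..k}" using Suc.prems by simp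
  have "cadjoint (word_op (T (Suc j)) w) (V h) = V (cadjoint (word_op (R (Suc j)) w) h)"
    if "set w \<subseteq> {1..n (Suc j)}" for w h
    using that
  proof (induction w arbitrary: h)
    case (Cons s w)
    then have "s \<in> {1..n (Suc j)}" "set w \<subseteq> {1..n (Suc j)}" by auto
    then show ?case
      by (simp only: T.cadjoint_word_op_Cons[OF i Cons.prems] R.cadjoint_word_op_Cons[OF i Cons.prems]
          rel[OF i] Cons.IH)
  qed (simp add: word_op_Nil cadjoint_id)
  moreover have "set (\<beta> (Suc j)) \<subseteq> {1..n (Suc j)}" using \<beta> i by (auto simp: mwords_def)
  ultimately show ?case using Suc by (simp add: mword_adj_Suc)
qed

context phase_matrices
begin

lemma bounded_tuple_model_shift: "bounded_tuple k n (model_shift k n \<Lambda>)"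
  by unfold_locales (rule bounded_clinear_model_shift)

lemma norm_coord_cadjoint_shift:
  assumes "i \<in> {1..k}" "s \<in> {1..n i}" "\<alpha> \<in> mwords k n"
  shows "norm (coord (cadjoint (model_shift k n \<Lambda> i s) g) \<alpha>) = norm (coord g (\<alpha>(i := s # \<alpha> i)))"
  using assms by (simp add: coord_cadjoint_model_shift norm_scaleC cmod_phase del: fun_upd_apply)

text \<open>Only norms of coordinates are tracked, so that the phases of the shifts drop
  out.\<close>

lemma norm_coord_cadjoint_word_shift:
  assumes i: "i \<in> {1..k}" and \<alpha>: "\<alpha> \<in> mwords k n"
  shows "set w \<subseteq> {1..n i} \<Longrightarrow>
    norm (coord (cadjoint (word_op (model_shift k n \<Lambda> i) w) g) \<alpha>) = norm (coord g (\<alpha>(i := w @ \<alpha> i)))"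
proof (induction w arbitrary: g)
  case Nil
  then show ?case by (simp add: word_op_Nil cadjoint_id)
next
  case (Cons s w)
  then have s: "s \<in> {1..n i}" and w: "set w \<subseteq> {1..n i}" by auto
  have "\<alpha>(i := w @ \<alpha> i) \<in> mwords k n" using \<alpha> w i by (auto simp: mwords_def)
  from norm_coord_cadjoint_shift[OF i s this] show ?case
    by (simp add: bounded_tuple.cadjoint_word_op_Cons[OF bounded_tuple_model_shift i Cons.prems] Cons.IH[OF w] fun_upd_same
        del: fun_upd_apply)
qed

lemma norm_coord_mword_adj_shift:
  assumes \<beta>: "\<beta> \<in> mwords k n"
  shows "j \<le> k \<Longrightarrow> \<alpha> \<in> mwords k n \<Longrightarrow> norm (coord (mword_adj (model_shift k n \<Lambda>) j \<beta> g) \<alpha>)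
    = norm (coord g (\<lambda>i. if i \<in> {1..j} then \<beta> i @ \<alpha> i else \<alpha> i))"
proof (induction j arbitrary: \<alpha>)
  case 0
  then show ?case by (simp add: mword_adj_0)
next
  case (Suc j)
  have i: "Suc j \<in> {1..k}" using Suc.prems by simp
  then have w: "set (\<beta> (Suc j)) \<subseteq> {1..n (Suc j)}" using \<beta> by (auto simp: mwords_def)
  let ?\<alpha> = "\<alpha>(Suc j := \<beta> (Suc j) @ \<alpha> (Suc j))"
  have \<alpha>': "?\<alpha> \<in> mwords k n" using Suc.prems w i by (auto simp: mwords_def)
  have "(\<lambda>i. if i \<in> {1..j} then \<beta> i @ ?\<alpha> i else ?\<alpha> i) = (\<lambda>i. if i \<in> {1..Suc j} then \<beta> i @ \<alpha> i else \<alpha> i)"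
    by (auto simp: fun_eq_iff)
  then show ?case
    using Suc.IH[OF _ \<alpha>'] Suc.prems
    by (simp only: mword_adj_Suc norm_coord_cadjoint_word_shift[OF i Suc.prems(2) w])
qed

text \<open>Word adjoints bring the coordinate at \<open>\<beta>\<close> to the empty multi-word,
  where the defect of the model can read it.\<close>

lemma norm_coord_mword_adj_shift_vacuum:
  assumes \<beta>: "\<beta> \<in> mwords k n"
  shows "norm (coord (mword_adj (model_shift k n \<Lambda>) k \<beta> g) (\<lambda>_. [])) = norm (coord g \<beta>)"
proof -
  have "(\<lambda>i. if i \<in> {1..k} then \<beta> i @ [] else []) = \<beta>" using \<beta> by (auto simp: fun_eq_iff mwords_def)
  moreover have "(\<lambda>_. []) \<in> mwords k n" by (simp add: mwords_def)
  ultimately show ?thesis using norm_coord_mword_adj_shift[OF \<beta> order_refl, of "\<lambda>_. []" g] by simp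
qed

text \<open>The defect operator of the universal model is the projection onto the vacuum vectors.\<close>

lemma defect_form_shift:
  "j \<le> k \<Longrightarrow> defect_form n (model_shift k n \<Lambda>) (\<lambda>_. 1) (\<lambda>g. \<Sum>\<^sub>\<infinity>\<alpha>\<in>mwords k n. (norm (coord g \<alpha>))\<^sup>2) j g
    = (\<Sum>\<^sub>\<infinity>\<alpha>\<in>{\<alpha> \<in> mwords k n. \<forall>i\<in>{1..j}. \<alpha> i = []}. (norm (coord g \<alpha>))\<^sup>2)"
proof (induction j arbitrary: g)
  case 0
  then show ?case by simp
next
  case (Suc j)
  let ?Z = "\<lambda>j. {\<alpha> \<in> mwords k n. \<forall>i\<in>{1..j}. \<alpha> i = []}"
  let ?u = "\<lambda>s \<alpha>. \<alpha>(Suc j := s # \<alpha> (Suc j))"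
  let ?f = "\<lambda>\<alpha>. (norm (coord g \<alpha>))\<^sup>2"
  have i: "Suc j \<in> {1..k}" using Suc.prems by simp
  have summ: "?f summable_on UNIV" by (rule coord_summable)
  \<comment> \<open>Split by the component \<open>Suc j\<close>: either it is empty, or it has a
    first letter s. The second part contributes exactly the term that id - \<Phi> subtracts.\<close>
  have cover: "?Z j = ?Z (Suc j) \<union> (\<Union>s\<in>{1..n (Suc j)}. ?u s ` ?Z j)"
  proof (intro set_eqI iffI)
    fix \<alpha> assume \<alpha>: "\<alpha> \<in> ?Z j"
    show "\<alpha> \<in> ?Z (Suc j) \<union> (\<Union>s\<in>{1..n (Suc j)}. ?u s ` ?Z j)"
    proof (cases "\<alpha> (Suc j)")
      case Nil
      then have "\<alpha> i = []" if "i \<in> {1..Suc j}" for i using \<alpha> that by (cases "i = Suc j") auto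
      then show ?thesis using \<alpha> by blast
    next
      case (Cons s w)
      have "\<alpha> = ?u s (\<alpha>(Suc j := w))" using Cons by (simp add: fun_eq_iff)
      moreover have "set (\<alpha> (Suc j)) \<subseteq> {1..n (Suc j)}" using \<alpha> i by (auto simp: mwords_def)
      then have "s \<in> {1..n (Suc j)}" "\<alpha>(Suc j := w) \<in> ?Z j"
        using \<alpha> Cons i by (auto simp: mwords_def)
      ultimately show ?thesis by blast
    qed
  next
    fix \<alpha> assume "\<alpha> \<in> ?Z (Suc j) \<union> (\<Union>s\<in>{1..n (Suc j)}. ?u s ` ?Z j)"
    then show "\<alpha> \<in> ?Z j"
    proof
      assume "\<alpha> \<in> ?Z (Suc j)"
      then show ?thesis by auto
    next
      assume "\<alpha> \<in> (\<Union>s\<in>{1..n (Suc j)}. ?u s ` ?Z j)"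
      then obtain s \<gamma> where s: "s \<in> {1..n (Suc j)}" and \<gamma>: "\<gamma> \<in> ?Z j" and \<alpha>: "\<alpha> = ?u s \<gamma>" by blast
      then have "\<alpha> \<in> mwords k n" using mwords_upd[OF _ i, of \<gamma> n s] by simp
      then show ?thesis using \<gamma> \<alpha> by auto
    qed
  qed
  have disj: "?Z (Suc j) \<inter> (\<Union>s\<in>{1..n (Suc j)}. ?u s ` ?Z j) = {}"
  proof -
    have "\<alpha> (Suc j) = []" if "\<alpha> \<in> ?Z (Suc j)" for \<alpha> using that by simp
    moreover have "\<alpha> (Suc j) \<noteq> []" if "\<alpha> \<in> (\<Union>s\<in>{1..n (Suc j)}. ?u s ` ?Z j)" for \<alpha>
      using that by auto
    ultimately show ?thesis by blast
  qed
  have "infsum ?f (?Z j) = infsum ?f (?Z (Suc j)) + infsum ?f (\<Union>s\<in>{1..n (Suc j)}. ?u s ` ?Z j)"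
    by (subst cover, rule infsum_Un_disjoint) (use summable_on_subset_banach[OF summ] disj in auto)
  also have "infsum ?f (\<Union>s\<in>{1..n (Suc j)}. ?u s ` ?Z j) = (\<Sum>s\<in>{1..n (Suc j)}. infsum ?f (?u s ` ?Z j))"
    by (rule infsum_finite_UN_disjoint[OF _ summ]) (auto dest: fun_cong[where x = "Suc j"])
  also have "\<dots> = (\<Sum>s\<in>{1..n (Suc j)}.
      infsum (\<lambda>\<alpha>. (norm (coord (cadjoint (model_shift k n \<Lambda> (Suc j) s) g) \<alpha>))\<^sup>2) (?Z j))"
  proof (rule sum.cong[OF refl])
    fix s assume s: "s \<in> {1..n (Suc j)}"
    have "infsum ?f (?u s ` ?Z j) = infsum (?f \<circ> ?u s) (?Z j)"
      by (rule infsum_reindex) (rule inj_on_subset[OF inj_cons_upd subset_UNIV])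
    also have "\<dots> = infsum (\<lambda>\<alpha>. (norm (coord (cadjoint (model_shift k n \<Lambda> (Suc j) s) g) \<alpha>))\<^sup>2) (?Z j)"
      by (rule infsum_cong) (simp add: norm_coord_cadjoint_shift[OF i s] del: fun_upd_apply)
    finally show "infsum ?f (?u s ` ?Z j)
      = infsum (\<lambda>\<alpha>. (norm (coord (cadjoint (model_shift k n \<Lambda> (Suc j) s) g) \<alpha>))\<^sup>2) (?Z j)" .
  qed
  finally show ?case
    using Suc by (simp add: defect_form_one_Suc phi_form_def del: defect_form.simps)
qed

lemma defect_form_shift_vacuum:
  assumes g: "g \<in> fock k n E"
  shows "defect_form n (model_shift k n \<Lambda>) (\<lambda>_. 1) (\<lambda>g. \<Sum>\<^sub>\<infinity>\<alpha>\<in>mwords k n. (norm (coord g \<alpha>))\<^sup>2) k g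
    = (norm (coord g (\<lambda>_. [])))\<^sup>2"
proof -
  have "{\<alpha> \<in> mwords k n. \<forall>i\<in>{1..k}. \<alpha> i = []} = {\<lambda>_. []}"
    by (auto simp: mwords_def fun_eq_iff) (metis atLeastAtMost_iff)
  then show ?thesis using defect_form_shift[OF order_refl, of g] by simp
qed

lemma norm_fock_sq:
  assumes "g \<in> fock k n E"
  shows "(norm g)\<^sup>2 = (\<Sum>\<^sub>\<infinity>\<alpha>\<in>mwords k n. (norm (coord g \<alpha>))\<^sup>2)"
  unfolding norm_ell2_sq by (rule infsum_cong_neutral) (use assms in \<open>auto simp: fock_def\<close>)

end

lemma le_on_closure_range:
  fixes f g :: "'a::metric_space \<Rightarrow> real"
  assumes "continuous_on UNIV f" "continuous_on UNIV g" "\<And>x. f (V x) \<le> g (V x)" "y \<in> closure (range V)"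
  shows "f y \<le> g y"
proof -
  obtain h where h: "\<And>m. h m \<in> range V" "h \<longlonglongrightarrow> y" using closure_seqE[OF assms(4)] by blast
  have "(\<lambda>m. f (h m)) \<longlonglongrightarrow> f y" "(\<lambda>m. g (h m)) \<longlonglongrightarrow> g y"
    using continuous_on_tendsto_compose[OF assms(1) h(2)] continuous_on_tendsto_compose[OF assms(2) h(2)] by auto
  moreover have "f (h m) \<le> g (h m)" for m using h(1)[of m] assms(3) by auto
  ultimately show ?thesis using LIMSEQ_le by blast
qed

locale characteristic_tuple = polyball_tuple k n \<Lambda> T H
  for k :: nat and n :: "nat \<Rightarrow> nat" and \<Lambda> :: "nat \<Rightarrow> nat \<Rightarrow> nat \<Rightarrow> nat \<Rightarrow> complex"
    and T :: "'a::complex_hilbert optuple" and H :: "'a set" +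
  fixes E :: "'e::complex_hilbert set" and \<Psi> :: "(mword, 'e) ell2 \<Rightarrow> (mword, 'a) ell2"
  assumes E: "closed_csubspace E"
    and analytic: "multi_analytic k n \<Lambda> E (defect_space k n H T) \<Psi>"
    and factor: "berezin k n H T (cadjoint (berezin k n H T) f) + \<Psi> (cadjoint \<Psi> f)
      = proj (fock k n (defect_space k n H T)) f"
begin

abbreviation "D \<equiv> defect_space k n H T"
abbreviation "Y \<equiv> berezin_codefect k n H T"
abbreviation "V \<equiv> op_sqrt Y"
abbreviation "M \<equiv> model_space k n H T"
abbreviation "N \<equiv> model_tuple k n \<Lambda> H T"
abbreviation "S \<equiv> model_shift k n \<Lambda>"

lemma \<Psi>_bops: "\<Psi> \<in> bops (fock k n E) (fock k n D)"
  using analytic by (simp add: multi_analytic_def)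

lemma bounded_\<Psi>: "bounded_clinear \<Psi>"
  by (rule bopsD(1)[OF \<Psi>_bops])

lemma Y_eq: "Y f = \<Psi> (cadjoint \<Psi> f)"
  unfolding berezin_codefect_def factor[symmetric] by simp

lemma inner_Y: "inner (Y f) f = (norm (cadjoint \<Psi> f))\<^sup>2"
  by (simp add: Y_eq inner_cadjoint[OF bounded_\<Psi>] power2_norm_eq_inner)

lemma pos_op_Y: "pos_op Y"
proof -
  have "bounded_clinear (\<lambda>f. \<Psi> (cadjoint \<Psi> f))"
    by (rule bounded_clinear_compose[OF bounded_\<Psi> bounded_clinear_cadjoint[OF bounded_\<Psi>]])
  moreover have "inner (\<Psi> (cadjoint \<Psi> x)) y = inner x (\<Psi> (cadjoint \<Psi> y))" for x y
    by (simp add: inner_cadjoint[OF bounded_\<Psi>] inner_cadjoint_left[OF bounded_\<Psi>, symmetric])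
  ultimately show ?thesis
    unfolding pos_op_iff using inner_Y by (simp add: Y_eq[abs_def])
qed

lemma Y_bops: "Y \<in> bops (fock k n D) (fock k n D)"
  using bops_compose[OF \<Psi>_bops bops_cadjoint[OF \<Psi>_bops closed_csubspace_fock[OF E] closed_csubspace_fock_defect]]
  by (simp add: Y_eq[abs_def])

lemma model_space_eq: "M = closure (range Y)" "M = closure (range V)"
  by (simp_all add: model_space_def image_bops_eq_range[OF Y_bops closed_csubspace_fock_defect]
      closure_range_op_sqrt pos_op_Y)

lemma closed_csubspace_M: "closed_csubspace M"
  unfolding model_space_eq(1) by (rule closed_csubspace_closure_range[OF pos_opD(1)[OF pos_op_Y]])

lemma V_bops: "V \<in> bops M M"
  unfolding model_space_eq(1) by (rule op_sqrt_bops[OF pos_op_Y])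

lemma bounded_V: "bounded_clinear V"
  by (rule bopsD(1)[OF V_bops])

lemma M_subset: "M \<subseteq> fock k n D"
  unfolding model_space_eq(1)
  by (rule closure_minimal)
    (use bopsD(2)[OF Y_bops] closed_csubspaceD(1)[OF closed_csubspace_fock_defect] in auto)

lemma V_fock: "V \<in> bops (fock k n D) (fock k n D)"
proof (rule bopsI[OF bounded_V closed_csubspace_fock_defect])
  show "V f \<in> fock k n D" for f using bopsD(2)[OF V_bops] M_subset by blast
  show "V (proj (fock k n D) f) = V f" for f
  proof -
    have "V (f - proj (fock k n D) f) = 0"
      using bopsD(3)[OF Y_bops diff_proj_ocomplement[OF closed_csubspace_fock_defect]]
      by (simp add: op_sqrt_eq_0_iff[OF pos_op_Y])
    then show ?thesis by (simp add: bounded_clinear_simps[OF bounded_V])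
  qed
qed

text \<open>This moves norm computations for the model tuple to the Fock space over
  \<open>E\<close>, where the shifts are explicit.\<close>

lemma norm_V: "norm (V f) = norm (cadjoint \<Psi> f)"
proof -
  have "(norm (V f))\<^sup>2 = (norm (cadjoint \<Psi> f))\<^sup>2" by (simp add: norm_op_sqrt_sq[OF pos_op_Y] inner_Y)
  then show ?thesis by simp
qed

lemma cadjoint_\<Psi>_shift:
  assumes i: "i \<in> {1..k}" "s \<in> {1..n i}"
  shows "cadjoint \<Psi> (cadjoint (S i s) f) = cadjoint (model_shift k n \<Lambda> i s) (cadjoint \<Psi> f)"
proof -
  let ?P = "proj (fock k n E)"
  have fE: "closed_csubspace (fock k n E)" by (rule closed_csubspace_fock[OF E])
  \<comment> \<open>Multi-analyticity is assumed only on the Fock space over \<open>E\<close>. The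
    projection onto it can be inserted because \<open>\<Psi>\<close> absorbs it and, being an
    ampliation, it commutes with the shift.\<close>
  have comm: "\<Psi> (model_shift k n \<Lambda> i s g) = S i s (\<Psi> g)" for g
  proof -
    have "\<Psi> (model_shift k n \<Lambda> i s g) = \<Psi> (?P (model_shift k n \<Lambda> i s g))"
      by (simp add: bops_proj[OF \<Psi>_bops fE])
    also have "?P (model_shift k n \<Lambda> i s g) = model_shift k n \<Lambda> i s (?P g)"
      by (simp only: proj_fock[OF E] ampliation_model_shift[OF i bounded_clinear_proj[OF E]])
    also have "\<Psi> \<dots> = S i s (\<Psi> (?P g))"
      using analytic i proj_in[OF fE] by (simp add: multi_analytic_def)
    finally show ?thesis by (simp add: bops_proj[OF \<Psi>_bops fE])
  qed
  show ?thesis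
  proof (subst vector_eq_ldot[symmetric], intro allI)
    fix x
    have "inner x (cadjoint \<Psi> (cadjoint (S i s) f)) = inner (S i s (\<Psi> x)) f"
      by (simp only: inner_cadjoint[OF bounded_\<Psi>] inner_cadjoint[OF bounded_clinear_model_shift[OF i]])
    also have "\<dots> = inner x (cadjoint (model_shift k n \<Lambda> i s) (cadjoint \<Psi> f))"
      by (simp only: comm[symmetric] inner_cadjoint[OF bounded_\<Psi>] inner_cadjoint[OF bounded_clinear_model_shift[OF i]])
    finally show "inner x (cadjoint \<Psi> (cadjoint (S i s) f))
      = inner x (cadjoint (model_shift k n \<Lambda> i s) (cadjoint \<Psi> f))" .
  qed
qed

text \<open>Existence of the operator in the definition of the model tuple is a factorization
  through \<open>V\<close>: since the adjoint of \<open>\<Psi>\<close> intertwines the adjoint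
  shifts, |V S* f| = |S* \<Psi>* f| <= |\<Psi>* f| = |V f|.\<close>

lemma
  assumes i: "i \<in> {1..k}" "s \<in> {1..n i}"
  shows cadjoint_model_tuple_bops: "cadjoint (N i s) \<in> bops M M"
    and cadjoint_model_tuple: "cadjoint (N i s) (V f) = V (cadjoint (S i s) f)"
    and model_tuple_bops: "N i s \<in> bops M M"
proof -
  let ?C = "\<lambda>f. V (cadjoint (S i s) f)"
  note bS = bounded_clinear_cadjoint[OF bounded_clinear_model_shift[OF i]]
  have C: "bounded_clinear ?C" by (rule bounded_clinear_compose[OF bounded_V bS])
  have "norm (?C f) \<le> norm (V f)" for f
    by (simp only: norm_V cadjoint_\<Psi>_shift[OF i] norm_cadjoint_model_shift_le[OF i])
  then obtain A where A: "A \<in> bops (closure (range V)) (closure (range ?C))" "\<And>f. A (V f) = ?C f"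
    using douglas_factorization[OF bounded_V C] by metis
  have "closure (range ?C) \<subseteq> M"
    by (rule closure_minimal) (use bopsD(2)[OF V_bops] closed_csubspaceD(1)[OF closed_csubspace_M] in auto)
  then have AM: "A \<in> bops M M" using A(1) unfolding model_space_eq(2)[symmetric] by (auto simp: bops_def)
  \<comment> \<open>Uniqueness holds since \<open>V\<close> has dense range in \<open>M\<close>; the
    prescribed values on the Fock space suffice because \<open>V\<close> kills its
    complement.\<close>
  have the: "(THE A. A \<in> bops M M \<and> (\<forall>f\<in>fock k n D. A (V f) = V (cadjoint (S i s) f))) = A"
  proof (rule the_equality)
    show "A \<in> bops M M \<and> (\<forall>f\<in>fock k n D. A (V f) = V (cadjoint (S i s) f))" using AM A(2) by blast
    fix B assume B: "B \<in> bops M M \<and> (\<forall>f\<in>fock k n D. B (V f) = V (cadjoint (S i s) f))"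
    have "B (V f) = A (V f)" for f
    proof -
      let ?f = "proj (fock k n D) f"
      have "B (V f) = B (V ?f)" by (simp add: bops_proj[OF V_fock closed_csubspace_fock_defect])
      also have "\<dots> = A (V ?f)" using B A(2) proj_in[OF closed_csubspace_fock_defect] by metis
      finally show ?thesis by (simp add: bops_proj[OF V_fock closed_csubspace_fock_defect])
    qed
    then show "B = A" using bops_eqI_dense[OF _ AM model_space_eq(2) bounded_V] B by blast
  qed
  have N: "N i s = cadjoint A" by (simp add: model_tuple_def the)
  show "N i s \<in> bops M M" unfolding N by (rule bops_cadjoint[OF AM closed_csubspace_M closed_csubspace_M])
  have "cadjoint (N i s) = A" by (simp add: N cadjoint_cadjoint[OF bopsD(1)[OF AM]])
  then show "cadjoint (N i s) \<in> bops M M" "cadjoint (N i s) (V f) = V (cadjoint (S i s) f)"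
    using AM A(2) by auto
qed

lemma bounded_tuple_model: "bounded_tuple k n N"
  by unfold_locales (rule bopsD(1)[OF model_tuple_bops])

interpretation N: bounded_tuple k n N by (rule bounded_tuple_model)

section \<open>Defect of the model tuple\<close>

lemma inner_model_defect:
  "inner (defect k n M N x) x = defect_form n N (\<lambda>_. 1) (\<lambda>h. inner (proj M h) h) k x"
  by (simp add: defect_def N.inner_defect_pow)

text \<open>Two pull-backs: along \<open>V\<close> from the model tuple to the shifts over
  \<open>D\<close>, then along the adjoint of \<open>\<Psi>\<close> to the shifts over
  \<open>E\<close>, whose defect form evaluates the vacuum coordinate.\<close>

lemma inner_model_defect_V: "inner (defect k n M N (V f)) (V f) = (norm (coord (cadjoint \<Psi> f) (\<lambda>_. [])))\<^sup>2"
proof -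
  have in_fock: "cadjoint \<Psi> f \<in> fock k n E" for f
    by (rule bopsD(2)[OF bops_cadjoint[OF \<Psi>_bops closed_csubspace_fock[OF E] closed_csubspace_fock_defect]])
  have "inner (proj M (V f)) (V f) = (\<Sum>\<^sub>\<infinity>\<alpha>\<in>mwords k n. (norm (coord (cadjoint \<Psi> f) \<alpha>))\<^sup>2)" for f
    unfolding norm_fock_sq[OF in_fock, symmetric] norm_V[symmetric]
    by (simp only: proj_idem[OF closed_csubspace_M bopsD(2)[OF V_bops]] power2_norm_eq_inner)
  then have "inner (defect k n M N (V f)) (V f)
      = defect_form n S (\<lambda>_. 1) (\<lambda>f. \<Sum>\<^sub>\<infinity>\<alpha>\<in>mwords k n. (norm (coord (cadjoint \<Psi> f) \<alpha>))\<^sup>2) k f"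
    unfolding inner_model_defect
    by (subst defect_form_transport[of k n N V S k]) (auto simp: cadjoint_model_tuple)
  also have "\<dots> = defect_form n (model_shift k n \<Lambda>) (\<lambda>_. 1)
      (\<lambda>g. \<Sum>\<^sub>\<infinity>\<alpha>\<in>mwords k n. (norm (coord g \<alpha>))\<^sup>2) k (cadjoint \<Psi> f)"
    by (subst defect_form_transport[of k n "model_shift k n \<Lambda>" "cadjoint \<Psi>" S k])
      (auto simp: cadjoint_\<Psi>_shift)
  also have "\<dots> = (norm (coord (cadjoint \<Psi> f) (\<lambda>_. [])))\<^sup>2"
    by (rule defect_form_shift_vacuum[OF in_fock])
  finally show ?thesis .
qed

lemma inner_model_defect_mword_V:
  assumes \<beta>: "\<beta> \<in> mwords k n"
  shows "inner (defect k n M N (mword_adj N k \<beta> (V f))) (mword_adj N k \<beta> (V f))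
    = (norm (coord (cadjoint \<Psi> f) \<beta>))\<^sup>2"
proof -
  have "mword_adj N k \<beta> (V f) = V (mword_adj S k \<beta> f)"
    by (rule mword_adj_transport[OF bounded_tuple_model bounded_tuple_model_shift _ \<beta> order_refl])
      (rule cadjoint_model_tuple)
  moreover have "cadjoint \<Psi> (mword_adj S k \<beta> f) = mword_adj (model_shift k n \<Lambda>) k \<beta> (cadjoint \<Psi> f)"
    by (rule mword_adj_transport[OF bounded_tuple_model_shift bounded_tuple_model_shift _ \<beta> order_refl, symmetric])
      (rule cadjoint_\<Psi>_shift[symmetric])
  ultimately show ?thesis
    by (simp add: inner_model_defect_V norm_coord_mword_adj_shift_vacuum[OF \<beta>])
qed

lemma inner_model_defect_proj:
  "inner (defect k n M N (proj M x)) (proj M x) = inner (defect k n M N x) x"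
proof -
  have "cadjoint (N i s) (proj M h) = proj M (cadjoint (N i s) h)" if "i \<in> {1..k}" "s \<in> {1..n i}" for i s h
    using cadjoint_model_tuple_bops[OF that] bops_proj[OF _ closed_csubspace_M]
      proj_idem[OF closed_csubspace_M bopsD(2)] by metis
  then show ?thesis
    unfolding inner_model_defect
    by (subst defect_form_transport[of k n N "proj M" N k])
      (auto simp: proj_idem[OF closed_csubspace_M proj_in[OF closed_csubspace_M]] inner_proj[OF closed_csubspace_M])
qed

lemma continuous_inner_self: "bounded_clinear A \<Longrightarrow> bounded_clinear B \<Longrightarrow>
    continuous_on UNIV (\<lambda>x. inner (A x) (B x))"
  by (intro continuous_on_inner bounded_clinear_continuous_on)

lemma mword_adj_model_proj:
  assumes "\<beta> \<in> mwords k n"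
  shows "mword_adj N k \<beta> (proj M x) = proj M (mword_adj N k \<beta> x)"
proof (rule mword_adj_transport[OF bounded_tuple_model bounded_tuple_model _ assms order_refl])
  show "cadjoint (N i s) (proj M h) = proj M (cadjoint (N i s) h)" if "i \<in> {1..k}" "s \<in> {1..n i}" for i s h
    using cadjoint_model_tuple_bops[OF that] bops_proj[OF _ closed_csubspace_M]
      proj_idem[OF closed_csubspace_M bopsD(2)] by metis
qed

lemma bounded_model_defect: "bounded_clinear (defect k n M N)"
  using N.selfadjoint_defect_pow[OF closed_csubspace_M order_refl] by (simp add: defect_def selfadjoint_def)

text \<open>Both inequalities are preserved under limits, so they are checked on the vectors V f and
  extended to \<open>M\<close>. There the summability bound says that finitely many squared
  coordinates of \<Psi>* f do not exceed its squared norm.\<close>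

sublocale N: berezin_tuple k n N M
proof
  show "closed_csubspace M" by (rule closed_csubspace_M)
  show "N i s \<in> bops M M" if "i \<in> {1..k}" "s \<in> {1..n i}" for i s by (rule model_tuple_bops[OF that])
  show "0 \<le> inner (defect k n M N h) h" for h
  proof -
    have "0 \<le> inner (defect k n M N (proj M h)) (proj M h)"
      by (rule le_on_closure_range[of "\<lambda>_. 0" "\<lambda>x. inner (defect k n M N x) x" V])
        (use proj_in[OF closed_csubspace_M, of h] in \<open>auto simp: model_space_eq(2)[symmetric] inner_model_defect_V
          intro!: continuous_inner_self bounded_model_defect bounded_clinear_id\<close>)
    then show ?thesis by (simp only: inner_model_defect_proj)
  qed
  fix F :: "mword set" and h assume F: "finite F" "F \<subseteq> mwords k n"
  let ?q = "\<lambda>h. \<Sum>\<beta>\<in>F. inner (defect k n M N (mword_adj N k \<beta> h)) (mword_adj N k \<beta> h)"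
  have "?q (proj M h) \<le> (norm (proj M h))\<^sup>2"
  proof (rule le_on_closure_range[of ?q "\<lambda>x. (norm x)\<^sup>2" V])
    have bounded: "bounded_clinear (mword_adj N k \<beta>)" if "\<beta> \<in> F" for \<beta>
      using N.bounded_clinear_mword_adj F that by blast
    show "continuous_on UNIV ?q"
      by (intro continuous_on_sum continuous_inner_self bounded
          bounded_clinear_compose[OF bounded_model_defect])
    show "continuous_on UNIV (\<lambda>x::(mword, 'a) ell2. (norm x)\<^sup>2)" by (intro continuous_intros)
    show "proj M h \<in> closure (range V)" using proj_in[OF closed_csubspace_M] by (simp add: model_space_eq(2))
    fix f
    have "?q (V f) = (\<Sum>\<beta>\<in>F. (norm (coord (cadjoint \<Psi> f) \<beta>))\<^sup>2)"
      by (rule sum.cong[OF refl]) (use F inner_model_defect_mword_V in blast)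
    also have "\<dots> \<le> (norm (V f))\<^sup>2" unfolding norm_V by (rule sum_coord_le[OF F(1)])
    finally show "?q (V f) \<le> (norm (V f))\<^sup>2" .
  qed
  moreover have "?q (proj M h) = ?q h"
    by (rule sum.cong[OF refl]) (use F in \<open>auto simp: mword_adj_model_proj inner_model_defect_proj\<close>)
  ultimately show "?q h \<le> (norm (proj M h))\<^sup>2" by simp
qed

section \<open>The isometric Berezin kernel of the model tuple and the factorization of Y through
  \<Theta>\<close>

abbreviation "KM \<equiv> berezin k n M N"

lemma norm_KM_V: "norm (KM (V f)) = norm (V f)"
proof -
  have "(norm (coord (KM (V f)) \<beta>))\<^sup>2 = (norm (coord (cadjoint \<Psi> f) \<beta>))\<^sup>2" for \<beta>
  proof (cases "\<beta> \<in> mwords k n")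
    case True
    then show ?thesis
      by (simp add: N.coord_berezin norm_op_sqrt_sq[OF N.pos_op_defect] inner_model_defect_mword_V)
  next
    case False
    moreover have "cadjoint \<Psi> f \<in> fock k n E"
      by (rule bopsD(2)[OF bops_cadjoint[OF \<Psi>_bops closed_csubspace_fock[OF E] closed_csubspace_fock_defect]])
    ultimately show ?thesis by (simp add: N.coord_berezin fock_def)
  qed
  then have "(norm (KM (V f)))\<^sup>2 = (norm (V f))\<^sup>2" by (simp add: norm_ell2_sq norm_V)
  then show ?thesis by simp
qed

lemma norm_KM: "norm (KM x) = norm (proj M x)"
proof -
  have "norm y \<le> norm (KM y)" if "y \<in> M" for y
    by (rule le_on_closure_range[of norm "\<lambda>y. norm (KM y)" V])
      (use that bounded_clinear_continuous_on[OF bopsD(1)[OF N.berezin_bops]]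
        in \<open>auto simp: model_space_eq(2)[symmetric] norm_KM_V intro!: continuous_on_norm continuous_on_id\<close>)
  from this[OF proj_in[OF closed_csubspace_M, of x]] N.norm_berezin_le[of x] show ?thesis
    by (intro antisym) (simp_all add: bops_proj[OF N.berezin_bops closed_csubspace_M])
qed

lemma cadjoint_KM_KM: "cadjoint KM (KM x) = proj M x"
proof -
  note K = bopsD(1)[OF N.berezin_bops]
  have "(\<lambda>x. cadjoint KM (KM x)) = proj M"
  proof (rule selfadjoint_eqI)
    show "bounded_clinear (\<lambda>x. cadjoint KM (KM x))"
      by (rule bounded_clinear_compose[OF bounded_clinear_cadjoint[OF K] K])
    show "inner (cadjoint KM (KM x)) x = inner (proj M x) x" for x
      by (simp add: inner_cadjoint_left[OF K] power2_norm_eq_inner[symmetric] norm_KM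
          norm_proj_sq[OF closed_csubspace_M])
  qed (simp_all add: bounded_clinear_proj closed_csubspace_M inner_proj inner_cadjoint_left[OF K]
      inner_cadjoint[OF K, symmetric])
  then show ?thesis by (rule fun_cong)
qed

abbreviation "\<Theta> \<equiv> char_fun k n \<Lambda> H T"

lemma char_fun_eq: "\<Theta> f = V (cadjoint KM f)"
  by (simp add: char_fun_def)

lemma closed_csubspace_char_dom: "closed_csubspace (char_dom k n \<Lambda> H T)"
  unfolding char_dom_def by (rule N.closed_csubspace_defect_space)

lemma cadjoint_KM_bops: "cadjoint KM \<in> bops (fock k n (char_dom k n \<Lambda> H T)) M"
  unfolding char_dom_def
  by (rule bops_cadjoint[OF N.berezin_bops closed_csubspace_M N.closed_csubspace_fock_defect])

lemma char_fun_bops: "\<Theta> \<in> bops (fock k n (char_dom k n \<Lambda> H T)) (fock k n D)"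
  using bops_compose[OF V_fock cadjoint_KM_bops] by (simp add: char_fun_eq[abs_def])

lemma cadjoint_char_fun: "cadjoint \<Theta> f = KM (V f)"
  using cadjoint_compose[OF bounded_V bounded_clinear_cadjoint[OF bopsD(1)[OF N.berezin_bops]]]
  by (simp add: char_fun_eq[abs_def] cadjoint_cadjoint[OF bopsD(1)[OF N.berezin_bops]] pos_opD(4)[OF pos_op_sqrt[OF pos_op_Y]])

theorem char_fun_cadjoint_char_fun: "\<Theta> (cadjoint \<Theta> f) = Y f"
  by (simp add: cadjoint_char_fun char_fun_eq cadjoint_KM_KM op_sqrt_sqrt[OF pos_op_Y]
      proj_idem[OF closed_csubspace_M bopsD(2)[OF V_bops]])

end

section \<open>Unitary equivalence and coincidence\<close>

lemma norm_unitary_between: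
  assumes W: "unitary_between H H' W" and H: "closed_csubspace H"
  shows "norm (W x) = norm (proj H x)"
proof -
  note D = unitary_betweenD[OF W]
  have "(norm (W x))\<^sup>2 = inner (W x) (W x)" by (simp add: power2_norm_eq_inner)
  also have "\<dots> = inner x (proj H x)" by (simp add: inner_cadjoint[OF D(4)] D(2))
  also have "\<dots> = (norm (proj H x))\<^sup>2" by (simp add: norm_proj_sq[OF H] inner_commute)
  finally show ?thesis by simp
qed

text \<open>Mutually inverse contractions are isometric, since |x| = |W' (W x)| <= |W x| <= |x| on
  \<open>H\<close>; the inverse is then the adjoint.\<close>

lemma unitary_between_contractions:
  assumes H: "closed_csubspace H" and H': "closed_csubspace H'"
    and W: "W \<in> bops H H'" and W': "W' \<in> bops H' H"
    and le: "\<And>x. norm (W x) \<le> norm x" "\<And>y. norm (W' y) \<le> norm y"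
    and inv: "\<And>x. W' (W x) = proj H x" "\<And>y. W (W' y) = proj H' y"
  shows "unitary_between H H' W"
proof -
  note bW = bopsD(1)[OF W]
  have nW: "norm (W x) = norm (proj H x)" for x
    using le(1)[of "proj H x"] le(2)[of "W x"] by (simp add: inv bops_proj[OF W H])
  have "(\<lambda>x. cadjoint W (W x)) = proj H"
  proof (rule selfadjoint_eqI)
    show "bounded_clinear (\<lambda>x. cadjoint W (W x))"
      by (rule bounded_clinear_compose[OF bounded_clinear_cadjoint[OF bW] bW])
    show "inner (cadjoint W (W x)) x = inner (proj H x) x" for x
      by (simp add: inner_cadjoint_left[OF bW] power2_norm_eq_inner[symmetric] nW norm_proj_sq[OF H])
  qed (simp_all add: bounded_clinear_proj H inner_proj inner_cadjoint_left[OF bW]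
      inner_cadjoint[OF bW, symmetric])
  then have WW: "cadjoint W (W x) = proj H x" for x by (rule fun_cong)
  have "cadjoint W y = W' y" for y
  proof -
    have "cadjoint W y = cadjoint W (proj H' y)"
      by (simp add: bops_proj[OF bops_cadjoint[OF W H H'] H'])
    also have "\<dots> = proj H (W' y)" by (simp only: inv(2)[symmetric] WW)
    also have "\<dots> = W' y" by (rule proj_idem[OF H bopsD(2)[OF W']])
    finally show ?thesis .
  qed
  then show ?thesis by (intro unitary_betweenI W WW) (simp add: inv(2))
qed

text \<open>The relation says that K' equals U K W* on \<open>H'\<close>; taking adjoints and
  cancelling the unitary U gives the claim.\<close>

lemma cadjoint_intertwine:
  assumes W: "unitary_between H H' W" and U: "unitary_between G G' U"
    and H: "closed_csubspace H" and H': "closed_csubspace H'" and G: "closed_csubspace G" and G': "closed_csubspace G'"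
    and K: "K \<in> bops H G" and K': "K' \<in> bops H' G'" and rel: "\<And>h. K' (W h) = U (K h)"
  shows "cadjoint K' (U f) = W (cadjoint K f)"
proof -
  note DW = unitary_betweenD[OF W] and DU = unitary_betweenD[OF U]
  have "inner x (cadjoint K' (U f)) = inner x (W (cadjoint K f))" for x
  proof -
    have "K' x = K' (proj H' x)" by (simp add: bops_proj[OF K' H'])
    also have "\<dots> = U (K (cadjoint W x))" by (simp only: DW(3)[symmetric] rel)
    finally have "inner x (cadjoint K' (U f)) = inner (U (K (cadjoint W x))) (U f)"
      by (simp add: inner_cadjoint[OF bopsD(1)[OF K'], symmetric])
    also have "\<dots> = inner (K (cadjoint W x)) (proj G f)"
      by (simp add: inner_cadjoint[OF DU(4)] DU(2))
    also have "\<dots> = inner (K (cadjoint W x)) f"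
      by (simp add: inner_proj[OF G, symmetric] proj_idem[OF G bopsD(2)[OF K]])
    also have "\<dots> = inner x (W (cadjoint K f))"
      by (simp add: inner_cadjoint[OF bopsD(1)[OF K]] inner_cadjoint_left[OF DW(4)])
    finally show ?thesis .
  qed
  then show ?thesis using vector_eq_ldot by blast
qed

text \<open>Conjugating the root of \<open>A'\<close> back by W yields a positive square root of
  \<open>A\<close>, hence the square root by uniqueness.\<close>

lemma op_sqrt_transport:
  assumes W: "unitary_between H H' W" and H: "closed_csubspace H" and H': "closed_csubspace H'"
    and A: "A \<in> bops H H" "pos_op A" and A': "A' \<in> bops H' H'" "pos_op A'"
    and rel: "\<And>h. A' (W h) = W (A h)"
  shows "op_sqrt A' (W h) = W (op_sqrt A h)"
proof -
  note D = unitary_betweenD[OF W]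
  let ?s = "op_sqrt A'"
  note s = pos_opD[OF pos_op_sqrt[OF A'(2)]]
  have sH': "proj H' (?s x) = ?s x" for x
  proof -
    have "closure (range A') \<subseteq> H'"
      by (rule closure_minimal) (use bopsD(2)[OF A'(1)] closed_csubspaceD(1)[OF H'] in auto)
    then show ?thesis using proj_idem[OF H'] bopsD(2)[OF op_sqrt_bops[OF A'(2)]] by blast
  qed
  have "op_sqrt A = (\<lambda>x. cadjoint W (?s (W x)))"
  proof (rule op_sqrt_unique[OF _ _ A(2)])
    show "pos_op (\<lambda>x. cadjoint W (?s (W x)))"
      unfolding pos_op_iff
    proof (intro conjI allI)
      show "bounded_clinear (\<lambda>x. cadjoint W (?s (W x)))"
        by (rule bounded_clinear_compose[OF bounded_clinear_cadjoint[OF D(4)] bounded_clinear_compose[OF s(1) D(4)]])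
      show "inner (cadjoint W (?s (W x))) y = inner x (cadjoint W (?s (W y)))" for x y
        by (simp add: inner_cadjoint_left[OF D(4)] inner_cadjoint[OF D(4), symmetric] s(2))
      show "0 \<le> inner (cadjoint W (?s (W x))) x" for x
        by (simp add: inner_cadjoint_left[OF D(4)] s(3))
    qed
    show "cadjoint W (?s (W (cadjoint W (?s (W x))))) = A x" for x
      by (simp add: D(3) sH' op_sqrt_sqrt[OF A'(2)] rel D(2) proj_idem[OF H bopsD(2)[OF A(1)]])
  qed
  then show ?thesis by (simp add: D(3) sH')
qed

text \<open>W maps the range of \<open>A\<close> into that of \<open>A'\<close>, and its adjoint
  maps back; continuity extends both statements to the closures.\<close>

lemma
  assumes W: "unitary_between H H' W" and H: "closed_csubspace H" and H': "closed_csubspace H'"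
    and A: "A \<in> bops H H" and A': "A' \<in> bops H' H'" and rel: "\<And>h. A' (W h) = W (A h)"
  shows proj_closure_range_transport:
      "proj (closure (range A')) (W x) = W (proj (closure (range A)) x)"
    and unitary_closure_range:
      "unitary_between (closure (range A)) (closure (range A')) (\<lambda>x. W (proj (closure (range A)) x))"
proof -
  let ?D = "closure (range A)" and ?D' = "closure (range A')"
  note U = unitary_betweenD[OF W]
  have D: "closed_csubspace ?D" and D': "closed_csubspace ?D'"
    using closed_csubspace_closure_range bopsD(1) A A' by blast+
  have sub: "?D \<subseteq> H" "?D' \<subseteq> H'"
    using bopsD(2)[OF A] bopsD(2)[OF A'] closed_csubspaceD(1)[OF H] closed_csubspaceD(1)[OF H']
    by (simp_all add: closure_minimal image_subset_iff)
  have WD: "W d \<in> ?D'" if "d \<in> ?D" for d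
  proof -
    have "W ` ?D \<subseteq> closure (W ` range A)"
      by (rule continuous_image_closure_subset[OF bounded_clinear_continuous_on[OF U(4), of UNIV]]) simp
    also have "\<dots> \<subseteq> ?D'" by (rule closure_mono) (auto simp: rel[symmetric])
    finally show ?thesis using that by blast
  qed
  have W'D': "cadjoint W d \<in> ?D" if "d \<in> ?D'" for d
  proof -
    have "cadjoint W (A' y) = A (cadjoint W y)" for y
    proof -
      have "cadjoint W (A' y) = cadjoint W (A' (W (cadjoint W y)))"
        by (simp add: U(3) bops_proj[OF A' H'])
      also have "\<dots> = A (cadjoint W y)" by (simp add: rel U(2) proj_idem[OF H bopsD(2)[OF A]])
      finally show ?thesis .
    qed
    then have "cadjoint W ` range A' \<subseteq> range A" by auto
    moreover have "cadjoint W ` ?D' \<subseteq> closure (cadjoint W ` range A')"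
      by (rule continuous_image_closure_subset[OF bounded_clinear_continuous_on[OF bounded_clinear_cadjoint[OF U(4)], of UNIV]]) simp
    ultimately show ?thesis using that closure_mono by blast
  qed
  show pr: "proj ?D' (W x) = W (proj ?D x)" for x
  proof (rule proj_unique[OF D' WD[OF proj_in[OF D]]])
    fix z assume z: "z \<in> ?D'"
    have "inner (W x - W (proj ?D x)) z = inner (x - proj ?D x) (cadjoint W z)"
      by (simp add: bounded_clinear_simps(2)[OF U(4), symmetric] inner_cadjoint[OF U(4)])
    then show "inner (W x - W (proj ?D x)) z = 0" using proj_orth[OF D W'D'[OF z]] by simp
  qed
  have adj: "cadjoint (\<lambda>x. W (proj ?D x)) y = proj ?D (cadjoint W y)" for y
    using cadjoint_compose[OF U(4) bounded_clinear_proj[OF D]] by (simp add: cadjoint_proj[OF D])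
  note pH = proj_idem[OF H subsetD[OF sub(1) proj_in[OF D]]]
  show "unitary_between ?D ?D' (\<lambda>x. W (proj ?D x))"
  proof (rule unitary_betweenI)
    show "(\<lambda>x. W (proj ?D x)) \<in> bops ?D ?D'"
      by (rule bopsI[OF bounded_clinear_compose[OF U(4) bounded_clinear_proj[OF D]] D])
        (simp_all add: WD proj_in[OF D] proj_idem[OF D proj_in[OF D]])
    show "cadjoint (\<lambda>x. W (proj ?D x)) (W (proj ?D x)) = proj ?D x" for x
      by (simp add: adj U(2) pH proj_idem[OF D proj_in[OF D]])
    show "W (proj ?D (cadjoint (\<lambda>x. W (proj ?D x)) y)) = proj ?D' y" for y
    proof -
      have "W (proj ?D (cadjoint (\<lambda>x. W (proj ?D x)) y)) = proj ?D' (proj H' y)"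
        unfolding adj proj_idem[OF D proj_in[OF D]] by (simp only: pr[symmetric] U(3))
      also have "\<dots> = proj ?D' y"
      proof (rule proj_unique[OF D' proj_in[OF D'], symmetric])
        fix z assume z: "z \<in> ?D'"
        have "inner (y - proj H' y) z = 0" "inner (proj H' y - proj ?D' (proj H' y)) z = 0"
          using proj_orth[OF H'] proj_orth[OF D' z] sub(2) z by blast+
        then show "inner (y - proj ?D' (proj H' y)) z = 0" by (simp add: inner_diff_left)
      qed
      finally show ?thesis .
    qed
  qed
qed

text \<open>Instantiated twice: for the given tuples, and for their model tuples with the unitary
  induced on the model spaces.\<close>

locale tuple_equivalence = A: berezin_tuple k n T H + B: berezin_tuple k n T' H'
  for k :: nat and n :: "nat \<Rightarrow> nat" and T :: "'a::complex_hilbert optuple" and H :: "'a set"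
    and T' :: "'b::complex_hilbert optuple" and H' :: "'b set" +
  fixes W :: "'a \<Rightarrow> 'b"
  assumes W: "unitary_between H H' W"
    and cadjoint_W: "\<lbrakk>i \<in> {1..k}; s \<in> {1..n i}\<rbrakk> \<Longrightarrow> cadjoint (T' i s) (W h) = W (cadjoint (T i s) h)"
begin

lemmas WD = unitary_betweenD[OF W]

text \<open>The defect forms correspond by transport along W, and polarization makes the operators
  correspond.\<close>

lemma defect_W: "defect k n H' T' (W h) = W (defect k n H T h)"
proof -
  have "inner (proj H' (W h)) (W h) = inner (proj H h) h" for h
    using proj_idem[OF B.H bopsD(2)[OF WD(1)]] norm_unitary_between[OF W A.H]
    by (simp add: power2_norm_eq_inner[symmetric] norm_proj_sq[OF A.H, symmetric])
  then have form: "inner (defect k n H' T' (W h)) (W h) = inner (defect k n H T h) h" for h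
    unfolding A.inner_defect B.inner_defect
    by (subst defect_form_transport[of k n T' W T k]) (auto simp: cadjoint_W)
  note a = pos_opD[OF A.pos_op_defect] and b = pos_opD[OF B.pos_op_defect]
  have "(\<lambda>h. cadjoint W (defect k n H' T' (W h))) = defect k n H T"
  proof (rule selfadjoint_eqI)
    show "bounded_clinear (\<lambda>x. cadjoint W (defect k n H' T' (W x)))"
      by (rule bounded_clinear_compose[OF bounded_clinear_cadjoint[OF WD(4)] bounded_clinear_compose[OF b(1) WD(4)]])
    show "inner (cadjoint W (defect k n H' T' (W x))) y = inner x (cadjoint W (defect k n H' T' (W y)))" for x y
      by (simp add: inner_cadjoint_left[OF WD(4)] inner_cadjoint[OF WD(4), symmetric] b(2))
    show "inner (cadjoint W (defect k n H' T' (W x))) x = inner (defect k n H T x) x" for x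
      by (simp add: inner_cadjoint_left[OF WD(4)] form)
  qed (rule a)+
  then have "W (defect k n H T h) = W (cadjoint W (defect k n H' T' (W h)))" by metis
  then show ?thesis by (simp add: WD(3) proj_idem[OF B.H bopsD(2)[OF B.defect_bops]])
qed

lemma proj_defect_space_W:
  "proj (defect_space k n H' T') (W x) = W (proj (defect_space k n H T) x)"
  unfolding A.defect_space_eq B.defect_space_eq
  by (rule proj_closure_range_transport[OF W A.H B.H A.defect_bops B.defect_bops defect_W])

lemma unitary_defect_space:
  "unitary_between (defect_space k n H T) (defect_space k n H' T') (\<lambda>x. W (proj (defect_space k n H T) x))"
  unfolding A.defect_space_eq B.defect_space_eq
  by (rule unitary_closure_range[OF W A.H B.H A.defect_bops B.defect_bops defect_W])

lemma berezin_W: "berezin k n H' T' (W h) = ampliation k n W (berezin k n H T h)"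
proof (rule ell2_eqI)
  fix \<beta>
  have "mword_adj T' k \<beta> (W h) = W (mword_adj T k \<beta> h)" if "\<beta> \<in> mwords k n"
    by (rule mword_adj_transport[OF B.bounded_tuple_axioms A.bounded_tuple_axioms _ that order_refl])
      (rule cadjoint_W)
  then show "coord (berezin k n H' T' (W h)) \<beta> = coord (ampliation k n W (berezin k n H T h)) \<beta>"
    by (simp add: B.coord_berezin A.coord_berezin coord_ampliation[OF WD(4)]
        op_sqrt_transport[OF W A.H B.H A.defect_bops A.pos_op_defect B.defect_bops B.pos_op_defect defect_W])
qed

text \<open>The kernels are regarded as maps into the Fock spaces over all of \<open>H\<close> and
  \<open>H'\<close>, between which the ampliation of W is unitary without being cut down to the
  defect spaces.\<close>

lemma cadjoint_berezin_W:
  "cadjoint (berezin k n H' T') (ampliation k n W f) = W (cadjoint (berezin k n H T) f)"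
proof (rule cadjoint_intertwine[of H H' W "fock k n H" "fock k n H'" "ampliation k n W"
      "berezin k n H T" "berezin k n H' T'"])
  show "berezin k n H T \<in> bops H (fock k n H)"
    using A.berezin_bops A.defect_space_subset by (fastforce simp: bops_def fock_def)
  show "berezin k n H' T' \<in> bops H' (fock k n H')"
    using B.berezin_bops B.defect_space_subset by (fastforce simp: bops_def fock_def)
qed (simp_all add: closed_csubspace_fock A.H B.H W unitary_ampliation berezin_W)

end

section \<open>From unitary equivalence to coincidence\<close>

theorem unitarily_equivalent_imp_coincide:
  assumes X: "characteristic_tuple k n \<Lambda> T H E \<Psi>" and X': "characteristic_tuple k n \<Lambda> T' H' E' \<Psi>'"
    and ue: "unitarily_equivalent k n H T H' T'"
  shows "coincide k n
      (char_dom k n \<Lambda> H T) (defect_space k n H T) (char_fun k n \<Lambda> H T)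
      (char_dom k n \<Lambda> H' T') (defect_space k n H' T') (char_fun k n \<Lambda> H' T')"
proof -
  interpret A: characteristic_tuple k n \<Lambda> T H E \<Psi> by fact
  interpret B: characteristic_tuple k n \<Lambda> T' H' E' \<Psi>' by fact
  obtain W where W: "unitary_between H H' W"
    and rel: "\<And>i s. i \<in> {1..k} \<Longrightarrow> s \<in> {1..n i} \<Longrightarrow> T i s = cadjoint W \<circ> T' i s \<circ> W"
    using ue unfolding unitarily_equivalent_def by blast
  note WD = unitary_betweenD[OF W]
  have rel': "cadjoint (T' i s) (W h) = W (cadjoint (T i s) h)" if i: "i \<in> {1..k}" "s \<in> {1..n i}" for i s h
  proof -
    note b = B.tuple_bops[OF i]
    have "inner (T i s x) y = inner x (cadjoint W (cadjoint (T' i s) (W y)))" for x y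
      by (simp add: rel[OF i] inner_cadjoint_left[OF WD(4)] inner_cadjoint[OF bopsD(1)[OF b]] inner_cadjoint[OF WD(4)])
    then have "cadjoint (T i s) = (\<lambda>y. cadjoint W (cadjoint (T' i s) (W y)))"
      by (rule cadjoint_eqI[OF A.bounded[OF i]])
    then show ?thesis
      by (simp add: WD(3) proj_idem[OF B.H bopsD(2)[OF bops_cadjoint[OF b B.H B.H]]])
  qed
  interpret TE: tuple_equivalence k n T H T' H' W
    by unfold_locales (rule W, rule rel')
  let ?U = "ampliation k n W"
  have fH: "closed_csubspace (fock k n H)" and fH': "closed_csubspace (fock k n H')"
    by (simp_all add: closed_csubspace_fock A.H B.H)
  have U: "unitary_between (fock k n H) (fock k n H') ?U" by (rule unitary_ampliation[OF W A.H B.H])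
  have YU: "berezin_codefect k n H' T' (?U f) = ?U (berezin_codefect k n H T f)" for f
  proof -
    have "proj (fock k n (defect_space k n H' T')) (?U f) = ?U (proj (fock k n (defect_space k n H T)) f)"
      by (rule ell2_eqI)
        (simp add: proj_fock A.closed_csubspace_defect_space B.closed_csubspace_defect_space
          coord_ampliation bounded_clinear_proj WD(4) TE.proj_defect_space_W)
    then show ?thesis
      by (simp add: berezin_codefect_def TE.cadjoint_berezin_W TE.berezin_W
          bounded_clinear_simps[OF bounded_clinear_ampliation[OF WD(4)]])
  qed
  \<comment> \<open>The codefect lives over the defect space but is re-read over \<open>H\<close>,
    because \<open>?U\<close> is unitary between the larger Fock spaces.\<close>
  have "A.Y \<in> bops (fock k n H) (fock k n H)"
  proof (rule bopsI[OF bopsD(1)[OF A.Y_bops] fH])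
    show sub: "A.Y x \<in> fock k n H" for x
      using bopsD(2)[OF A.Y_bops, of x] A.defect_space_subset by (auto simp: fock_def)
    have "inner (A.Y (proj (fock k n H) x)) y = inner (A.Y x) y" for x y
      using sub by (simp add: pos_opD(2)[OF A.pos_op_Y] inner_proj[OF fH] proj_idem[OF fH])
    then show "A.Y (proj (fock k n H) x) = A.Y x" for x using vector_eq_rdot by blast
  qed
  moreover have "B.Y \<in> bops (fock k n H') (fock k n H')"
  proof (rule bopsI[OF bopsD(1)[OF B.Y_bops] fH'])
    show sub: "B.Y x \<in> fock k n H'" for x
      using bopsD(2)[OF B.Y_bops, of x] B.defect_space_subset by (auto simp: fock_def)
    have "inner (B.Y (proj (fock k n H') x)) y = inner (B.Y x) y" for x y
      using sub by (simp add: pos_opD(2)[OF B.pos_op_Y] inner_proj[OF fH'] proj_idem[OF fH'])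
    then show "B.Y (proj (fock k n H') x) = B.Y x" for x using vector_eq_rdot by blast
  qed
  ultimately have Y: "A.Y \<in> bops (fock k n H) (fock k n H)" "B.Y \<in> bops (fock k n H') (fock k n H')" by auto
  have VU: "B.V (?U f) = ?U (A.V f)" for f
    by (rule op_sqrt_transport[OF U fH fH' Y(1) A.pos_op_Y Y(2) B.pos_op_Y YU])
  \<comment> \<open>The restriction of \<open>?U\<close> to the model space, extended by zero as the
    encoding of operators demands; \<open>?u1\<close> and \<open>?u2\<close> below are restricted
    likewise.\<close>
  define w where "w = (\<lambda>x. ?U (proj A.M x))"
  have w: "unitary_between A.M B.M w"
    unfolding w_def A.model_space_eq(1) B.model_space_eq(1)
    by (rule unitary_closure_range[OF U fH fH' Y YU])
  note wD = unitary_betweenD[OF w]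
  have wV: "w (A.V f) = ?U (A.V f)" for f
    by (simp add: w_def proj_idem[OF A.closed_csubspace_M bopsD(2)[OF A.V_bops]])
  \<comment> \<open>On the dense vectors V f the model operators are expressed through shifts, with
    which the ampliation commutes.\<close>
  have "cadjoint (B.N i s) (w h) = w (cadjoint (A.N i s) h)" if i: "i \<in> {1..k}" "s \<in> {1..n i}" for i s h
  proof -
    have "(\<lambda>h. cadjoint (B.N i s) (w h)) = (\<lambda>h. w (cadjoint (A.N i s) h))"
    proof (rule bops_eqI_dense[OF _ _ A.model_space_eq(2) A.bounded_V])
      show "(\<lambda>h. cadjoint (B.N i s) (w h)) \<in> bops A.M B.M"
        by (rule bops_compose[OF B.cadjoint_model_tuple_bops[OF i] wD(1)])
      show "(\<lambda>h. w (cadjoint (A.N i s) h)) \<in> bops A.M B.M"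
        by (rule bops_compose[OF wD(1) A.cadjoint_model_tuple_bops[OF i]])
      show "cadjoint (B.N i s) (w (A.V f)) = w (cadjoint (A.N i s) (A.V f))" for f
        by (simp add: wV VU[symmetric] B.cadjoint_model_tuple[OF i] A.cadjoint_model_tuple[OF i]
            A.ampliation_cadjoint_model_shift[OF i WD(4), symmetric])
    qed
    then show ?thesis by (rule fun_cong)
  qed
  then interpret NE: tuple_equivalence k n A.N A.M B.N B.M w
    by unfold_locales (rule w)
  let ?D = "defect_space k n H T" and ?DM = "char_dom k n \<Lambda> H T"
  let ?u1 = "\<lambda>x. w (proj ?DM x)" and ?u2 = "\<lambda>x. W (proj ?D x)"
  have "B.\<Theta> (ampliation k n ?u1 f) = ampliation k n ?u2 (A.\<Theta> f)" if f: "f \<in> fock k n ?DM" for f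
  proof -
    have "ampliation k n ?u1 f = ampliation k n w f"
      using f by (intro ell2_eqI) (simp add: coord_ampliation wD(4)
          bounded_clinear_compose[OF wD(4) bounded_clinear_proj[OF A.closed_csubspace_char_dom]]
          fock_def proj_idem[OF A.closed_csubspace_char_dom])
    then have "B.\<Theta> (ampliation k n ?u1 f) = B.V (w (cadjoint A.KM f))"
      by (simp add: B.char_fun_eq NE.cadjoint_berezin_W)
    also have "\<dots> = ?U (A.V (cadjoint A.KM f))"
      by (simp add: w_def VU bops_proj[OF A.V_bops A.closed_csubspace_M])
    also have "\<dots> = ?U (A.\<Theta> f)" by (simp add: A.char_fun_eq)
    also have "\<dots> = ampliation k n ?u2 (A.\<Theta> f)"
      using bopsD(2)[OF A.char_fun_bops, of f]
      by (intro ell2_eqI) (simp add: coord_ampliation WD(4)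
          bounded_clinear_compose[OF WD(4) bounded_clinear_proj[OF A.closed_csubspace_defect_space]]
          fock_def proj_idem[OF A.closed_csubspace_defect_space])
    finally show ?thesis .
  qed
  moreover have "unitary_between ?DM (char_dom k n \<Lambda> H' T') ?u1"
    using NE.unitary_defect_space by (simp add: char_dom_def)
  ultimately show ?thesis
    unfolding coincide_def using TE.unitary_defect_space by blast
qed

section \<open>From coincidence back to unitary equivalence\<close>

lemma closure_range_cadjoint_berezin:
  assumes "polyball_tuple k n \<Lambda> T H" "completely_non_coisometric k n H T"
  shows "closure (range (cadjoint (berezin k n H T))) = H"
proof (rule antisym)
  interpret polyball_tuple k n \<Lambda> T H by fact
  note K = berezin_bops
  note K' = bops_cadjoint[OF K H closed_csubspace_fock_defect]
  show "closure (range (cadjoint (berezin k n H T))) \<subseteq> H"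
    by (rule closure_minimal) (use bopsD(2)[OF K'] closed_csubspaceD(1)[OF H] in auto)
  show "H \<subseteq> closure (range (cadjoint (berezin k n H T)))"
  proof
    fix h assume h: "h \<in> H"
    show "h \<in> closure (range (cadjoint (berezin k n H T)))"
    proof (rule in_closure_rangeI[OF bopsD(1)[OF K']])
      \<comment> \<open>Density of the range is dual to injectivity of the kernel on
        \<open>H\<close>; here complete non-coisometry enters.\<close>
      fix z assume "cadjoint (cadjoint (berezin k n H T)) z = 0"
      then have "berezin k n H T (proj H z) = 0"
        by (simp add: cadjoint_cadjoint[OF bopsD(1)[OF K]] bops_proj[OF K H])
      then have "proj H z = 0" by (rule berezin_eq_0[OF assms(2) proj_in[OF H]])
      then show "inner h z = 0" using inner_proj[OF H, of h z] by (simp add: proj_idem[OF H h])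
    qed
  qed
qed

theorem coincide_imp_unitarily_equivalent:
  assumes X: "characteristic_tuple k n \<Lambda> T H E \<Psi>" and X': "characteristic_tuple k n \<Lambda> T' H' E' \<Psi>'"
    and cnc: "completely_non_coisometric k n H T" "completely_non_coisometric k n H' T'"
    and co: "coincide k n
      (char_dom k n \<Lambda> H T) (defect_space k n H T) (char_fun k n \<Lambda> H T)
      (char_dom k n \<Lambda> H' T') (defect_space k n H' T') (char_fun k n \<Lambda> H' T')"
  shows "unitarily_equivalent k n H T H' T'"
proof -
  interpret A: characteristic_tuple k n \<Lambda> T H E \<Psi> by fact
  interpret B: characteristic_tuple k n \<Lambda> T' H' E' \<Psi>' by fact
  let ?C = "char_dom k n \<Lambda> H T" and ?C' = "char_dom k n \<Lambda> H' T'"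
  let ?K = "berezin k n H T" and ?K' = "berezin k n H' T'"
  obtain u1 u2 where u1: "unitary_between ?C ?C' u1" and u2: "unitary_between A.D B.D u2"
    and eq: "\<And>f. f \<in> fock k n ?C \<Longrightarrow> B.\<Theta> (ampliation k n u1 f) = ampliation k n u2 (A.\<Theta> f)"
    using co unfolding coincide_def by blast
  let ?F = "fock k n A.D" and ?F' = "fock k n B.D"
  let ?U1 = "ampliation k n u1" and ?U2 = "ampliation k n u2"
  note F = A.closed_csubspace_fock_defect and F' = B.closed_csubspace_fock_defect
  note fC = closed_csubspace_fock[OF A.closed_csubspace_char_dom, of k n]
    and fC' = closed_csubspace_fock[OF B.closed_csubspace_char_dom, of k n]
  have U1: "unitary_between (fock k n ?C) (fock k n ?C') ?U1"
    by (rule unitary_ampliation[OF u1 A.closed_csubspace_char_dom B.closed_csubspace_char_dom])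
  have U2: "unitary_between ?F ?F' ?U2"
    by (rule unitary_ampliation[OF u2 A.closed_csubspace_defect_space B.closed_csubspace_defect_space])
  note U1D = unitary_betweenD[OF U1] and U2D = unitary_betweenD[OF U2]
  have \<Theta>U: "B.\<Theta> (?U1 f) = ?U2 (A.\<Theta> f)" for f
    using eq[OF proj_in[OF fC], of f] by (simp add: bops_proj[OF U1D(1) fC] bops_proj[OF A.char_fun_bops fC])
  have "cadjoint B.\<Theta> (?U2 f) = ?U1 (cadjoint A.\<Theta> f)" for f
    by (rule cadjoint_intertwine[OF U1 U2 fC fC' F F' A.char_fun_bops B.char_fun_bops \<Theta>U])
  \<comment> \<open>In the product of \<Theta> with its adjoint \<open>?U1\<close> cancels, so
    \<open>u2\<close> alone carries one codefect to the other.\<close>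
  then have YU: "B.Y (?U2 f) = ?U2 (A.Y f)" for f
    by (simp only: A.char_fun_cadjoint_char_fun[symmetric] B.char_fun_cadjoint_char_fun[symmetric] \<Theta>U)
  have KKU: "?K' (cadjoint ?K' (?U2 f)) = ?U2 (?K (cadjoint ?K f))" for f
  proof -
    have "?K' (cadjoint ?K' (?U2 f)) = ?U2 f - B.Y (?U2 f)"
      by (simp add: berezin_codefect_def proj_idem[OF F' bopsD(2)[OF U2D(1)]])
    also have "\<dots> = ?U2 (proj ?F f - A.Y f)"
      by (simp add: YU bounded_clinear_simps[OF U2D(4)] bops_proj[OF U2D(1) F])
    also have "\<dots> = ?U2 (?K (cadjoint ?K f))" by (simp add: berezin_codefect_def)
    finally show ?thesis .
  qed
  note K = A.berezin_bops and K' = B.berezin_bops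
  note bK = bopsD(1)[OF K] and bK' = bopsD(1)[OF K']
  let ?B = "cadjoint ?K" and ?G = "\<lambda>f. cadjoint ?K' (?U2 f)"
  have bB: "bounded_clinear ?B" by (rule bounded_clinear_cadjoint[OF bK])
  have bG: "bounded_clinear ?G" by (rule bounded_clinear_compose[OF bounded_clinear_cadjoint[OF bK'] U2D(4)])
  \<comment> \<open>Equality of norms makes \<open>?B\<close> f \<mapsto> \<open>?G\<close> f
    isometric in both directions, as the two factorizations below require.\<close>
  have nrm: "norm (?G f) = norm (?B f)" for f
  proof -
    have "(norm (?G f))\<^sup>2 = inner (?K' (?G f)) (?U2 f)"
      by (simp add: power2_norm_eq_inner inner_cadjoint[OF bK'])
    also have "\<dots> = inner (?K (?B f)) (proj ?F f)"
      by (simp add: KKU inner_cadjoint[OF U2D(4)] U2D(2))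
    also have "\<dots> = inner (?K (?B f)) f"
      by (simp add: inner_proj[OF F, symmetric] proj_idem[OF F bopsD(2)[OF K]])
    also have "\<dots> = (norm (?B f))\<^sup>2" by (simp add: power2_norm_eq_inner inner_cadjoint[OF bK])
    finally show ?thesis by simp
  qed
  have cB: "closure (range ?B) = H"
    by (rule closure_range_cadjoint_berezin[OF A.polyball_tuple_axioms cnc(1)])
  \<comment> \<open>\<open>?U2\<close> maps onto the Fock space on which the adjoint of
    \<open>?K'\<close> lives, so composing with it loses nothing of the range.\<close>
  have "range ?G = range (cadjoint ?K')"
  proof (intro antisym subsetI)
    fix y assume "y \<in> range (cadjoint ?K')"
    then obtain g where "y = cadjoint ?K' g" by blast
    then have "y = ?G (cadjoint ?U2 g)"
      by (simp add: U2D(3) bops_proj[OF bops_cadjoint[OF K' B.H F'] F'])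
    then show "y \<in> range ?G" by blast
  qed auto
  then have cG: "closure (range ?G) = H'"
    using closure_range_cadjoint_berezin[OF B.polyball_tuple_axioms cnc(2)] by simp
  obtain W where W: "W \<in> bops H H'" and WB: "\<And>f. W (?B f) = ?G f" and nW: "\<And>x. norm (W x) \<le> norm x"
    using douglas_factorization[OF bB bG] nrm unfolding cB cG by (metis order_refl)
  obtain W' where W': "W' \<in> bops H' H" and WG: "\<And>f. W' (?G f) = ?B f" and nW': "\<And>x. norm (W' x) \<le> norm x"
    using douglas_factorization[OF bG bB] nrm unfolding cB cG by (metis order_refl)
  have "(\<lambda>x. W' (W x)) = proj H"
    by (rule bops_eqI_dense[OF bops_compose[OF W' W] proj_bops[OF A.H] cB[symmetric] bB])
      (simp add: WB WG proj_idem[OF A.H bopsD(2)[OF bops_cadjoint[OF K A.H F]]])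
  moreover have "(\<lambda>x. W (W' x)) = proj H'"
    by (rule bops_eqI_dense[OF bops_compose[OF W W'] proj_bops[OF B.H] cG[symmetric] bG])
      (simp add: WB WG proj_idem[OF B.H bopsD(2)[OF bops_cadjoint[OF K' B.H F']]])
  ultimately have unitary: "unitary_between H H' W"
    by (intro unitary_between_contractions[OF A.H B.H W W' nW nW']) (simp_all add: fun_eq_iff)
  note WD = unitary_betweenD[OF unitary]
  have "T i s = cadjoint W \<circ> T' i s \<circ> W" if i: "i \<in> {1..k}" "s \<in> {1..n i}" for i s
  proof -
    \<comment> \<open>On the dense range of \<open>?B\<close> the tuples act through shifts of the
      argument f, and shifts commute with the ampliation of \<open>u2\<close>.\<close>
    have "(\<lambda>x. W (T i s x)) = (\<lambda>x. T' i s (W x))"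
    proof (rule bops_eqI_dense[OF bops_compose[OF W A.tuple_bops[OF i]] bops_compose[OF B.tuple_bops[OF i] W]
          cB[symmetric] bB])
      show "W (T i s (?B f)) = T' i s (W (?B f))" for f
        by (simp only: A.cadjoint_berezin_model_shift[OF i, symmetric] WB
            A.ampliation_model_shift[OF i unitary_betweenD(4)[OF u2]] B.cadjoint_berezin_model_shift[OF i])
    qed
    then have "T' i s (W x) = W (T i s x)" for x by metis
    then show ?thesis
      by (simp add: fun_eq_iff WD(2) proj_idem[OF A.H bopsD(2)[OF A.tuple_bops[OF i]]])
  qed
  then show ?thesis unfolding unitarily_equivalent_def using unitary by blast
qed

theorem theorem5p7:
  fixes k :: nat and n :: "nat \<Rightarrow> nat"
    and \<Lambda> :: "nat \<Rightarrow> nat \<Rightarrow> nat \<Rightarrow> nat \<Rightarrow> complex"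
    and H :: "'h::complex_hilbert set" and T :: "'h optuple"
    and H' :: "'g::complex_hilbert set" and T' :: "'g optuple"
  assumes "k \<ge> 1"
    and "\<forall>i\<in>{1..k}. n i \<ge> 1"
    and "\<forall>i\<in>{1..k}. \<forall>j\<in>{1..k}. i \<noteq> j \<longrightarrow> (\<forall>s\<in>{1..n i}. \<forall>t\<in>{1..n j}.
          cmod (\<Lambda> i j s t) = 1 \<and> \<Lambda> j i t s = cnj (\<Lambda> i j s t))"
    and "closed_csubspace H" and "closed_csubspace H'"
    and "T \<in> polyball k n \<Lambda> H" and "T' \<in> polyball k n \<Lambda> H'"
    and "completely_non_coisometric k n H T" and "completely_non_coisometric k n H' T'"
    and "admits_char_fun TYPE('e::complex_hilbert) k n \<Lambda> H T"
    and "admits_char_fun TYPE('f::complex_hilbert) k n \<Lambda> H' T'"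
  shows "unitarily_equivalent k n H T H' T' \<longleftrightarrow>
    coincide k n
      (char_dom k n \<Lambda> H T) (defect_space k n H T) (char_fun k n \<Lambda> H T)
      (char_dom k n \<Lambda> H' T') (defect_space k n H' T') (char_fun k n \<Lambda> H' T')"
proof -
  have ph: "phase_matrices k n \<Lambda>" by unfold_locales (use assms(3) in blast)
  \<comment> \<open>The witnesses give the factorization of Y; the characteristic function itself is
    built from T alone and does not depend on their choice.\<close>
  obtain E :: "'e set" and \<Psi> where \<Psi>: "closed_csubspace E"
    "multi_analytic k n \<Lambda> E (defect_space k n H T) \<Psi>"
    "\<And>f. berezin k n H T (cadjoint (berezin k n H T) f) + \<Psi> (cadjoint \<Psi> f)
        = proj (fock k n (defect_space k n H T)) f"
    using assms(10) unfolding admits_char_fun_def by blast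
  obtain E' :: "'f set" and \<Psi>' where \<Psi>': "closed_csubspace E'"
    "multi_analytic k n \<Lambda> E' (defect_space k n H' T') \<Psi>'"
    "\<And>f. berezin k n H' T' (cadjoint (berezin k n H' T') f) + \<Psi>' (cadjoint \<Psi>' f)
        = proj (fock k n (defect_space k n H' T')) f"
    using assms(11) unfolding admits_char_fun_def by blast
  have X: "characteristic_tuple k n \<Lambda> T H E \<Psi>" and X': "characteristic_tuple k n \<Lambda> T' H' E' \<Psi>'"
    using ph assms(4-7) \<Psi> \<Psi>'
    by (simp_all add: characteristic_tuple_def characteristic_tuple_axioms_def polyball_tuple_def
        polyball_tuple_axioms_def)
  show ?thesis
    using unitarily_equivalent_imp_coincide[OF X X']
      coincide_imp_unitarily_equivalent[OF X X' assms(8,9)] by blast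
qed

end
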